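(* Let $g$ be a real analytic function on $(-1,1)$ with real Taylor coefficients $(g_n)_{n\ge0}$ at $0$ (finitely many of which may be negative), and assume that $(g_n)_{n\ge0}$ is regularly varying of index $\gamma-1$, not summable and tends to $0$ at infinity. Let $F$ be a distribution function with negative mean $\mu$, whose upper tail $\overline F=1-F$ is regularly varying with index $-\alpha$, and satisfying the tail balance condition $$\lim_{t\to\infty}\frac{\overline F(t)}{\overline F_*(t)}\in(0,\infty)\quad\text{and}\quad\lim_{t\to\infty}\frac{F(-t)}{\overline F_*(t)}\in[0,\infty),$$ where $F_*$ is the distribution function of $|X_1|$, with $X_1$ having distribution function $F$, and $\overline F_*=1-F_*$. If $1/\alpha<\gamma<1$, then the maximum $M$ of the corresponding $(g,F)$-process satisfies $$P\{M>t\}\sim\frac1\gamma B\Bigl(\frac1\gamma,\alpha-\frac1\gamma\Bigr)\Bigl(\frac{\Gamma(1+\gamma)}{-\mu}\Bigr)^{1/\gamma}U(t)\bigl((g^* )^\alpha\overline F(t)+(-g_* )^\alpha F(-t)\bigr)$$ as $t\to\infty$.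
   Context: $(g,F)$-process: let $g(x)=\sum_{i\ge0}g_ix^i$ on $(-1,1)$ and let $(X_n)_{n\ge1}$ be independent random variables with common distribution function $F$ (with finite mean $\mu$); set $S_n=\sum_{0\le i<n}g_iX_{n-i}$ for $n\ge0$ (so $S_0=0$) and $M=\sup_{n\ge0}S_n$. A sequence $(g_n)$ is regularly varying of index $\gamma-1$ if it is ultimately positive and $g_{\lfloor\lambda n\rfloor}/g_n\to\lambda^{\gamma-1}$ as $n\to\infty$ for every $\lambda>0$. The tail $\overline F$ is regularly varying with index $-\alpha$ if $\overline F(\lambda t)/\overline F(t)\to\lambda^{-\alpha}$ as $t\to\infty$ for every $\lambda>0$. $g^*=\sup_{i\ge0}g_i$ and $g_*=\min\{0,\inf_{i\ge0}g_i\}$. $U$ is a regularly varying function of index $1/\gamma$ such that $g(1-1/U(t))\sim t$ as $t\to\infty$ (unique up to asymptotic equivalence). $\Gamma$ is the gamma function and $B(p,q)=\int_0^1u^{p-1}(1-u)^{q-1}\,du$. *)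

theory Defs
  imports "HOL-Probability.Probability" "HOL-Library.Landau_Symbols"
begin

definition regularly_varying :: "(real \<Rightarrow> real) \<Rightarrow> real \<Rightarrow> bool" where
  "regularly_varying f \<rho> \<longleftrightarrow>
     (\<forall>\<^sub>F t in at_top. f t > 0) \<and>
     (\<forall>s>0. ((\<lambda>t. f (s * t) / f t) \<longlongrightarrow> s powr \<rho>) at_top)"

definition regularly_varying_seq :: "(nat \<Rightarrow> real) \<Rightarrow> real \<Rightarrow> bool" where
  "regularly_varying_seq c \<rho> \<longleftrightarrow>
     (\<forall>\<^sub>F n in sequentially. c n > 0) \<and>
     (\<forall>s>0. (\<lambda>n. c (nat \<lfloor>s * real n\<rfloor>) / c n) \<longlonglongrightarrow> s powr \<rho>)"

text \<open>
  In the following two definitions \<open>c\<close> is the sequence of Taylor coefficients of \<open>g\<close> at 0.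
  The innovations are indexed from 1: only \<open>X 1, X 2, \<dots>\<close> enter, and \<open>X 0\<close> is never used.
\<close>

definition gF_process :: "(nat \<Rightarrow> real) \<Rightarrow> (nat \<Rightarrow> 'a \<Rightarrow> real) \<Rightarrow> nat \<Rightarrow> 'a \<Rightarrow> real" where
  "gF_process c X n \<omega> = (\<Sum>i<n. c i * X (n - i) \<omega>)"

text \<open>The supremum is taken in the extended reals, so that it is meaningful on every path.\<close>

definition gF_maximum :: "(nat \<Rightarrow> real) \<Rightarrow> (nat \<Rightarrow> 'a \<Rightarrow> real) \<Rightarrow> 'a \<Rightarrow> ereal" where
  "gF_maximum c X \<omega> = (SUP n. ereal (gF_process c X n \<omega>))"

text \<open>
  The first supremum below is over the reals and therefore only meaningful if \<open>c\<close> is bounded above,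
  the infimum only if \<open>c\<close> is bounded below; both hold as soon as \<open>c\<close> converges.
\<close>

definition coeff_sup :: "(nat \<Rightarrow> real) \<Rightarrow> real" where
  "coeff_sup c = (SUP i. c i)"

definition coeff_inf :: "(nat \<Rightarrow> real) \<Rightarrow> real" where
  "coeff_inf c = min 0 (INF i. c i)"

end

theory Submission
  imports Defs "HOL-Real_Asymp.Real_Asymp"
begin

text \<open>
  Write \<open>A n\<close> for the sum of the first \<open>n\<close> coefficients in absolute value. Large values of the maximum
  are caused by one large innovation: up to events of negligible probability, the process exceeds
  \<open>t\<close> iff for some \<open>k\<close> the innovation \<open>X k\<close>, multiplied by the most favourable coefficient, beats the
  level \<open>t\<close> plus the accumulated drift \<open>\<bar>\<mu>\<bar> * A k\<close>. To see this, truncate the innovations entering the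
  \<open>n\<close>-th sum at \<open>\<delta> * (t + A n)\<close>. A Chernoff bound keeps all truncated sums close to their means
  except with probability \<open>O(t powr - K)\<close> for any \<open>K\<close>, once \<open>\<delta>\<close> is small, and two untruncated jumps
  cost the square of the main term. Hence the probability is equivalent to
  \<open>\<Sum>k. Q (t + \<bar>\<mu>\<bar> * A k)\<close>, where \<open>Q\<close> is the tail of the most favourable multiple of an innovation.

  The coefficients being regularly varying, \<open>A\<close> is regularly varying of index \<open>\<gamma>\<close>, and the Abelian
  theorem for power series gives \<open>g (1 - 1 / x) \<sim> Gamma (1 + \<gamma>) * A x\<close>, so \<open>A (U t) \<sim> t / Gamma (1 + \<gamma>)\<close>.
  Scaling the summation index by \<open>U t\<close> and using Potter bounds for dominated convergence turns
  the sum into \<open>U t * Q t\<close> times an integral of \<open>(1 + \<kappa> * v powr \<gamma>) powr - \<alpha>\<close>, a Beta integral.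
\<close>

section \<open>Regular variation of monotone functions\<close>

text \<open>Regular variation of the coefficients gives no monotonicity, so the analysis goes
  through their partial sums in absolute value, which are monotone and therefore admit elementary
  locally uniform convergence and Potter bounds. Since \<alpha> may be at most 2, the variance may
  be infinite: the Chernoff bound rests on a moment of order \<open>p\<close> with 1 < p <= 2 and p
  < \<alpha>, which is finite because tail balance makes the lower tail at most of the order of the
  upper one. The truncation level grows with \<open>n\<close>, so the failure probabilities decay
  like a power of \<open>t + abs_psum c n\<close> and can be summed over all \<open>n\<close> at
  once. The condition \<alpha> * \<gamma> > 1 makes the tail sum converge and leaves room to lower
  both exponents slightly in a dominating function. Because the coefficients tend to 0, a positive
  supremum and a negative infimum are attained, at fixed lags: after a jump only a bounded number of
  steps pass until the most favourable coefficient acts on it, and the drift accumulated meanwhile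
  is negligible.\<close>

lemma regularly_varying_pos: "regularly_varying f \<rho> \<Longrightarrow> \<forall>\<^sub>F t in at_top. f t > 0"
  by (simp add: regularly_varying_def)

lemma regularly_varying_ratio:
  "regularly_varying f \<rho> \<Longrightarrow> s > 0 \<Longrightarrow> ((\<lambda>t. f (s * t) / f t) \<longlongrightarrow> s powr \<rho>) at_top"
  by (simp add: regularly_varying_def)

lemma regularly_varying_inverse:
  assumes "regularly_varying f \<rho>"
  shows "regularly_varying (\<lambda>t. 1 / f t) (- \<rho>)"
  unfolding regularly_varying_def
proof (intro conjI allI impI)
  show "\<forall>\<^sub>F t in at_top. 1 / f t > 0"
    using regularly_varying_pos[OF assms] by (rule eventually_mono) auto
  fix s :: real assume s: "s > 0"
  have "((\<lambda>t. inverse (f (s * t) / f t)) \<longlongrightarrow> inverse (s powr \<rho>)) at_top"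
    using regularly_varying_ratio[OF assms s] s by (intro tendsto_inverse) auto
  then show "((\<lambda>t. (1 / f (s * t)) / (1 / f t)) \<longlongrightarrow> s powr - \<rho>) at_top"
    by (simp add: powr_minus field_simps)
qed

text \<open>Asymptotic proportionality preserves the index; this carries regular variation from the
  upper tail of one innovation to the tail of its most favourable multiple.\<close>

lemma regularly_varying_of_ratio_tendsto:
  assumes f: "regularly_varying f \<rho>" and k: "k > 0"
    and q: "((\<lambda>t. q t / f t) \<longlongrightarrow> k) at_top"
  shows "regularly_varying q \<rho>"
proof -
  have "\<forall>\<^sub>F t in at_top. q t / f t > 0" using q k order_tendstoD(1) by blast
  with regularly_varying_pos[OF f] have pos: "\<forall>\<^sub>F t in at_top. q t > 0 \<and> f t > 0"
    by eventually_elim (auto simp: zero_less_divide_iff)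
  show ?thesis unfolding regularly_varying_def
  proof (intro conjI allI impI)
    show "\<forall>\<^sub>F t in at_top. q t > 0" using pos by (rule eventually_mono) auto
    fix s :: real assume s: "s > 0"
    have at: "filterlim (\<lambda>t. s * t) at_top at_top"
      by (rule filterlim_tendsto_pos_mult_at_top[OF tendsto_const s filterlim_ident])
    have "((\<lambda>t. (q (s * t) / f (s * t)) * (f (s * t) / f t) / (q t / f t)) \<longlongrightarrow> k * s powr \<rho> / k) at_top"
      using k by (intro tendsto_intros filterlim_compose[OF q at] regularly_varying_ratio[OF f s] q) auto
    moreover have "\<forall>\<^sub>F t in at_top. (q (s * t) / f (s * t)) * (f (s * t) / f t) / (q t / f t) = q (s * t) / q t"
      using pos eventually_compose_filterlim[OF pos at] by eventually_elim auto
    ultimately have "((\<lambda>t. q (s * t) / q t) \<longlongrightarrow> k * s powr \<rho> / k) at_top"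
      by (rule Lim_transform_eventually)
    then show "((\<lambda>t. q (s * t) / q t) \<longlongrightarrow> s powr \<rho>) at_top"
      using k by simp
  qed
qed

text \<open>Monotonicity makes the convergence in the definition locally uniform.\<close>

lemma regularly_varying_tendsto_mono:
  assumes rv: "regularly_varying f \<rho>" and mono: "mono f"
    and x: "filterlim x at_top L" and s: "(s \<longlongrightarrow> l) L" and l: "l > 0"
  shows "((\<lambda>t. f (s t * x t) / f (x t)) \<longlongrightarrow> l powr \<rho>) L"
proof -
  have pos: "\<forall>\<^sub>F t in L. f (x t) > 0 \<and> x t > 0"
    using eventually_compose_filterlim[OF regularly_varying_pos[OF rv] x]
      eventually_compose_filterlim[OF eventually_gt_at_top[of 0] x] by eventually_elim auto
  have lim: "((\<lambda>t. f (r * x t) / f (x t)) \<longlongrightarrow> r powr \<rho>) L" if "r > 0" for r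
    using filterlim_compose[OF regularly_varying_ratio[OF rv that] x] .
  have cont: "((\<lambda>r. r powr \<rho>) \<longlongrightarrow> l powr \<rho>) (at l)"
    using l by (intro tendsto_powr tendsto_ident_at tendsto_const) auto
  show ?thesis
  proof (rule order_tendstoI)
    fix u assume "u < l powr \<rho>"
    from order_tendstoD(1)[OF cont this] have "\<forall>\<^sub>F r in at l. u < r powr \<rho>" .
    then obtain b where b: "b > 0" "\<And>r. r \<noteq> l \<Longrightarrow> dist r l < b \<Longrightarrow> u < r powr \<rho>"
      unfolding eventually_at by auto
    \<comment> \<open>A fixed positive point below \<open>l\<close> and within distance
      \<open>b\<close> of it. Eventually \<open>s t\<close> exceeds it, so monotonicity reduces the
      moving scale \<open>s t\<close> to the constant scale \<open>r\<close>.\<close>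
    define r where "r = max (l - b / 2) (l / 2)"
    have r: "r > 0" "r < l" "u < r powr \<rho>"
      using b(1) l by (auto simp: r_def dist_real_def intro!: b(2))
    have "\<forall>\<^sub>F t in L. u < f (r * x t) / f (x t)" using order_tendstoD(1)[OF lim[OF r(1)] r(3)] .
    moreover have "\<forall>\<^sub>F t in L. r < s t" using order_tendstoD(1)[OF s r(2)] .
    ultimately show "\<forall>\<^sub>F t in L. u < f (s t * x t) / f (x t)"
      using pos
    proof eventually_elim
      case (elim t)
      have "f (r * x t) \<le> f (s t * x t)"
        using elim by (intro monoD[OF mono] mult_right_mono) auto
      then have "f (r * x t) / f (x t) \<le> f (s t * x t) / f (x t)"
        using elim by (intro divide_right_mono) auto
      with elim show ?case by linarith
    qed
  next
    fix u assume "u > l powr \<rho>"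
    from order_tendstoD(2)[OF cont this] have "\<forall>\<^sub>F r in at l. u > r powr \<rho>" .
    then obtain b where b: "b > 0" "\<And>r. r \<noteq> l \<Longrightarrow> dist r l < b \<Longrightarrow> u > r powr \<rho>"
      unfolding eventually_at by auto
    define r where "r = l + b / 2"
    have r: "r > 0" "r > l" "u > r powr \<rho>"
      using b(1) l by (auto simp: r_def dist_real_def intro!: b(2))
    have "\<forall>\<^sub>F t in L. u > f (r * x t) / f (x t)" using order_tendstoD(2)[OF lim[OF r(1)] r(3)] .
    moreover have "\<forall>\<^sub>F t in L. r > s t" using order_tendstoD(2)[OF s r(2)] .
    ultimately show "\<forall>\<^sub>F t in L. u > f (s t * x t) / f (x t)"
      using pos
    proof eventually_elim
      case (elim t)
      have "f (r * x t) \<ge> f (s t * x t)"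
        using elim by (intro monoD[OF mono] mult_right_mono) auto
      then have "f (r * x t) / f (x t) \<ge> f (s t * x t) / f (x t)"
        using elim by (intro divide_right_mono) auto
      with elim show ?case by linarith
    qed
  qed
qed

text \<open>Reduces to the monotone case through the reciprocal, which is monotone on the whole line
  because \<open>f\<close> is positive everywhere.\<close>

lemma regularly_varying_tendsto_antimono:
  assumes rv: "regularly_varying f \<rho>" and mono: "antimono f" and nonneg: "\<And>t. f t > 0"
    and x: "filterlim x at_top L" and s: "(s \<longlongrightarrow> l) L" and l: "l > 0"
  shows "((\<lambda>t. f (s t * x t) / f (x t)) \<longlongrightarrow> l powr \<rho>) L"
proof -
  have "mono (\<lambda>t. 1 / f t)"
    using mono nonneg by (auto intro!: monoI divide_left_mono dest: antimonoD simp: monotone_def)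
  from regularly_varying_tendsto_mono[OF regularly_varying_inverse[OF rv] this x s l]
  have "((\<lambda>t. inverse ((1 / f (s t * x t)) / (1 / f (x t)))) \<longlongrightarrow> inverse (l powr - \<rho>)) L"
    using l by (intro tendsto_inverse) auto
  then show ?thesis by (simp add: powr_minus field_simps)
qed

text \<open>Iterating the doubling bound \<open>f (2 * x) \<le> 2 powr \<sigma> * f x\<close>
  controls \<open>f\<close> at \<open>2 ^ n * x\<close>, and monotonicity fills the gaps between
  consecutive powers of two. Lower bounds come from applying this to \<open>1 / f\<close>;
  monotonicity is asked only on a half-line because \<open>1 / f\<close> jumps to 0 where
  \<open>f\<close> vanishes.\<close>

lemma regularly_varying_potter:
  assumes rv: "regularly_varying f \<rho>" and mono: "mono_on {b..} f \<or> antimono_on {b..} f" and \<sigma>: "\<rho> < \<sigma>"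
  shows "\<exists>C x0. C > 0 \<and> x0 > 0 \<and> (\<forall>x\<ge>x0. f x > 0 \<and> (\<forall>y\<ge>1. f (y * x) \<le> C * y powr \<sigma> * f x))"
proof -
  have "\<forall>\<^sub>F x in at_top. f (2 * x) / f x < 2 powr \<sigma>"
    using order_tendstoD(2)[OF regularly_varying_ratio[OF rv, of 2], of "2 powr \<sigma>"] \<sigma> by simp
  with regularly_varying_pos[OF rv] have "\<forall>\<^sub>F x in at_top. f x > 0 \<and> f (2 * x) \<le> 2 powr \<sigma> * f x"
    by eventually_elim (auto simp: field_simps)
  then obtain x1 where x1: "\<And>x. x \<ge> x1 \<Longrightarrow> f x > 0 \<and> f (2 * x) \<le> 2 powr \<sigma> * f x"
    by (auto simp: eventually_at_top_linorder)
  define x0 where "x0 = max (max x1 1) b"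
  have dbl: "f (2 ^ n * x) \<le> (2 powr \<sigma>) ^ n * f x" if "x \<ge> x0" for x n
  proof (induction n)
    case (Suc n)
    have "1 * x0 \<le> 2 ^ n * x" using that by (intro mult_mono) (auto simp: x0_def)
    then have "f (2 * (2 ^ n * x)) \<le> 2 powr \<sigma> * f (2 ^ n * x)"
      using x1 by (simp add: x0_def)
    also have "\<dots> \<le> 2 powr \<sigma> * ((2 powr \<sigma>) ^ n * f x)"
      using Suc by (intro mult_left_mono) auto
    finally show ?case by (simp add: mult_ac)
  qed simp
  \<comment> \<open>One factor \<open>K\<close> pays for overshooting to the next power of two, the
    other for replacing \<open>2 ^ n\<close> by \<open>y\<close>; the absolute value covers both
    signs of \<sigma>.\<close>
  define K where "K = (2::real) powr \<bar>\<sigma>\<bar>"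
  have "f (y * x) \<le> K * K * y powr \<sigma> * f x" if x: "x \<ge> x0" and y: "y \<ge> 1" for x y
  proof -
    define n where "n = nat \<lfloor>log 2 y\<rfloor>"
    have "real n = of_int \<lfloor>log 2 y\<rfloor>" using y by (simp add: n_def)
    then have "real n \<le> log 2 y" "log 2 y < real (n + 1)" by linarith+
    then have n: "2 ^ n \<le> y" "y < 2 ^ (n + 1)"
      using y by (auto simp: le_log_iff log_less_iff powr_realpow powr_add)
    define w where "w = y / 2 ^ n"
    have w: "1 \<le> w" "w \<le> 2" "y = 2 ^ n * w" using n by (auto simp: w_def field_simps)
    have fx: "f x > 0" using x1 x by (auto simp: x0_def)
    have xp: "x > 0" using x by (auto simp: x0_def)
    have le1: "f (2 ^ n * x) \<le> (2 powr \<sigma>) ^ n * f x" by (rule dbl[OF x])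
    have le2: "f (2 ^ Suc n * x) \<le> 2 powr \<sigma> * (2 powr \<sigma>) ^ n * f x" using dbl[OF x, of "Suc n"] by simp
    have K: "K \<ge> 1" "2 powr \<sigma> \<le> K" by (auto simp: K_def intro!: ge_one_powr_ge_zero powr_mono)
    have P: "0 \<le> (2 powr \<sigma>) ^ n * f x" using fx by simp
    \<comment> \<open>The maximum over both dyadic endpoints serves increasing and decreasing
      \<open>f\<close> alike.\<close>
    have "f (y * x) \<le> max (f (2 ^ n * x)) (f (2 ^ Suc n * x))"
    proof -
      have "2 ^ n * x \<le> y * x" "y * x \<le> 2 ^ Suc n * x" using n xp by auto
      moreover have "1 * b \<le> 2 ^ n * x"
      proof (cases "b \<ge> 0")
        case True
        then show ?thesis using x by (intro mult_mono) (auto simp: x0_def)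
      next
        case False
        then show ?thesis using xp by (smt (verit) mult_nonneg_nonneg zero_le_power)
      qed
      ultimately show ?thesis using mono by (auto simp: monotone_on_def le_max_iff_disj)
    qed
    also have "\<dots> \<le> K * ((2 powr \<sigma>) ^ n * f x)"
      using le1 le2 mult_right_mono[OF K(1) P] mult_right_mono[OF K(2) P] by (simp add: mult_ac)
    also have "(2 powr \<sigma>) ^ n = y powr \<sigma> * w powr (- \<sigma>)"
    proof -
      have "(2 powr \<sigma>) ^ n = (2 ^ n) powr \<sigma>" by (simp add: powr_powr powr_realpow[symmetric] mult.commute)
      then show ?thesis using w by (simp add: powr_mult powr_minus)
    qed
    also have "K * (y powr \<sigma> * w powr (- \<sigma>) * f x) \<le> K * (y powr \<sigma> * K * f x)"
    proof -
      have "w powr (- \<sigma>) \<le> w powr \<bar>\<sigma>\<bar>" using w by (intro powr_mono) auto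
      also have "\<dots> \<le> K" unfolding K_def using w by (intro powr_mono2) auto
      finally show ?thesis using fx K by (intro mult_left_mono mult_right_mono) auto
    qed
    finally show ?thesis by (simp add: mult_ac)
  qed
  moreover have "K * K > 0" by (simp add: K_def)
  moreover have "\<forall>x\<ge>x0. f x > 0" "x0 > 0" using x1 by (auto simp: x0_def)
  ultimately show ?thesis by blast
qed

section \<open>Partial sums of a regularly varying sequence\<close>

text \<open>The absolute values make the partial sums monotone from the start. With finitely many
  negative coefficients this changes the plain partial sums by a bounded amount only.\<close>

definition abs_psum :: "(nat \<Rightarrow> real) \<Rightarrow> nat \<Rightarrow> real" where
  "abs_psum c n = (\<Sum>i<n. \<bar>c i\<bar>)"

abbreviation abs_psum_real :: "(nat \<Rightarrow> real) \<Rightarrow> real \<Rightarrow> real" where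
  "abs_psum_real c x \<equiv> abs_psum c (nat \<lfloor>x\<rfloor>)"

lemma abs_psum_mono: "m \<le> n \<Longrightarrow> abs_psum c m \<le> abs_psum c n"
  unfolding abs_psum_def by (rule sum_mono2) auto

lemma abs_psum_nonneg: "0 \<le> abs_psum c n"
  unfolding abs_psum_def by (rule sum_nonneg) auto

lemma mono_abs_psum_real: "mono (abs_psum_real c)"
  by (intro monoI abs_psum_mono nat_mono floor_mono)

lemma abs_psum_add_le:
  assumes "\<And>i. \<bar>c i\<bar> \<le> G"
  shows "abs_psum c (n + k) \<le> abs_psum c n + real k * G"
proof (induction k)
  case (Suc k)
  have "abs_psum c (n + Suc k) = abs_psum c (n + k) + \<bar>c (n + k)\<bar>" by (simp add: abs_psum_def)
  then show ?case using Suc assms[of "n + k"] by (simp add: algebra_simps)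
qed simp

lemma abs_psum_at_top:
  assumes "\<not> summable c"
  shows "filterlim (abs_psum c) at_top sequentially"
  unfolding filterlim_at_top
proof
  fix K :: real
  have "\<exists>n. abs_psum c n > K"
  proof (rule ccontr)
    assume "\<not> ?thesis"
    then have "summable (\<lambda>i. \<bar>c i\<bar>)"
      by (intro summableI_nonneg_bounded[where x = K]) (auto simp: abs_psum_def not_less)
    then show False using assms summable_rabs_cancel by blast
  qed
  then obtain n where "abs_psum c n > K" ..
  then have "K \<le> abs_psum c k" if "k \<ge> n" for k using abs_psum_mono[OF that, of c] by simp
  then show "\<forall>\<^sub>F k in sequentially. K \<le> abs_psum c k" by (auto simp: eventually_sequentially)
qed

text \<open>A Stolz-Cesaro argument: from some \<open>N\<close> on, \<open>b n\<close> differs from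
  \<open>l * a n\<close> by at most \<open>e / 2 * a n\<close>, and the contribution of the first
  \<open>N\<close> terms is a constant that the divergent denominator absorbs.\<close>

lemma sum_ratio_tendsto:
  fixes a b :: "nat \<Rightarrow> real"
  assumes top: "filterlim (\<lambda>n. \<Sum>i<n. a i) at_top sequentially"
    and pos: "\<forall>\<^sub>F n in sequentially. a n > 0"
    and lim: "(\<lambda>n. b n / a n) \<longlonglongrightarrow> l"
  shows "(\<lambda>n. (\<Sum>i<n. b i) / (\<Sum>i<n. a i)) \<longlonglongrightarrow> l"
proof (rule tendstoI)
  fix e :: real assume e: "e > 0"
  have "\<forall>\<^sub>F n in sequentially. \<bar>b n / a n - l\<bar> < e / 2"
    using tendstoD[OF lim, of "e / 2"] e by (simp add: dist_real_def)
  with pos have "\<forall>\<^sub>F n in sequentially. a n > 0 \<and> \<bar>b n - l * a n\<bar> \<le> e / 2 * a n"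
  proof eventually_elim
    case (elim n)
    have "\<bar>b n - l * a n\<bar> = \<bar>b n / a n - l\<bar> * a n" using elim by (simp add: abs_mult_pos field_simps)
    with elim show ?case by (simp add: mult_right_mono less_imp_le)
  qed
  then obtain N where N: "\<And>n. n \<ge> N \<Longrightarrow> a n > 0 \<and> \<bar>b n - l * a n\<bar> \<le> e / 2 * a n"
    by (auto simp: eventually_sequentially)
  define K where "K = (\<Sum>i<N. \<bar>b i - l * a i\<bar> - e / 2 * a i)"
  have est: "\<bar>(\<Sum>i<n. b i) - l * (\<Sum>i<n. a i)\<bar> \<le> K + e / 2 * (\<Sum>i<n. a i)" if "n \<ge> N" for n
  proof -
    have "\<bar>(\<Sum>i<n. b i) - l * (\<Sum>i<n. a i)\<bar> = \<bar>\<Sum>i<n. b i - l * a i\<bar>"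
      by (simp add: sum_subtractf sum_distrib_left)
    also have "\<dots> \<le> (\<Sum>i<n. \<bar>b i - l * a i\<bar>)" by (rule sum_abs)
    also have "\<dots> = (\<Sum>i<n. \<bar>b i - l * a i\<bar> - e / 2 * a i) + e / 2 * (\<Sum>i<n. a i)"
      by (simp add: sum_subtractf sum_distrib_left)
    also have "(\<Sum>i<n. \<bar>b i - l * a i\<bar> - e / 2 * a i) \<le> K"
    proof -
      have "{..<n} = {..<N} \<union> {N..<n}" using that by auto
      then have "(\<Sum>i<n. \<bar>b i - l * a i\<bar> - e / 2 * a i)
          = K + (\<Sum>i\<in>{N..<n}. \<bar>b i - l * a i\<bar> - e / 2 * a i)"
        unfolding K_def by (simp add: sum.union_disjoint ivl_disj_int)
      moreover have "(\<Sum>i\<in>{N..<n}. \<bar>b i - l * a i\<bar> - e / 2 * a i) \<le> 0"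
        using N by (intro sum_nonpos) auto
      ultimately show ?thesis by simp
    qed
    finally show ?thesis by simp
  qed
  have "\<forall>\<^sub>F n in sequentially. (\<Sum>i<n. a i) > max 0 (K / (e / 2))"
    using top unfolding filterlim_at_top_dense by blast
  then show "\<forall>\<^sub>F n in sequentially. dist ((\<Sum>i<n. b i) / (\<Sum>i<n. a i)) l < e"
    using eventually_ge_at_top[of N]
  proof eventually_elim
    case (elim n)
    define A where "A = (\<Sum>i<n. a i)"
    have A: "A > 0" "K < e / 2 * A" using elim e by (auto simp: A_def field_simps)
    have "\<bar>(\<Sum>i<n. b i) / A - l\<bar> = \<bar>(\<Sum>i<n. b i) - l * A\<bar> / A"
      using A by (simp add: abs_divide field_simps)
    also have "\<dots> \<le> (K + e / 2 * A) / A"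
      using est[OF elim(2)] A unfolding A_def by (intro divide_right_mono) auto
    also have "\<dots> < e" using A by (simp add: field_simps)
    finally show ?case by (simp add: dist_real_def A_def)
  qed
qed

lemma sum_div_blocks:
  fixes f :: "nat \<Rightarrow> real"
  assumes "m > 0"
  shows "(\<Sum>n<m * N. f (n div m)) = real m * (\<Sum>i<N. f i)"
proof -
  have "(\<Sum>n<m * N. f (n div m)) = (\<Sum>n\<in>{..<N*m}. f (n div m))" by (simp add: mult.commute)
  also have "\<dots> = (\<Sum>i<N. \<Sum>n\<in>{i*m..<i*m+m}. f (n div m))"
    by (rule sum.nat_group[symmetric])
  also have "\<dots> = (\<Sum>i<N. \<Sum>n\<in>{i*m..<i*m+m}. f i)"
  proof (intro sum.cong refl)
    fix i n assume "n \<in> {i*m..<i*m+m}"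
    then have "n div m = i" using assms by (auto intro!: div_nat_eqI simp: mult.commute)
    then show "f (n div m) = f i" by simp
  qed
  also have "\<dots> = real m * (\<Sum>i<N. f i)" by (simp add: sum_distrib_left)
  finally show ?thesis .
qed

text \<open>
  Summing \<open>c (n div m) \<sim> m powr - \<rho> * c n\<close> over \<open>n < m * N\<close> compares the partial sums at
  \<open>N\<close> and \<open>m * N\<close>; no uniform convergence theorem for \<open>c\<close> itself is needed.
\<close>

lemma abs_psum_mult_tendsto:
  assumes rv: "regularly_varying_seq c \<rho>" and ns: "\<not> summable c" and m: "m > 0"
  shows "(\<lambda>N. abs_psum c (m * N) / abs_psum c N) \<longlonglongrightarrow> real m powr (\<rho> + 1)"
proof -
  have pos: "\<forall>\<^sub>F n in sequentially. c n > 0" using rv by (simp add: regularly_varying_seq_def)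
  \<comment> \<open>At scale \<open>1 / m\<close> the floor in the definition is exactly integer
    division.\<close>
  have "(\<lambda>n. c (nat \<lfloor>(1 / real m) * real n\<rfloor>) / c n) \<longlonglongrightarrow> (1 / real m) powr \<rho>"
    using rv m unfolding regularly_varying_seq_def by (metis of_nat_0_less_iff zero_less_divide_1_iff)
  moreover have "nat \<lfloor>(1 / real m) * real n\<rfloor> = n div m" for n
    by (simp add: floor_divide_of_nat_eq)
  ultimately have "(\<lambda>n. c (n div m) / c n) \<longlonglongrightarrow> (1 / real m) powr \<rho>" by simp
  then have "(\<lambda>n. \<bar>c (n div m) / c n\<bar>) \<longlonglongrightarrow> \<bar>(1 / real m) powr \<rho>\<bar>" by (rule tendsto_rabs)
  then have lim: "(\<lambda>n. \<bar>c (n div m)\<bar> / \<bar>c n\<bar>) \<longlonglongrightarrow> real m powr - \<rho>"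
    using m by (simp add: abs_divide powr_divide powr_minus field_simps)
  have pos': "\<forall>\<^sub>F n in sequentially. \<bar>c n\<bar> > 0" using pos by (rule eventually_mono) auto
  note top = abs_psum_at_top[OF ns]
  have "(\<lambda>n. (\<Sum>i<n. \<bar>c (i div m)\<bar>) / abs_psum c n) \<longlonglongrightarrow> real m powr - \<rho>"
    unfolding abs_psum_def using sum_ratio_tendsto[OF _ pos' lim] top[unfolded abs_psum_def] by simp
  moreover have mt: "filterlim (\<lambda>N. m * N) at_top sequentially"
    using m by (simp add: mult_nat_left_at_top)
  ultimately have "(\<lambda>N. (\<Sum>i<m*N. \<bar>c (i div m)\<bar>) / abs_psum c (m * N)) \<longlonglongrightarrow> real m powr - \<rho>"
    by (rule filterlim_compose)
  then have "(\<lambda>N. real m * abs_psum c N / abs_psum c (m * N)) \<longlonglongrightarrow> real m powr - \<rho>"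
    using sum_div_blocks[OF m, of "\<lambda>i. \<bar>c i\<bar>"] by (simp add: abs_psum_def)
  then have "(\<lambda>N. real m * inverse (real m * abs_psum c N / abs_psum c (m * N)))
      \<longlonglongrightarrow> real m * inverse (real m powr - \<rho>)"
    using m by (intro tendsto_intros) auto
  then show ?thesis using m by (simp add: powr_minus powr_add field_simps)
qed

text \<open>The scale is enlarged in stages: integers, then rationals as quotients of two integer
  limits, then all positive reals by squeezing between rationals with monotonicity. The bound
  \<open>G\<close> enters because rounding after multiplication by \<open>m\<close>, instead of
  before, adds at most \<open>m\<close> terms, which is negligible against a divergent sum.\<close>

lemma abs_psum_real_regularly_varying:
  assumes rv: "regularly_varying_seq c \<rho>" and ns: "\<not> summable c" and bdd: "\<And>i. \<bar>c i\<bar> \<le> G"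
    and \<rho>: "\<rho> + 1 > 0"
  shows "regularly_varying (abs_psum_real c) (\<rho> + 1)"
proof -
  define a where "a = abs_psum_real c"
  have mono: "mono a" unfolding a_def by (rule mono_abs_psum_real)
  have nat_at_top: "filterlim (\<lambda>x::real. nat \<lfloor>x\<rfloor>) at_top at_top"
    by (intro filterlim_compose[OF filterlim_nat_sequentially filterlim_floor_sequentially])
  have at: "filterlim a at_top at_top"
    unfolding a_def by (rule filterlim_compose[OF abs_psum_at_top[OF ns] nat_at_top])
  have apos: "\<forall>\<^sub>F x in at_top. a x > 0" using at by (simp add: filterlim_at_top_dense)
  have scale: "filterlim (\<lambda>x::real. s * x) at_top at_top" if "s > 0" for s
    by (rule filterlim_tendsto_pos_mult_at_top[OF tendsto_const that filterlim_ident])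
  have nat: "((\<lambda>x. a (real m * x) / a x) \<longlongrightarrow> real m powr (\<rho> + 1)) at_top" if m: "m > 0" for m
  proof -
    have base: "((\<lambda>x. abs_psum c (m * nat \<lfloor>x\<rfloor>) / a x) \<longlongrightarrow> real m powr (\<rho> + 1)) at_top"
      unfolding a_def by (rule filterlim_compose[OF abs_psum_mult_tendsto[OF rv ns m] nat_at_top])
    have "((\<lambda>x. (real m * G) / a x) \<longlongrightarrow> 0) at_top"
      by (rule real_tendsto_divide_at_top[OF tendsto_const at])
    from tendsto_add[OF base this]
    have up: "((\<lambda>x. abs_psum c (m * nat \<lfloor>x\<rfloor>) / a x + (real m * G) / a x) \<longlongrightarrow> real m powr (\<rho> + 1)) at_top"
      by simp
    show ?thesis
    proof (rule tendsto_sandwich[OF _ _ base up])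
      have key: "m * nat \<lfloor>x\<rfloor> \<le> nat \<lfloor>real m * x\<rfloor> \<and> nat \<lfloor>real m * x\<rfloor> \<le> m * nat \<lfloor>x\<rfloor> + m"
        if x: "x \<ge> 0" for x
      proof
        have fx: "real (nat \<lfloor>x\<rfloor>) \<le> x" "x \<le> real (nat \<lfloor>x\<rfloor>) + 1" using x by linarith+
        have "real (m * nat \<lfloor>x\<rfloor>) \<le> real m * x" using fx(1) by (simp add: mult_left_mono)
        then show "m * nat \<lfloor>x\<rfloor> \<le> nat \<lfloor>real m * x\<rfloor>" by (rule le_nat_floor)
        have "real m * x \<le> real m * (real (nat \<lfloor>x\<rfloor>) + 1)" using fx(2) by (intro mult_left_mono) auto
        then have "real m * x \<le> real (m * nat \<lfloor>x\<rfloor> + m)" by (simp add: algebra_simps)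
        then show "nat \<lfloor>real m * x\<rfloor> \<le> m * nat \<lfloor>x\<rfloor> + m" by linarith
      qed
      show "\<forall>\<^sub>F x in at_top. abs_psum c (m * nat \<lfloor>x\<rfloor>) / a x \<le> a (real m * x) / a x"
        using apos eventually_ge_at_top[of 0]
      proof eventually_elim
        case (elim x)
        have "abs_psum c (m * nat \<lfloor>x\<rfloor>) \<le> a (real m * x)"
          unfolding a_def using key[OF elim(2)] by (intro abs_psum_mono) auto
        then show ?case using elim by (intro divide_right_mono) auto
      qed
      show "\<forall>\<^sub>F x in at_top. a (real m * x) / a x \<le> abs_psum c (m * nat \<lfloor>x\<rfloor>) / a x + (real m * G) / a x"
        using apos eventually_ge_at_top[of 0]
      proof eventually_elim
        case (elim x)
        have "a (real m * x) \<le> abs_psum c (m * nat \<lfloor>x\<rfloor> + m)"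
          unfolding a_def using key[OF elim(2)] by (intro abs_psum_mono) auto
        also have "\<dots> \<le> abs_psum c (m * nat \<lfloor>x\<rfloor>) + real m * G" by (rule abs_psum_add_le[OF bdd])
        finally have "a (real m * x) / a x \<le> (abs_psum c (m * nat \<lfloor>x\<rfloor>) + real m * G) / a x"
          using elim by (intro divide_right_mono) auto
        then show ?case by (simp add: add_divide_distrib)
      qed
    qed
  qed
  have rat: "((\<lambda>x. a (r * x) / a x) \<longlongrightarrow> r powr (\<rho> + 1)) at_top" if r: "r \<in> \<rat>" "r > 0" for r
  proof -
    obtain p q where pq: "q \<noteq> 0" "\<bar>r\<bar> = real p / real q" using Rats_abs_nat_div_natE[OF r(1)] by metis
    then have pq: "r = real p / real q" "p > 0" "q > 0" using r(2) by (auto intro!: gr0I)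
    have sc: "filterlim (\<lambda>x::real. x / real q) at_top at_top"
      using scale[of "1 / real q"] pq by simp
    have 1: "((\<lambda>x. a (real p * (x / real q)) / a (x / real q)) \<longlongrightarrow> real p powr (\<rho> + 1)) at_top"
      by (rule filterlim_compose[OF nat[OF pq(2)] sc])
    have 2: "((\<lambda>x. a (real q * (x / real q)) / a (x / real q)) \<longlongrightarrow> real q powr (\<rho> + 1)) at_top"
      by (rule filterlim_compose[OF nat[OF pq(3)] sc])
    \<comment> \<open>Both integer limits are taken at the argument \<open>x / q\<close>, so that
      the common denominator \<open>a (x / q)\<close> cancels.\<close>
    have "((\<lambda>x. (a (real p * (x / real q)) / a (x / real q)) / (a (real q * (x / real q)) / a (x / real q)))
        \<longlongrightarrow> real p powr (\<rho> + 1) / real q powr (\<rho> + 1)) at_top"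
      using pq by (intro tendsto_divide 1 2) auto
    moreover have "\<forall>\<^sub>F x in at_top. (a (real p * (x / real q)) / a (x / real q)) / (a (real q * (x / real q)) / a (x / real q))
        = a (r * x) / a x"
      using eventually_compose_filterlim[OF apos sc]
    proof eventually_elim
      case (elim x)
      have "real p * (x / real q) = r * x" "real q * (x / real q) = x" using pq by simp_all
      with elim show ?case by simp
    qed
    ultimately have "((\<lambda>x. a (r * x) / a x) \<longlongrightarrow> real p powr (\<rho> + 1) / real q powr (\<rho> + 1)) at_top"
      by (rule Lim_transform_eventually)
    then show ?thesis using pq by (simp add: powr_divide)
  qed
  have "((\<lambda>x. a (s * x) / a x) \<longlongrightarrow> s powr (\<rho> + 1)) at_top" if s: "s > 0" for s
  proof -
    have cont: "((\<lambda>r. r powr (\<rho> + 1)) \<longlongrightarrow> s powr (\<rho> + 1)) (at s)"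
      using s by (intro tendsto_powr tendsto_ident_at tendsto_const) auto
    show ?thesis
    proof (rule order_tendstoI)
      fix u assume "u < s powr (\<rho> + 1)"
      from order_tendstoD(1)[OF cont this] obtain b
        where b: "b > 0" "\<And>r. r \<noteq> s \<Longrightarrow> dist r s < b \<Longrightarrow> u < r powr (\<rho> + 1)"
        unfolding eventually_at by auto
      obtain r where r: "r \<in> \<rat>" "max (s - b) 0 < r" "r < s"
        using Rats_dense_in_real[of "max (s - b) 0" s] b s by auto
      have ur: "u < r powr (\<rho> + 1)" using r by (intro b(2)) (auto simp: dist_real_def)
      have "\<forall>\<^sub>F x in at_top. u < a (r * x) / a x" using order_tendstoD(1)[OF rat ur] r by simp
      with apos eventually_ge_at_top[of 0] show "\<forall>\<^sub>F x in at_top. u < a (s * x) / a x"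
      proof eventually_elim
        case (elim x)
        have "a (r * x) \<le> a (s * x)" using elim r by (intro monoD[OF mono] mult_right_mono) auto
        then have "a (r * x) / a x \<le> a (s * x) / a x" using elim by (intro divide_right_mono) auto
        with elim show ?case by linarith
      qed
    next
      fix u assume "u > s powr (\<rho> + 1)"
      from order_tendstoD(2)[OF cont this] obtain b
        where b: "b > 0" "\<And>r. r \<noteq> s \<Longrightarrow> dist r s < b \<Longrightarrow> u > r powr (\<rho> + 1)"
        unfolding eventually_at by auto
      obtain r where r: "r \<in> \<rat>" "s < r" "r < s + b"
        using Rats_dense_in_real[of s "s + b"] b s by auto
      have ur: "u > r powr (\<rho> + 1)" using r by (intro b(2)) (auto simp: dist_real_def)
      have "\<forall>\<^sub>F x in at_top. u > a (r * x) / a x" using order_tendstoD(2)[OF rat ur] r s by simp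
      with apos eventually_ge_at_top[of 0] show "\<forall>\<^sub>F x in at_top. u > a (s * x) / a x"
      proof eventually_elim
        case (elim x)
        have "a (r * x) \<ge> a (s * x)" using elim r by (intro monoD[OF mono] mult_right_mono) auto
        then have "a (r * x) / a x \<ge> a (s * x) / a x" using elim by (intro divide_right_mono) auto
        with elim show ?case by linarith
      qed
    qed
  qed
  then show ?thesis using apos by (simp add: regularly_varying_def a_def)
qed

section \<open>Sums and integrals\<close>

text \<open>The Gamma and Beta integrals are available as gauge integrals, whereas dominated
  convergence is applied to Lebesgue integrals; for a nonnegative integrand the former is absolute
  and the two agree.\<close>

lemma has_bochner_integral_has_integral_nonneg:
  fixes f :: "real \<Rightarrow> real"
  assumes I: "(f has_integral I) S" and nonneg: "\<And>x. x \<in> S \<Longrightarrow> 0 \<le> f x"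
    and meas: "(\<lambda>x. indicator S x * f x) \<in> borel_measurable borel"
  shows "has_bochner_integral lborel (\<lambda>x. indicator S x * f x) I"
proof -
  have abs: "f absolutely_integrable_on S"
    using I nonneg by (intro nonnegative_absolutely_integrable_1) auto
  then have "integral\<^sup>L lebesgue (\<lambda>x. indicator S x *\<^sub>R f x) = I"
    using set_lebesgue_integral_eq_integral(2)[OF abs] integral_unique[OF I]
    by (simp add: set_lebesgue_integral_def)
  moreover have "integrable lebesgue (\<lambda>x. indicator S x *\<^sub>R f x)"
    using abs by (simp add: set_integrable_def)
  moreover have "(\<lambda>x. indicator S x *\<^sub>R f x) \<in> borel_measurable lborel" using meas by simp
  ultimately show ?thesis
    by (simp add: has_bochner_integral_iff integrable_completion integral_completion)
qed

lemma measurable_nat_floor_comp [measurable]: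
  fixes f :: "nat \<Rightarrow> real" and x :: real
  shows "(\<lambda>v. f (nat \<lfloor>x * v\<rfloor>)) \<in> borel_measurable borel"
proof -
  have "(\<lambda>v. x * v) \<in> borel \<rightarrow>\<^sub>M borel"
    by (intro borel_measurable_continuous_onI linear_continuous_on bounded_linear_mult_right)
  then have "(\<lambda>v. \<lfloor>x * v\<rfloor>) \<in> borel \<rightarrow>\<^sub>M count_space UNIV"
    by (rule measurable_compose[OF _ measurable_real_floor])
  then show ?thesis by (rule measurable_compose) simp
qed

text \<open>The integrand is a step function: \<open>nat \<lfloor>x * v\<rfloor>\<close> equals
  \<open>n\<close> exactly for \<open>v\<close> in an interval of length \<open>1 / x\<close>. This
  is the change of summation index \<open>n = x * v\<close> that turns series into integrals on
  which limits in \<open>x\<close> can be taken.\<close>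

lemma sums_integral_nat_floor:
  fixes f :: "nat \<Rightarrow> real"
  assumes nonneg: "\<And>n. 0 \<le> f n" and x: "x > 0"
    and int: "integrable lborel (\<lambda>v. indicator {0..} v * f (nat \<lfloor>x * v\<rfloor>))"
  shows "f sums (x * (\<integral>v. indicator {0..} v * f (nat \<lfloor>x * v\<rfloor>) \<partial>lborel))"
proof -
  define I where "I = (\<lambda>n::nat. {real n / x ..< (real n + 1) / x})"
  have I: "v \<in> I n \<longleftrightarrow> 0 \<le> v \<and> n = nat \<lfloor>x * v\<rfloor>" for v n
  proof -
    have "v \<in> I n \<longleftrightarrow> real n \<le> x * v \<and> x * v < real n + 1"
      using x by (auto simp: I_def field_simps)
    also have "\<dots> \<longleftrightarrow> \<lfloor>x * v\<rfloor> = int n" by (auto simp: floor_eq_iff)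
    also have "\<dots> \<longleftrightarrow> 0 \<le> x * v \<and> n = nat \<lfloor>x * v\<rfloor>" by (auto simp flip: zero_le_floor)
    finally show ?thesis using x by (simp add: zero_le_mult_iff)
  qed
  have pt: "ennreal (indicator {0..} v * f (nat \<lfloor>x * v\<rfloor>)) = (\<Sum>n. ennreal (f n) * indicator (I n) v)" for v
  proof -
    have "(\<Sum>n. ennreal (f n) * indicator (I n) v) =
        (\<Sum>n\<in>{nat \<lfloor>x * v\<rfloor>}. ennreal (f n) * indicator (I n) v)"
      by (rule suminf_finite) (auto simp: indicator_def I)
    then show ?thesis by (auto simp: I indicator_def)
  qed
  have em: "emeasure lborel (I n) = ennreal (1 / x)" for n
    using x unfolding I_def by (subst emeasure_lborel_Ico) (auto simp: field_simps)
  define L where "L = (\<integral>v. indicator {0..} v * f (nat \<lfloor>x * v\<rfloor>) \<partial>lborel)"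
  have L: "0 \<le> L" unfolding L_def by (rule integral_nonneg_AE) (auto simp: nonneg)
  have "ennreal L = (\<integral>\<^sup>+v. ennreal (indicator {0..} v * f (nat \<lfloor>x * v\<rfloor>)) \<partial>lborel)"
    unfolding L_def by (rule nn_integral_eq_integral[symmetric, OF int]) (auto simp: nonneg)
  also have "\<dots> = (\<Sum>n. \<integral>\<^sup>+v. ennreal (f n) * indicator (I n) v \<partial>lborel)"
    unfolding pt by (rule nn_integral_suminf) (simp add: I_def)
  also have "\<dots> = (\<Sum>n. ennreal (f n / x))"
  proof (rule suminf_cong)
    fix n
    have "(\<integral>\<^sup>+v. ennreal (f n) * indicator (I n) v \<partial>lborel) = ennreal (f n) * ennreal (1 / x)"
      by (subst nn_integral_cmult_indicator) (auto simp: em, simp add: I_def)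
    then show "(\<integral>\<^sup>+v. ennreal (f n) * indicator (I n) v \<partial>lborel) = ennreal (f n / x)"
      using x nonneg by (simp add: ennreal_mult[symmetric])
  qed
  finally have "(\<Sum>n. ennreal (f n / x)) = ennreal L" ..
  then have "(\<lambda>n. ennreal (f n / x)) sums ennreal L"
    by (metis summableI summable_sums)
  then have "(\<lambda>n. f n / x) sums L" using x nonneg L by simp
  from sums_mult[OF this, of x] show ?thesis using x by (simp add: L_def)
qed

text \<open>Multiplication by \<open>1 / (1 - z)\<close> replaces coefficients by their partial
  sums, so only the partial sums have to be understood. The index is \<open>Suc n\<close> because
  the coefficient of \<open>z ^ n\<close> includes \<open>\<bar>c n\<bar>\<close>.\<close>

lemma cauchy_product_geometric:
  fixes c :: "nat \<Rightarrow> real"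
  assumes z: "0 \<le> z" "z < 1" and s: "summable (\<lambda>i. \<bar>c i\<bar> * z ^ i)"
  shows "(\<lambda>n. abs_psum c (Suc n) * z ^ n) sums ((\<Sum>i. \<bar>c i\<bar> * z ^ i) / (1 - z))"
proof -
  have "(\<lambda>k. \<Sum>i\<le>k. \<bar>c i\<bar> * z ^ i * z ^ (k - i)) sums ((\<Sum>i. \<bar>c i\<bar> * z ^ i) * (\<Sum>i. z ^ i))"
    using z s by (intro Cauchy_product_sums) (auto simp: abs_mult)
  moreover have "(\<Sum>i\<le>k. \<bar>c i\<bar> * z ^ i * z ^ (k - i)) = abs_psum c (Suc k) * z ^ k" for k
    by (simp add: abs_psum_def lessThan_Suc_atMost sum_distrib_right mult.assoc flip: power_add)
  ultimately show ?thesis using z by (simp add: suminf_geometric)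
qed

lemma integral_powr_exp:
  assumes "\<gamma> > (0::real)"
  shows "has_bochner_integral lborel (\<lambda>v. indicator {0..} v * (v powr \<gamma> * exp (- v))) (Gamma (1 + \<gamma>))"
proof (rule has_bochner_integral_has_integral_nonneg)
  have "((\<lambda>t. t powr ((1 + \<gamma>) - 1) / exp t) has_integral Gamma (1 + \<gamma>)) {0..}"
    using assms by (intro Gamma_integral_real) auto
  then show "((\<lambda>v. v powr \<gamma> * exp (- v)) has_integral Gamma (1 + \<gamma>)) {0..}"
    by (simp add: exp_minus field_simps)
qed auto

text \<open>
  The substitution is \<open>v = ((1 - w) / (\<kappa> * w)) powr (1 / \<gamma>)\<close>, that is, \<open>w = 1 / (1 + \<kappa> * v powr \<gamma>)\<close>.
\<close>

lemma integral_powr_Beta: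
  fixes \<alpha> \<gamma> \<kappa> :: real
  assumes \<gamma>: "\<gamma> > 0" and \<kappa>: "\<kappa> > 0" and \<alpha>: "1 / \<gamma> < \<alpha>"
  shows "has_bochner_integral lborel (\<lambda>v. indicator {0<..} v * (1 + \<kappa> * v powr \<gamma>) powr (- \<alpha>))
    (\<kappa> powr - (1 / \<gamma>) * (1 / \<gamma> * Beta (1 / \<gamma>) (\<alpha> - 1 / \<gamma>)))"
proof (rule has_bochner_integral_has_integral_nonneg)
  define g where "g = (\<lambda>w::real. ((1 - w) / (\<kappa> * w)) powr (1 / \<gamma>))"
  define g' where "g' = (\<lambda>w::real. - (1 / \<gamma> * ((1 - w) / (\<kappa> * w)) powr (1 / \<gamma> - 1) * (1 / (\<kappa> * w\<^sup>2))))"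
  define f where "f = (\<lambda>v::real. (1 + \<kappa> * v powr \<gamma>) powr (- \<alpha>))"
  define b where "b = \<kappa> powr - (1 / \<gamma>) * (1 / \<gamma> * Beta (1 / \<gamma>) (\<alpha> - 1 / \<gamma>))"
  have base: "(1 - w) / (\<kappa> * w) > 0" if "w \<in> {0<..<1}" for w
    using that \<kappa> by auto
  have inv: "1 + \<kappa> * g w powr \<gamma> = 1 / w" if "w \<in> {0<..<1}" for w
    using that \<kappa> \<gamma> base[OF that] by (simp add: g_def powr_powr field_simps)
  have inj: "inj_on g {0<..<1}"
  proof (rule inj_onI)
    fix v w assume "v \<in> {0<..<1}" "w \<in> {0<..<1}" "g v = g w"
    then have "1 / v = 1 / w" using inv by metis
    then show "v = w" by simp
  qed
  have img: "g ` {0<..<1} = {0<..}"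
  proof (intro equalityI subsetI)
    fix v assume "v \<in> g ` {0<..<1}"
    then obtain w where w: "w \<in> {0<..<1}" "v = g w" by auto
    then show "v \<in> {0<..}" using base[OF w(1)] by (auto simp: g_def)
  next
    fix v :: real assume v: "v \<in> {0<..}"
    define w where "w = 1 / (1 + \<kappa> * v powr \<gamma>)"
    have p: "\<kappa> * v powr \<gamma> > 0" using v \<kappa> by auto
    have w: "w \<in> {0<..<1}" using p by (auto simp: w_def field_simps add_pos_pos)
    have "1 - w = (\<kappa> * v powr \<gamma>) * w" using p by (simp add: w_def field_simps add_pos_pos)
    then have "(1 - w) / (\<kappa> * w) = v powr \<gamma>" using w \<kappa> by simp
    then have "g w = v" using v \<gamma> by (simp add: g_def powr_powr)
    then show "v \<in> g ` {0<..<1}" using w by blast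
  qed
  have der: "(g has_field_derivative g' w) (at w within {0<..<1})" if w: "w \<in> {0<..<1}" for w
  proof -
    have "((\<lambda>w. (1 - w) / (\<kappa> * w)) has_real_derivative - (1 / (\<kappa> * w\<^sup>2))) (at w)"
      using w \<kappa> by (auto intro!: derivative_eq_intros simp: field_simps power2_eq_square)
    from has_real_derivative_powr'[OF this DERIV_const[of "1 / \<gamma>"] base[OF w]]
    have "(g has_real_derivative (((1 - w) / (\<kappa> * w)) powr (1 / \<gamma>) *
        (0 * ln ((1 - w) / (\<kappa> * w)) + - (1 / (\<kappa> * w\<^sup>2)) * (1 / \<gamma>) / ((1 - w) / (\<kappa> * w))))) (at w)"
      by (simp add: g_def)
    also have "((1 - w) / (\<kappa> * w)) powr (1 / \<gamma>) *
        (0 * ln ((1 - w) / (\<kappa> * w)) + - (1 / (\<kappa> * w\<^sup>2)) * (1 / \<gamma>) / ((1 - w) / (\<kappa> * w))) = g' w"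
      using base[OF w] w \<kappa> by (simp add: g'_def powr_diff)
    finally show ?thesis by (rule has_field_derivative_at_within)
  qed
  have beta: "((\<lambda>w. w powr (\<alpha> - 1 / \<gamma> - 1) * (1 - w) powr (1 / \<gamma> - 1)) has_integral
      Beta (\<alpha> - 1 / \<gamma>) (1 / \<gamma>)) {0<..<1}"
    using has_integral_Beta_real[of "\<alpha> - 1 / \<gamma>" "1 / \<gamma>"] \<alpha> \<gamma> by (simp add: has_integral_Icc_iff_Ioo)
  have "((\<lambda>w. (\<kappa> powr - (1 / \<gamma>) * (1 / \<gamma>)) * (w powr (\<alpha> - 1 / \<gamma> - 1) * (1 - w) powr (1 / \<gamma> - 1)))
      has_integral (\<kappa> powr - (1 / \<gamma>) * (1 / \<gamma>)) * Beta (\<alpha> - 1 / \<gamma>) (1 / \<gamma>)) {0<..<1}"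
    by (rule has_integral_mult_right[OF beta])
  moreover have "(\<kappa> powr - (1 / \<gamma>) * (1 / \<gamma>)) * Beta (\<alpha> - 1 / \<gamma>) (1 / \<gamma>) = b"
    by (simp add: b_def Beta_commute)
  ultimately have "((\<lambda>w. (\<kappa> powr - (1 / \<gamma>) * (1 / \<gamma>)) * (w powr (\<alpha> - 1 / \<gamma> - 1) * (1 - w) powr (1 / \<gamma> - 1)))
      has_integral b) {0<..<1}" by simp
  then have int: "((\<lambda>w. \<bar>g' w\<bar> * f (g w)) has_integral b) {0<..<1}"
  \<comment> \<open>Collecting exponents: \<open>w\<close> appears with \<alpha> - (1/\<gamma> - 1)
    - 2 = \<alpha> - 1/\<gamma> - 1, and \<kappa> with -(1/\<gamma> - 1) - 1 = -1/\<gamma>.\<close>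
  proof (rule has_integral_eq[rotated])
    fix w :: real assume w: "w \<in> {0<..<1}"
    have "\<bar>g' w\<bar> = 1 / \<gamma> * ((1 - w) / (\<kappa> * w)) powr (1 / \<gamma> - 1) * (1 / (\<kappa> * w\<^sup>2))"
      using \<gamma> \<kappa> w by (simp add: g'_def abs_mult)
    moreover have "f (g w) = w powr \<alpha>" using w by (simp add: f_def inv[OF w] powr_minus powr_divide)
    ultimately have "\<bar>g' w\<bar> * f (g w) = 1 / \<gamma> * ((1 - w) powr (1 / \<gamma> - 1) /
        (\<kappa> powr (1 / \<gamma> - 1) * w powr (1 / \<gamma> - 1))) * (1 / (\<kappa> powr 1 * w powr 2)) * w powr \<alpha>"
      using w \<kappa> by (simp add: powr_divide powr_mult powr_numeral)
    also have "\<dots> = 1 / \<gamma> * (1 - w) powr (1 / \<gamma> - 1) * (1 / (\<kappa> powr (1 / \<gamma> - 1) * \<kappa> powr 1)) *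
        (w powr \<alpha> / (w powr (1 / \<gamma> - 1) * w powr 2))" by simp
    also have "\<kappa> powr (1 / \<gamma> - 1) * \<kappa> powr 1 = \<kappa> powr (1 / \<gamma>)" using \<kappa> by (simp add: powr_diff)
    also have "w powr \<alpha> / (w powr (1 / \<gamma> - 1) * w powr 2) = w powr (\<alpha> - ((1 / \<gamma> - 1) + 2))"
      by (simp only: powr_diff powr_add)
    finally show "\<kappa> powr - (1 / \<gamma>) * (1 / \<gamma>) * (w powr (\<alpha> - 1 / \<gamma> - 1) * (1 - w) powr (1 / \<gamma> - 1)) = \<bar>g' w\<bar> * f (g w)"
      by (simp add: powr_minus field_simps)
  qed
  then have "(\<lambda>w. \<bar>g' w\<bar> * f (g w)) absolutely_integrable_on {0<..<1} \<and>
      integral {0<..<1} (\<lambda>w. \<bar>g' w\<bar> * f (g w)) = b"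
    by (auto intro!: nonnegative_absolutely_integrable_1 simp: f_def)
  then have "f absolutely_integrable_on (g ` {0<..<1}) \<and> integral (g ` {0<..<1}) f = b"
    by (subst (asm) has_absolute_integral_change_of_variables_1') (use der inj in auto)
  then show "((\<lambda>v. (1 + \<kappa> * v powr \<gamma>) powr (- \<alpha>)) has_integral
      (\<kappa> powr - (1 / \<gamma>) * (1 / \<gamma> * Beta (1 / \<gamma>) (\<alpha> - 1 / \<gamma>)))) {0<..}"
    unfolding img b_def[symmetric] f_def
    using set_lebesgue_integral_eq_integral(1) has_integral_integral by blast
qed auto

section \<open>The Abelian theorem\<close>

text \<open>The logarithm of the power is the product of
  \<open>real (nat \<lfloor>x * v\<rfloor>) / x\<close>, which tends to \<open>v\<close>, and
  \<open>x * ln (1 - 1 / x)\<close>, which tends to -1.\<close>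

lemma power_floor_tendsto_exp:
  assumes v: "v > (0::real)"
  shows "((\<lambda>x. (1 - 1 / x) ^ nat \<lfloor>x * v\<rfloor>) \<longlongrightarrow> exp (- v)) at_top"
proof -
  have "((\<lambda>x. real (nat \<lfloor>x * v\<rfloor>) / x) \<longlongrightarrow> v) at_top"
  proof (rule tendsto_sandwich)
    show "((\<lambda>x. v - 1 / x) \<longlongrightarrow> v) at_top" "((\<lambda>x. v) \<longlongrightarrow> v) at_top" by (real_asymp, simp)
    show "\<forall>\<^sub>F x in at_top. v - 1 / x \<le> real (nat \<lfloor>x * v\<rfloor>) / x"
      using eventually_gt_at_top[of 0]
    proof eventually_elim
      case (elim x)
      have "x * v - 1 \<le> real (nat \<lfloor>x * v\<rfloor>)" by linarith
      then have "(x * v - 1) / x \<le> real (nat \<lfloor>x * v\<rfloor>) / x" using elim by (intro divide_right_mono) auto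
      then show ?case using elim by (simp add: diff_divide_distrib)
    qed
    show "\<forall>\<^sub>F x in at_top. real (nat \<lfloor>x * v\<rfloor>) / x \<le> v"
      using eventually_gt_at_top[of 0]
    proof eventually_elim
      case (elim x)
      have "0 \<le> x * v" using elim v by simp
      then have "real (nat \<lfloor>x * v\<rfloor>) \<le> x * v" by linarith
      then show ?case using elim by (simp add: field_simps)
    qed
  qed
  moreover have "((\<lambda>x::real. x * ln (1 - 1 / x)) \<longlongrightarrow> -1) at_top" by real_asymp
  ultimately have "((\<lambda>x. exp (real (nat \<lfloor>x * v\<rfloor>) / x * (x * ln (1 - 1 / x)))) \<longlongrightarrow> exp (v * -1)) at_top"
    by (intro tendsto_intros)
  moreover have "\<forall>\<^sub>F x::real in at_top. exp (real (nat \<lfloor>x * v\<rfloor>) / x * (x * ln (1 - 1 / x))) = (1 - 1 / x) ^ nat \<lfloor>x * v\<rfloor>"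
    using eventually_gt_at_top[of 1] by eventually_elim (simp add: exp_of_nat_mult)
  ultimately have "((\<lambda>x. (1 - 1 / x) ^ nat \<lfloor>x * v\<rfloor>) \<longlongrightarrow> exp (v * -1)) at_top"
    by (rule Lim_transform_eventually)
  then show ?thesis by simp
qed

text \<open>Moves the successor into the real argument. At \<open>u = x * v\<close> the argument
  becomes \<open>(v + 1 / x) * x\<close>, a convergent scale to which locally uniform regular
  variation applies.\<close>

lemma abs_psum_Suc_nat_floor:
  assumes "u \<ge> 0"
  shows "abs_psum c (Suc (nat \<lfloor>u\<rfloor>)) = abs_psum_real c (u + 1)"
proof -
  have "nat \<lfloor>u + 1\<rfloor> = Suc (nat \<lfloor>u\<rfloor>)" using assms by (simp add: nat_add_distrib)
  then show ?thesis by simp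
qed

text \<open>With \<open>z = 1 - 1 / x\<close> the Cauchy product writes the series as
  \<open>1 / x\<close> times the sum of \<open>abs_psum c (Suc n) * z ^ n\<close>, hence as an
  integral over \<open>v\<close> with \<open>n = \<lfloor>x * v\<rfloor>\<close>. Divided by
  \<open>abs_psum_real c x\<close>, the integrand tends to
  \<open>v powr \<gamma> * exp (- v)\<close>, whose integral is the Gamma value.\<close>

lemma power_series_abs_asymptotics:
  fixes c :: "nat \<Rightarrow> real"
  assumes rv: "regularly_varying (abs_psum_real c) \<gamma>" and \<gamma>: "0 < \<gamma>" "\<gamma> < 1" and G: "\<And>i. \<bar>c i\<bar> \<le> G"
  shows "((\<lambda>x. (\<Sum>i. \<bar>c i\<bar> * (1 - 1 / x) ^ i) / abs_psum_real c x) \<longlongrightarrow> Gamma (1 + \<gamma>)) at_top"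
proof -
  define a where "a = abs_psum_real c"
  define s where "s = (\<lambda>x v. indicator {0..} v * (abs_psum c (Suc (nat \<lfloor>x * v\<rfloor>)) * (1 - 1 / x) ^ nat \<lfloor>x * v\<rfloor> / a x))"
  \<comment> \<open>Any Potter exponent above \<gamma> would do; 2 is chosen because the quadratic
    Taylor bound for \<open>exp\<close> then dominates the growth.\<close>
  obtain C x0 where C: "C > 0" "x0 > 0" "\<And>x. x \<ge> x0 \<Longrightarrow> a x > 0"
    "\<And>x y. x \<ge> x0 \<Longrightarrow> y \<ge> 1 \<Longrightarrow> a (y * x) \<le> C * y powr 2 * a x"
    using regularly_varying_potter[OF rv, of 0 2] \<gamma> mono_imp_mono_on[OF mono_abs_psum_real]
    unfolding a_def by auto
  \<comment> \<open>The 8 comes from \<open>(v + 1)\<^sup>2 \<le> 8 * exp ((v + 1) / 2)\<close>. The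
    power of \<open>1 - 1 / x\<close> is at most \<open>exp (1 - v)\<close>, and the exponents (v +
    1) / 2 and 1 - v add up to 3/2 - v/2.\<close>
  define w where "w = (\<lambda>v::real. 8 * C * exp (3 / 2) * (indicator {0..} v * exp (- (1 / 2) * v)))"
  have w_int: "integrable lborel w"
    unfolding w_def
    using has_bochner_integral_has_integral_nonneg[OF has_integral_exp_minus_to_infinity[of "1/2" 0]]
    by (intro integrable_mult_right) (auto dest: integrable.intros)
  have bound: "norm (s x v) \<le> w v" if x: "x \<ge> max x0 2" for x v
  proof (cases "v \<ge> 0")
    case True
    define n where "n = nat \<lfloor>x * v\<rfloor>"
    have x': "x \<ge> x0" "x \<ge> 2" using x by auto
    have z: "0 \<le> 1 - 1 / x" using x' by auto
    have "abs_psum c (Suc n) = a (x * v + 1)"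
      using abs_psum_Suc_nat_floor[of "x * v" c] True x' by (simp add: a_def n_def)
    also have "\<dots> \<le> a ((v + 1) * x)"
      unfolding a_def by (rule monoD[OF mono_abs_psum_real]) (use x' True in \<open>simp add: algebra_simps\<close>)
    also have "\<dots> \<le> C * (v + 1) powr 2 * a x" using C(4)[OF x'(1), of "v + 1"] True by simp
    finally have 1: "abs_psum c (Suc n) / a x \<le> C * (v + 1)\<^sup>2"
      using C(3)[OF x'(1)] True by (simp add: field_simps powr_numeral)
    have "0 \<le> (v + 1) / 2" using True by simp
    with exp_lower_Taylor_quadratic[OF this] have "((v + 1) / 2)\<^sup>2 / 2 \<le> exp ((v + 1) / 2)" by linarith
    then have "(v + 1)\<^sup>2 \<le> 8 * exp ((v + 1) / 2)" by (simp add: power_divide)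
    then have "C * (v + 1)\<^sup>2 \<le> C * (8 * exp ((v + 1) / 2))" using C(1) by (intro mult_left_mono) auto
    with 1 have 1: "abs_psum c (Suc n) / a x \<le> C * (8 * exp ((v + 1) / 2))" by linarith
    have "(1 - 1 / x) ^ n \<le> exp (- 1 / x) ^ n"
      using z exp_ge_add_one_self[of "- 1 / x"] by (intro power_mono) auto
    also have "\<dots> = exp (- (real n / x))" by (simp flip: exp_of_nat_mult)
    also have "\<dots> \<le> exp (1 - v)"
    proof -
      have "x * v - 1 \<le> real n" unfolding n_def by linarith
      then have "(x * v - 1) / x \<le> real n / x" using x' by (intro divide_right_mono) auto
      then have "v - 1 / x \<le> real n / x" using x' by (simp add: diff_divide_distrib)
      moreover have "1 / x \<le> 1" using x' by simp
      ultimately show ?thesis by simp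
    qed
    finally have 2: "(1 - 1 / x) ^ n \<le> exp (1 - v)" .
    have "norm (s x v) = (abs_psum c (Suc n) / a x) * (1 - 1 / x) ^ n"
      using True C(3)[OF x'(1)] z abs_psum_nonneg[of c "Suc n"] by (simp add: s_def n_def)
    also have "\<dots> \<le> (C * (8 * exp ((v + 1) / 2))) * exp (1 - v)"
      using 1 2 z C by (intro mult_mono) auto
    also have "\<dots> = w v"
    proof -
      have "(v + 1) / 2 + (1 - v) = 3 / 2 + - (1 / 2) * v" by (simp add: field_simps)
      then have "exp ((v + 1) / 2) * exp (1 - v) = exp (3 / 2) * exp (- (1 / 2) * v)"
        by (simp only: flip: exp_add)
      then show ?thesis using True by (simp add: w_def mult.assoc)
    qed
    finally show ?thesis .
  qed (auto simp: s_def w_def)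
  have s_meas: "s x \<in> borel_measurable lborel" for x
    unfolding s_def using measurable_nat_floor_comp[of "\<lambda>n. abs_psum c (Suc n) * (1 - 1 / x) ^ n / a x" x]
    by (intro borel_measurable_times borel_measurable_indicator) auto
  \<comment> \<open>Locally uniform convergence needs a positive limiting scale, so the null set
    \<open>{0}\<close> is excluded.\<close>
  have lim: "((\<lambda>x. s x v) \<longlongrightarrow> indicator {0..} v * (v powr \<gamma> * exp (- v))) at_top" if "v \<noteq> 0" for v
  proof (cases "v > 0")
    case True
    have "((\<lambda>x::real. v + 1 / x) \<longlongrightarrow> v) at_top" by real_asymp
    from regularly_varying_tendsto_mono[OF rv mono_abs_psum_real filterlim_ident this True]
    have "((\<lambda>x. a ((v + 1 / x) * x) / a x) \<longlongrightarrow> v powr \<gamma>) at_top" by (simp add: a_def)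
    from tendsto_mult[OF this power_floor_tendsto_exp[OF True]]
    have "((\<lambda>x. a ((v + 1 / x) * x) / a x * (1 - 1 / x) ^ nat \<lfloor>x * v\<rfloor>) \<longlongrightarrow> v powr \<gamma> * exp (- v)) at_top" .
    moreover have "\<forall>\<^sub>F x in at_top. a ((v + 1 / x) * x) / a x * (1 - 1 / x) ^ nat \<lfloor>x * v\<rfloor> = s x v"
      using eventually_gt_at_top[of 0]
    proof eventually_elim
      case (elim x)
      have "(v + 1 / x) * x = x * v + 1" using elim by (simp add: field_simps)
      then show ?case using abs_psum_Suc_nat_floor[of "x * v" c] True elim
        by (simp add: s_def a_def)
    qed
    ultimately have "((\<lambda>x. s x v) \<longlongrightarrow> v powr \<gamma> * exp (- v)) at_top" by (rule Lim_transform_eventually)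
    then show ?thesis using True by simp
  qed (use that in \<open>auto simp: s_def\<close>)
  have "((\<lambda>x. integral\<^sup>L lborel (s x)) \<longlongrightarrow>
      integral\<^sup>L lborel (\<lambda>v. indicator {0..} v * (v powr \<gamma> * exp (- v)))) at_top"
  proof (rule integral_dominated_convergence_at_top[OF _ s_meas w_int])
    show "AE v in lborel. ((\<lambda>x. s x v) \<longlongrightarrow> indicator {0..} v * (v powr \<gamma> * exp (- v))) at_top"
      using AE_lborel_singleton[of 0] by eventually_elim (rule lim)
    show "\<forall>\<^sub>F x in at_top. AE v in lborel. norm (s x v) \<le> w v"
      using eventually_ge_at_top[of "max x0 2"] by eventually_elim (use bound in auto)
  qed auto
  then have "((\<lambda>x. integral\<^sup>L lborel (s x)) \<longlongrightarrow> Gamma (1 + \<gamma>)) at_top"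
    using has_bochner_integral_integral_eq[OF integral_powr_exp[OF \<gamma>(1)]] by simp
  moreover have "\<forall>\<^sub>F x in at_top. integral\<^sup>L lborel (s x) = (\<Sum>i. \<bar>c i\<bar> * (1 - 1 / x) ^ i) / abs_psum_real c x"
    using eventually_ge_at_top[of "max x0 2"]
  proof eventually_elim
    case (elim x)
    define z where "z = 1 - 1 / x"
    have z: "0 \<le> z" "z < 1" using elim by (auto simp: z_def)
    have ax: "a x > 0" using C elim by simp
    define f where "f = (\<lambda>n. abs_psum c (Suc n) * z ^ n / a x)"
    have s_eq: "s x = (\<lambda>v. indicator {0..} v * f (nat \<lfloor>x * v\<rfloor>))" by (simp add: s_def f_def z_def)
    have "integrable lborel (s x)"
      by (rule Bochner_Integration.integrable_bound[OF w_int s_meas])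
        (use bound[OF elim] in \<open>auto intro!: AE_I2 order_trans[OF _ abs_ge_self]\<close>)
    then have 1: "f sums (x * integral\<^sup>L lborel (s x))"
      unfolding s_eq using elim z ax abs_psum_nonneg
      by (intro sums_integral_nat_floor) (auto simp: f_def)
    have "summable (\<lambda>i. \<bar>c i\<bar> * z ^ i)"
      by (rule summable_comparison_test'[OF summable_mult[OF summable_geometric[of z], of G]])
        (use z G in \<open>auto intro!: mult_right_mono\<close>)
    from sums_divide[OF cauchy_product_geometric[OF z this], of "a x"]
    have "f sums ((\<Sum>i. \<bar>c i\<bar> * z ^ i) / (1 - z) / a x)" by (simp add: f_def)
    from sums_unique2[OF 1 this] have "x * integral\<^sup>L lborel (s x) = x * ((\<Sum>i. \<bar>c i\<bar> * z ^ i) / a x)"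
      by (simp add: z_def)
    then have "integral\<^sup>L lborel (s x) = (\<Sum>i. \<bar>c i\<bar> * z ^ i) / a x"
      using elim by (subst (asm) mult_left_cancel) auto
    then show ?case by (simp add: a_def z_def)
  qed
  ultimately show ?thesis by (rule Lim_transform_eventually)
qed

text \<open>Only the finitely many negative coefficients separate \<open>g\<close> from the series
  with absolute values. On [0, 1) they contribute at most the constant \<open>D\<close>, which
  vanishes after division by the divergent partial sums.\<close>

lemma power_series_asymptotics:
  fixes c :: "nat \<Rightarrow> real"
  assumes g: "\<And>x. -1 < x \<Longrightarrow> x < 1 \<Longrightarrow> (\<lambda>i. c i * x ^ i) sums g x"
    and rv: "regularly_varying (abs_psum_real c) \<gamma>" and \<gamma>: "0 < \<gamma>" "\<gamma> < 1" and G: "\<And>i. \<bar>c i\<bar> \<le> G"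
    and pos: "\<forall>\<^sub>F n in sequentially. c n > 0" and at: "filterlim (abs_psum_real c) at_top at_top"
  shows "((\<lambda>x. g (1 - 1 / x) / abs_psum_real c x) \<longlongrightarrow> Gamma (1 + \<gamma>)) at_top"
proof -
  obtain N where N: "\<And>n. n \<ge> N \<Longrightarrow> c n > 0" using pos by (auto simp: eventually_sequentially)
  define D where "D = (\<Sum>i<N. \<bar>c i\<bar> - c i)"
  define h where "h = (\<lambda>x. \<Sum>i. \<bar>c i\<bar> * (1 - 1 / x) ^ i)"
  have diff: "\<bar>g (1 - 1 / x) - h x\<bar> \<le> D" if x: "x > 1" for x
  proof -
    define z where "z = 1 - 1 / x"
    have z: "0 \<le> z" "z < 1" using x by (auto simp: z_def)
    have "summable (\<lambda>i. \<bar>c i\<bar> * z ^ i)"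
      by (rule summable_comparison_test'[OF summable_mult[OF summable_geometric[of z], of G]])
        (use z G in \<open>auto intro!: mult_right_mono\<close>)
    then have "(\<lambda>i. \<bar>c i\<bar> * z ^ i) sums h x" by (simp add: h_def z_def summable_sums)
    from sums_diff[OF this g[of z]] z have "(\<lambda>i. (\<bar>c i\<bar> - c i) * z ^ i) sums (h x - g z)"
      by (simp add: algebra_simps)
    moreover have "(\<lambda>i. (\<bar>c i\<bar> - c i) * z ^ i) sums (\<Sum>i<N. (\<bar>c i\<bar> - c i) * z ^ i)"
      by (rule sums_finite) (use N in \<open>auto simp: not_less abs_of_pos\<close>)
    ultimately have eq: "h x - g z = (\<Sum>i<N. (\<bar>c i\<bar> - c i) * z ^ i)" by (rule sums_unique2)
    moreover have "(\<Sum>i<N. (\<bar>c i\<bar> - c i) * z ^ i) \<ge> 0" using z by (intro sum_nonneg mult_nonneg_nonneg) auto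
    moreover have "(\<Sum>i<N. (\<bar>c i\<bar> - c i) * z ^ i) \<le> D"
      unfolding D_def using z by (intro sum_mono mult_left_le) (auto intro: power_le_one)
    ultimately show ?thesis by (simp add: z_def abs_le_iff)
  qed
  have "((\<lambda>x. g (1 - 1 / x) / abs_psum_real c x - h x / abs_psum_real c x) \<longlongrightarrow> 0) at_top"
  proof (rule Lim_null_comparison)
    show "((\<lambda>x. D / abs_psum_real c x) \<longlongrightarrow> 0) at_top"
      by (rule real_tendsto_divide_at_top[OF tendsto_const at])
    show "\<forall>\<^sub>F x in at_top. norm (g (1 - 1 / x) / abs_psum_real c x - h x / abs_psum_real c x) \<le> D / abs_psum_real c x"
      using eventually_gt_at_top[of 1]
    proof eventually_elim
      case (elim x)
      have "norm (g (1 - 1 / x) / abs_psum_real c x - h x / abs_psum_real c x)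
          = \<bar>g (1 - 1 / x) - h x\<bar> / abs_psum_real c x"
        using abs_psum_nonneg by (simp add: abs_divide flip: diff_divide_distrib)
      also have "\<dots> \<le> D / abs_psum_real c x"
        using diff[OF elim] abs_psum_nonneg by (intro divide_right_mono) auto
      finally show ?case .
    qed
  qed
  from tendsto_add[OF this power_series_abs_asymptotics[OF rv \<gamma> G]] show ?thesis by (simp add: h_def)
qed

text \<open>Each doubling of the argument multiplies \<open>f\<close> by at least
  \<open>q > 1\<close>. Since \<open>f\<close> need not be monotone, growth along every sequence
  \<open>2 ^ n * t\<close> says nothing uniform in \<open>t\<close>; the eventual lower bound
  \<open>d\<close> gives all these sequences a common start.\<close>

lemma regularly_varying_at_top:
  assumes rv: "regularly_varying f \<rho>" and \<rho>: "\<rho> > 0" and d: "d > 0" and low: "\<forall>\<^sub>F t in at_top. f t \<ge> d"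
  shows "filterlim f at_top at_top"
proof -
  define q where "q = (2::real) powr (\<rho> / 2)"
  have q: "q > 1" using \<rho> by (simp add: q_def)
  have "\<forall>\<^sub>F t in at_top. f (2 * t) / f t > q"
    using order_tendstoD(1)[OF regularly_varying_ratio[OF rv, of 2], of q] \<rho> by (simp add: q_def)
  with low have "\<forall>\<^sub>F t in at_top. f t \<ge> d \<and> f (2 * t) \<ge> q * f t"
    by eventually_elim (use d in \<open>auto simp: field_simps\<close>)
  then obtain T0 where T0: "\<And>t. t \<ge> T0 \<Longrightarrow> f t \<ge> d \<and> f (2 * t) \<ge> q * f t"
    by (auto simp: eventually_at_top_linorder)
  define T where "T = max T0 1"
  have pow: "f t \<ge> q ^ n * d" if "t \<ge> 2 ^ n * T" for n t
    using that
  proof (induction n arbitrary: t)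
    case 0
    then show ?case using T0 by (simp add: T_def)
  next
    case (Suc n)
    have le: "2 ^ n * T \<le> t / 2" using Suc.prems by simp
    have "1 * T \<le> 2 ^ n * T" by (intro mult_right_mono) (auto simp: T_def)
    then have "t / 2 \<ge> T0" using le by (simp add: T_def)
    then have "q * f (t / 2) \<le> f t" using T0[of "t / 2"] by simp
    moreover have "q * (q ^ n * d) \<le> q * f (t / 2)" using Suc.IH[OF le] q by (intro mult_left_mono) auto
    ultimately show ?case by (simp add: mult_ac)
  qed
  show ?thesis
    unfolding filterlim_at_top
  proof
    fix K
    obtain n where "K / d < q ^ n" using real_arch_pow[OF q] by auto
    then have n: "K \<le> q ^ n * d" using d by (simp add: field_simps)
    show "\<forall>\<^sub>F t in at_top. K \<le> f t"
      using eventually_ge_at_top[of "2 ^ n * T"] by eventually_elim (use n pow in force)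
  qed
qed

section \<open>Asymptotics of the tail sum\<close>

text \<open>For \<open>k\<close> near \<open>U t * v\<close> the partial sum is about
  \<open>v powr \<gamma> * t / L\<close>, so the summand is about
  \<open>Q t * (1 + (m / L) * v powr \<gamma>) powr - \<alpha>\<close>. Passing to an integral over
  \<open>v\<close> supplies the factor \<open>U t\<close>; the rest is domination by Potter bounds
  on both \<open>Q\<close> and the partial sums.\<close>

lemma shifted_tail_sum_asymptotics:
  fixes c :: "nat \<Rightarrow> real" and Q U :: "real \<Rightarrow> real"
  assumes Q: "regularly_varying Q (- \<alpha>)" "antimono Q" "\<And>t. Q t > 0"
    and rv: "regularly_varying (abs_psum_real c) \<gamma>"
    and U: "filterlim U at_top at_top"
    and lim: "((\<lambda>t. t / abs_psum_real c (U t)) \<longlongrightarrow> L) at_top" and L: "L > 0"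
    and m: "m > 0" and \<gamma>: "\<gamma> > 0" and \<alpha>: "1 / \<gamma> < \<alpha>"
  shows "\<forall>\<^sub>F t in at_top. summable (\<lambda>k. Q (t + m * abs_psum c (Suc k)))"
    and "((\<lambda>t. (\<Sum>k. Q (t + m * abs_psum c (Suc k))) / (U t * Q t)) \<longlongrightarrow>
      (m / L) powr - (1 / \<gamma>) * (1 / \<gamma> * Beta (1 / \<gamma>) (\<alpha> - 1 / \<gamma>))) at_top"
proof -
  define a where "a = abs_psum_real c"
  note mono_a = mono_abs_psum_real[of c, folded a_def]
  \<comment> \<open>Since \<alpha> * \<gamma> > 1, both exponents can be lowered, one midpoint after
    the other, with \<alpha>' * \<gamma>' > 1 still true. This is exactly what makes the dominating
    function integrable.\<close>
  define \<alpha>' where "\<alpha>' = (\<alpha> + 1 / \<gamma>) / 2"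
  have \<alpha>': "1 / \<gamma> < \<alpha>'" "\<alpha>' < \<alpha>" using \<alpha> by (auto simp: \<alpha>'_def)
  have \<alpha>'0: "\<alpha>' > 0" using \<alpha>' \<gamma> by (smt (verit) divide_pos_pos)
  define \<gamma>' where "\<gamma>' = (\<gamma> + 1 / \<alpha>') / 2"
  have "1 / \<alpha>' < \<gamma>" using \<alpha>' \<alpha>'0 \<gamma> by (simp add: field_simps)
  then have \<gamma>': "1 / \<alpha>' < \<gamma>'" "\<gamma>' < \<gamma>" by (auto simp: \<gamma>'_def)
  have \<gamma>'0: "\<gamma>' > 0" using \<gamma>' \<alpha>'0 by (smt (verit) divide_pos_pos)
  have \<gamma>\<alpha>': "1 / \<gamma>' < \<alpha>'" using \<gamma>' \<alpha>'0 \<gamma>'0 by (simp add: field_simps)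

  obtain C2 t0 where C2: "C2 > 0" "t0 > 0" "\<And>t y. t \<ge> t0 \<Longrightarrow> y \<ge> 1 \<Longrightarrow> Q (y * t) \<le> C2 * y powr (- \<alpha>') * Q t"
    using regularly_varying_potter[OF Q(1), of 0 "- \<alpha>'"] monotone_on_subset[OF Q(2)] \<alpha>' by auto
  obtain b where b: "\<And>x. x \<ge> b \<Longrightarrow> a x > 0"
    using regularly_varying_pos[OF rv] by (auto simp: eventually_at_top_linorder a_def)
  \<comment> \<open>A lower bound for \<open>a\<close> is the Potter bound for its reciprocal, which
    decreases only where \<open>a\<close> is positive.\<close>
  have "antimono_on {b..} (\<lambda>x. 1 / a x)"
    using b by (auto intro!: monotone_onI divide_left_mono mult_pos_pos monoD[OF mono_a])
  then obtain C1 x0 where C1: "C1 > 0" "x0 > 0" "\<And>x. x \<ge> x0 \<Longrightarrow> 1 / a x > 0"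
    "\<And>x y. x \<ge> x0 \<Longrightarrow> y \<ge> 1 \<Longrightarrow> 1 / a (y * x) \<le> C1 * y powr (- \<gamma>') * (1 / a x)"
    using regularly_varying_potter[OF regularly_varying_inverse[OF rv], of b "- \<gamma>'"] \<gamma>' unfolding a_def by auto
  have low: "a (y * x) \<ge> y powr \<gamma>' * a x / C1" if "x \<ge> x0" "y \<ge> 1" for x y
  proof -
    have "1 * x \<le> y * x" using that C1(2) by (intro mult_right_mono) auto
    then have p: "a x > 0" "a (y * x) > 0" using C1(3)[of x] C1(3)[of "y * x"] that by auto
    show ?thesis using C1(4)[OF that] p C1(1) that by (simp add: powr_minus field_simps)
  qed

  define \<kappa> where "\<kappa> = m / L"
  \<comment> \<open>The factor \<open>2 * L\<close> comes from the eventual inequality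
    \<open>t < 2 * L * a (U t)\<close>, the factor \<open>C1\<close> from the lower Potter bound for
    \<open>a\<close>.\<close>
  define \<kappa>' where "\<kappa>' = m / (2 * L * C1)"
  have \<kappa>: "\<kappa> > 0" "\<kappa>' > 0" using m L C1 by (auto simp: \<kappa>_def \<kappa>'_def)
  \<comment> \<open>\<open>C2\<close> serves \<open>v \<ge> 1\<close>, where the Potter bound for
    \<open>Q\<close> is used. For \<open>0 < v < 1\<close> the ratio of tails is at most 1 while the
    weight is at least \<open>(1 + \<kappa>') powr - \<alpha>'\<close>, which the second summand
    compensates.\<close>
  define K where "K = C2 + (1 + \<kappa>') powr \<alpha>'"
  have K: "K \<ge> C2" "K \<ge> (1 + \<kappa>') powr \<alpha>'" using C2 by (auto simp: K_def)
  define s where "s = (\<lambda>t v. indicator {0..} v * (Q (t + m * abs_psum c (Suc (nat \<lfloor>U t * v\<rfloor>))) / Q t))"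
  define f where "f = (\<lambda>v. indicator {0<..} v * (1 + \<kappa> * v powr \<gamma>) powr (- \<alpha>))"
  define w where "w = (\<lambda>v. K * (indicator {0<..} v * (1 + \<kappa>' * v powr \<gamma>') powr (- \<alpha>')))"
  have w_int: "integrable lborel w"
    unfolding w_def using integral_powr_Beta[OF \<gamma>'0 \<kappa>(2) \<gamma>\<alpha>']
    by (intro integrable_mult_right) (auto dest: integrable.intros)
  have s_meas: "s t \<in> borel_measurable lborel" for t
    unfolding s_def using measurable_nat_floor_comp[of "\<lambda>n. Q (t + m * abs_psum c (Suc n)) / Q t" "U t"]
    by (intro borel_measurable_times borel_measurable_indicator) auto

  have "\<forall>\<^sub>F t in at_top. t / a (U t) < 2 * L"
    using order_tendstoD(2)[OF lim, of "2 * L"] L by (simp add: a_def)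
  moreover have "\<forall>\<^sub>F t in at_top. U t \<ge> max x0 1" using U unfolding filterlim_at_top by blast
  ultimately have good: "\<forall>\<^sub>F t in at_top. t / a (U t) < 2 * L \<and> U t \<ge> max x0 1 \<and> t \<ge> max t0 1"
    using eventually_ge_at_top[of "max t0 1"] by eventually_elim auto
  have bound: "norm (s t v) \<le> w v"
    if t: "t / a (U t) < 2 * L \<and> U t \<ge> max x0 1 \<and> t \<ge> max t0 1" and v: "v \<noteq> 0" for t v
  proof (cases "v > 0")
    case True
    define A where "A = abs_psum c (Suc (nat \<lfloor>U t * v\<rfloor>))"
    have A0: "A \<ge> 0" by (simp add: A_def abs_psum_nonneg)
    have t': "t \<ge> t0" "t \<ge> 1" "U t \<ge> x0" "U t \<ge> 1" using t by auto
    have aU: "a (U t) > 0" using C1(3)[OF t'(3)] by simp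
    have Qt: "Q t > 0" by fact
    define y where "y = 1 + \<kappa>' * v powr \<gamma>'"
    have y: "y \<ge> 1" using \<kappa> by (simp add: y_def)
    have "Q (t + m * A) \<le> K * y powr (- \<alpha>') * Q t"
    proof (cases "v \<ge> 1")
      case v1: True
      have "A = a (U t * v + 1)" unfolding A_def a_def using t' True by (intro abs_psum_Suc_nat_floor) auto
      also have "\<dots> \<ge> a (v * U t)" by (intro monoD[OF mono_a]) (simp add: mult.commute)
      finally have "A \<ge> v powr \<gamma>' * a (U t) / C1" using low[OF t'(3) v1] by simp
      moreover have "v powr \<gamma>' * a (U t) / C1 \<ge> v powr \<gamma>' * (t / (2 * L)) / C1"
        using t aU L C1(1) by (intro divide_right_mono mult_left_mono) (auto simp: field_simps)
      ultimately have "A \<ge> v powr \<gamma>' * (t / (2 * L)) / C1" by linarith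
      then have "m * A \<ge> m * (v powr \<gamma>' * (t / (2 * L)) / C1)" using m by (intro mult_left_mono) auto
      also have "m * (v powr \<gamma>' * (t / (2 * L)) / C1) = \<kappa>' * v powr \<gamma>' * t" by (simp add: \<kappa>'_def)
      finally have "y * t \<le> t + m * A" by (simp add: y_def algebra_simps)
      then have "Q (t + m * A) \<le> Q (y * t)" using Q(2) by (auto simp: monotone_def)
      also have "\<dots> \<le> C2 * y powr (- \<alpha>') * Q t" by (rule C2(3)[OF t'(1) y])
      also have "\<dots> \<le> K * y powr (- \<alpha>') * Q t"
        using K(1) Qt by (intro mult_right_mono) auto
      finally show ?thesis .
    next
      case False
      have "v powr \<gamma>' \<le> 1" using False True \<gamma>'0 by (simp add: powr_le1)
      then have "y \<le> 1 + \<kappa>'" using \<kappa> by (simp add: y_def mult_left_le)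
      then have "(1 + \<kappa>') powr (- \<alpha>') \<le> y powr (- \<alpha>')" using y \<alpha>'0 by (intro powr_mono2') auto
      then have "(1 + \<kappa>') powr \<alpha>' * (1 + \<kappa>') powr (- \<alpha>') \<le> K * y powr (- \<alpha>')"
        using K C2(1) by (intro mult_mono) auto
      then have one: "1 \<le> K * y powr (- \<alpha>')" using \<kappa> by (simp flip: powr_add)
      have "Q (t + m * A) \<le> Q t" using Q(2) m A0 by (auto simp: monotone_def)
      also have "\<dots> \<le> K * y powr (- \<alpha>') * Q t" using mult_right_mono[OF one, of "Q t"] Qt by simp
      finally show ?thesis .
    qed
    then have "Q (t + m * A) / Q t \<le> K * y powr (- \<alpha>')" using Qt by (simp add: field_simps)
    moreover have "norm (s t v) = Q (t + m * A) / Q t"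
      using True Q(3) by (simp add: s_def A_def less_imp_le)
    ultimately show ?thesis using True by (simp add: w_def y_def)
  qed (use v K C2 in \<open>auto simp: s_def w_def\<close>)

  have ptlim: "((\<lambda>t. s t v) \<longlongrightarrow> f v) at_top" if v: "v \<noteq> 0" for v
  proof (cases "v > 0")
    case True
    have "((\<lambda>t. 1 / U t) \<longlongrightarrow> 0) at_top" by (rule real_tendsto_divide_at_top[OF tendsto_const U])
    from tendsto_add[OF tendsto_const[of v] this] have "((\<lambda>t. v + 1 / U t) \<longlongrightarrow> v) at_top" by simp
    from regularly_varying_tendsto_mono[OF rv mono_abs_psum_real U this True]
    have "((\<lambda>t. a ((v + 1 / U t) * U t) / a (U t)) \<longlongrightarrow> v powr \<gamma>) at_top" by (simp add: a_def)
    then have "((\<lambda>t. 1 + m * (a ((v + 1 / U t) * U t) / a (U t) * inverse (t / a (U t))))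
        \<longlongrightarrow> 1 + m * (v powr \<gamma> * inverse L)) at_top"
      using lim L by (intro tendsto_intros) (auto simp: a_def)
    moreover have "\<forall>\<^sub>F t in at_top. 1 + m * (a ((v + 1 / U t) * U t) / a (U t) * inverse (t / a (U t)))
        = (t + m * abs_psum c (Suc (nat \<lfloor>U t * v\<rfloor>))) / t"
      using good
    proof eventually_elim
      case (elim t)
      have "(v + 1 / U t) * U t = U t * v + 1" using elim by (simp add: field_simps)
      then have eq: "a ((v + 1 / U t) * U t) = abs_psum c (Suc (nat \<lfloor>U t * v\<rfloor>))"
        using abs_psum_Suc_nat_floor[of "U t * v" c] True elim by (simp add: a_def)
      have "a (U t) > 0" using C1(3)[of "U t"] elim by simp
      then show ?case unfolding eq using elim by (simp add: field_simps)
    qed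
    ultimately have "((\<lambda>t. (t + m * abs_psum c (Suc (nat \<lfloor>U t * v\<rfloor>))) / t) \<longlongrightarrow> 1 + m * (v powr \<gamma> * inverse L)) at_top"
      by (rule Lim_transform_eventually)
    then have "((\<lambda>t. (t + m * abs_psum c (Suc (nat \<lfloor>U t * v\<rfloor>))) / t) \<longlongrightarrow> 1 + \<kappa> * v powr \<gamma>) at_top"
      by (simp add: \<kappa>_def field_simps)
    moreover have "1 + \<kappa> * v powr \<gamma> > 0" using \<kappa> by (simp add: add_pos_nonneg)
    ultimately have "((\<lambda>t. Q ((t + m * abs_psum c (Suc (nat \<lfloor>U t * v\<rfloor>))) / t * t) / Q t)
        \<longlongrightarrow> (1 + \<kappa> * v powr \<gamma>) powr (- \<alpha>)) at_top"
      by (rule regularly_varying_tendsto_antimono[OF Q filterlim_ident])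
    moreover have "\<forall>\<^sub>F t in at_top. Q ((t + m * abs_psum c (Suc (nat \<lfloor>U t * v\<rfloor>))) / t * t) / Q t = s t v"
      using good by eventually_elim (use True in \<open>simp add: s_def\<close>)
    ultimately have "((\<lambda>t. s t v) \<longlongrightarrow> (1 + \<kappa> * v powr \<gamma>) powr (- \<alpha>)) at_top"
      by (rule Lim_transform_eventually)
    then show ?thesis using True by (simp add: f_def)
  qed (use v in \<open>auto simp: s_def f_def\<close>)

  have AE0: "AE v::real in lborel. v \<noteq> 0" by (rule AE_lborel_singleton)
  have "((\<lambda>t. integral\<^sup>L lborel (s t)) \<longlongrightarrow> integral\<^sup>L lborel f) at_top"
  proof (rule integral_dominated_convergence_at_top[OF _ s_meas w_int])
    show "AE v in lborel. ((\<lambda>t. s t v) \<longlongrightarrow> f v) at_top"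
      using AE0 by eventually_elim (rule ptlim)
    show "\<forall>\<^sub>F t in at_top. AE v in lborel. norm (s t v) \<le> w v"
      using good
    proof eventually_elim
      case (elim t)
      show ?case using AE0 by eventually_elim (use bound elim in auto)
    qed
  qed (auto simp: f_def)
  then have I: "((\<lambda>t. integral\<^sup>L lborel (s t)) \<longlongrightarrow>
      \<kappa> powr - (1 / \<gamma>) * (1 / \<gamma> * Beta (1 / \<gamma>) (\<alpha> - 1 / \<gamma>))) at_top"
    using has_bochner_integral_integral_eq[OF integral_powr_Beta[OF \<gamma> \<kappa>(1) \<alpha>]] by (simp add: f_def)
  have sums: "(\<lambda>k. Q (t + m * abs_psum c (Suc k))) sums (U t * Q t * integral\<^sup>L lborel (s t))"
    if t: "t / a (U t) < 2 * L \<and> U t \<ge> max x0 1 \<and> t \<ge> max t0 1" for t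
  proof -
    have "integrable lborel (s t)"
    proof (rule Bochner_Integration.integrable_bound[OF w_int s_meas])
      show "AE v in lborel. norm (s t v) \<le> norm (w v)"
        using AE0 by eventually_elim (use bound[OF t] in \<open>auto intro: order_trans[OF _ abs_ge_self]\<close>)
    qed
    then have "(\<lambda>k. Q (t + m * abs_psum c (Suc k)) / Q t) sums (U t * integral\<^sup>L lborel (s t))"
      unfolding s_def using t Q(3)[THEN less_imp_le] by (intro sums_integral_nat_floor) auto
    from sums_mult[OF this, of "Q t"] show ?thesis using Q(3)[of t] by (simp add: mult_ac)
  qed
  show "\<forall>\<^sub>F t in at_top. summable (\<lambda>k. Q (t + m * abs_psum c (Suc k)))"
    using good by eventually_elim (rule sums_summable[OF sums])
  have "\<forall>\<^sub>F t in at_top. integral\<^sup>L lborel (s t) = (\<Sum>k. Q (t + m * abs_psum c (Suc k))) / (U t * Q t)"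
    using good
  proof eventually_elim
    case (elim t)
    have "U t * Q t \<noteq> 0" using Q(3)[of t] elim by simp
    then show ?case using sums_unique[OF sums[OF elim]] by (metis nonzero_mult_div_cancel_left)
  qed
  with I show "((\<lambda>t. (\<Sum>k. Q (t + m * abs_psum c (Suc k))) / (U t * Q t)) \<longlongrightarrow>
      (m / L) powr - (1 / \<gamma>) * (1 / \<gamma> * Beta (1 / \<gamma>) (\<alpha> - 1 / \<gamma>))) at_top"
    unfolding \<kappa>_def by (rule Lim_transform_eventually)
qed

section \<open>A Chernoff bound and a Bonferroni inequality\<close>

text \<open>A remainder of order \<open>p \<le> 2\<close> replaces the quadratic one because second
  moments may be infinite. For \<open>\<bar>x\<bar> \<le> 1\<close> the square is below
  \<open>\<bar>x\<bar> powr p\<close>; outside, the factor \<open>exp R\<close> and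
  \<open>\<bar>x\<bar> powr p \<ge> \<bar>x\<bar>\<close> suffice.\<close>

lemma exp_le_add_powr:
  fixes x p R :: real
  assumes p: "1 \<le> p" "p \<le> 2" and R: "\<bar>x\<bar> \<le> R"
  shows "exp x \<le> 1 + x + \<bar>x\<bar> powr p * exp R"
proof -
  have eR: "exp R \<ge> 1" using R by (simp add: one_le_exp_iff)
  consider "\<bar>x\<bar> \<le> 1" | "x > 1" | "x < -1" by linarith
  then show ?thesis
  proof cases
    case 1
    have "exp x \<le> 1 + x + x\<^sup>2"
    proof (cases "x \<ge> 0")
      case True
      then show ?thesis using 1 exp_bound[of x] by simp
    next
      case False
      define y where "y = - x"
      have y: "0 \<le> y" "y \<le> 1" using False 1 by (auto simp: y_def)
      have low: "1 + y + y\<^sup>2 / 2 \<le> exp y" by (rule exp_lower_Taylor_quadratic[OF y(1)])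
      have pos: "1 - y + y\<^sup>2 \<ge> 0" using y by (smt (verit) zero_le_power2)
      \<comment> \<open>The product with a lower bound for \<open>exp y\<close> is at least 1, so
        \<open>1 - y + y\<^sup>2\<close> dominates \<open>exp (- y)\<close>.\<close>
      have "(1 - y + y\<^sup>2) * (1 + y + y\<^sup>2 / 2) = 1 + y\<^sup>2 / 2 + y ^ 3 / 2 + y ^ 4 / 2"
        by (simp add: field_simps power2_eq_square power3_eq_cube power4_eq_xxxx)
      also have "\<dots> \<ge> 1" using y by simp
      finally have "1 \<le> (1 - y + y\<^sup>2) * (1 + y + y\<^sup>2 / 2)" .
      also have "\<dots> \<le> (1 - y + y\<^sup>2) * exp y" by (rule mult_left_mono[OF low pos])
      finally have "exp (- y) \<le> 1 - y + y\<^sup>2" by (simp add: exp_minus field_simps)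
      then show ?thesis by (simp add: y_def)
    qed
    also have "x\<^sup>2 \<le> \<bar>x\<bar> powr p * 1"
    proof (cases "x = 0")
      case False
      then have "x\<^sup>2 = \<bar>x\<bar> powr 2" by (simp add: powr_numeral)
      also have "\<dots> \<le> \<bar>x\<bar> powr p" using 1 False p by (intro powr_mono') auto
      finally show ?thesis by simp
    qed auto
    also have "\<bar>x\<bar> powr p * 1 \<le> \<bar>x\<bar> powr p * exp R" using eR by (intro mult_left_mono) auto
    finally show ?thesis by simp
  next
    case 2
    have "exp x \<le> 1 * exp R" using R by simp
    also have "\<dots> \<le> \<bar>x\<bar> powr p * exp R"
      using 2 p by (intro mult_right_mono ge_one_powr_ge_zero) auto
    finally show ?thesis using 2 by simp
  next
    case 3
    have "\<bar>x\<bar> powr 1 \<le> \<bar>x\<bar> powr p" using 3 p by (intro powr_mono) auto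
    moreover have "\<bar>x\<bar> powr p * 1 \<le> \<bar>x\<bar> powr p * exp R" using eR by (intro mult_left_mono) auto
    moreover have "\<bar>x\<bar> powr 1 = - x" using 3 by simp
    ultimately have "1 \<le> 1 + x + \<bar>x\<bar> powr p * exp R" by linarith
    moreover have "exp x \<le> 1" using 3 by simp
    ultimately show ?thesis by linarith
  qed
qed

text \<open>Markov's inequality for the exponential of \<open>l\<close> times the sum, whose
  expectation factorises by independence. The parameter \<open>l\<close> stays free; it will be
  taken of order \<open>ln y / y\<close> at level \<open>y\<close>.\<close>

lemma (in prob_space) chernoff_bounded_sum:
  fixes Y :: "'i \<Rightarrow> 'a \<Rightarrow> real"
  assumes fin: "finite I" and indep: "indep_vars (\<lambda>_. borel) Y I"
    and B: "\<And>i \<omega>. i \<in> I \<Longrightarrow> \<omega> \<in> space M \<Longrightarrow> \<bar>Y i \<omega>\<bar> \<le> B" and p: "1 \<le> p" "p \<le> 2" and l: "l > 0"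
    and V: "(\<Sum>i\<in>I. expectation (\<lambda>\<omega>. \<bar>Y i \<omega>\<bar> powr p)) \<le> V"
  shows "prob {\<omega> \<in> space M. (\<Sum>i\<in>I. Y i \<omega>) \<ge> (\<Sum>i\<in>I. expectation (Y i)) + u}
    \<le> exp (- l * u + l powr p * exp (l * B) * V)"
proof -
  have rv [measurable]: "random_variable borel (Y i)" if "i \<in> I" for i
    using indep that by (auto simp: indep_vars_def)
  have int: "integrable M (Y i)" if "i \<in> I" for i
    using that B by (intro integrable_const_bound[of _ B] AE_I2) auto
  have intp: "integrable M (\<lambda>\<omega>. \<bar>Y i \<omega>\<bar> powr p)" if "i \<in> I" for i
    using that B p by (intro integrable_const_bound[of _ "B powr p"] AE_I2) (auto intro!: powr_mono2)
  have inte: "integrable M (\<lambda>\<omega>. exp (l * Y i \<omega>))" if "i \<in> I" for i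
  proof (intro integrable_const_bound[of _ "exp (l * B)"] AE_I2)
    fix \<omega> assume "\<omega> \<in> space M"
    then have "Y i \<omega> \<le> B" using B[OF that] by force
    then show "norm (exp (l * Y i \<omega>)) \<le> exp (l * B)" using l by simp
  qed (use that in measurable)
  define e where "e = (\<lambda>i. expectation (\<lambda>\<omega>. \<bar>Y i \<omega>\<bar> powr p))"
  define D where "D = l powr p * exp (l * B)"
  have mgf: "expectation (\<lambda>\<omega>. exp (l * Y i \<omega>)) \<le> exp (l * expectation (Y i) + D * e i)" if i: "i \<in> I" for i
  proof -
    have "expectation (\<lambda>\<omega>. exp (l * Y i \<omega>)) \<le> expectation (\<lambda>\<omega>. 1 + l * Y i \<omega> + D * \<bar>Y i \<omega>\<bar> powr p)"
    proof (rule integral_mono[OF inte[OF i]])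
      show "integrable M (\<lambda>\<omega>. 1 + l * Y i \<omega> + D * \<bar>Y i \<omega>\<bar> powr p)"
        using int[OF i] intp[OF i] by auto
      fix \<omega> assume "\<omega> \<in> space M"
      then have "\<bar>l * Y i \<omega>\<bar> \<le> l * B" using B[OF i] l by (simp add: abs_mult)
      from exp_le_add_powr[OF p this] show "exp (l * Y i \<omega>) \<le> 1 + l * Y i \<omega> + D * \<bar>Y i \<omega>\<bar> powr p"
        using l by (simp add: D_def abs_mult powr_mult mult_ac)
    qed
    also have "\<dots> = 1 + (l * expectation (Y i) + D * e i)"
      using int[OF i] intp[OF i] by (simp add: e_def prob_space)
    also have "\<dots> \<le> exp (l * expectation (Y i) + D * e i)" by (rule exp_ge_add_one_self)
    finally show ?thesis .
  qed
  have indep_e: "indep_vars (\<lambda>_. borel) (\<lambda>i \<omega>. exp (l * Y i \<omega>)) I"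
    by (rule indep_vars_compose2[OF indep]) auto
  define m where "m = (\<Sum>i\<in>I. expectation (Y i))"
  define F where "F = (\<lambda>\<omega>. \<Prod>i\<in>I. exp (l * Y i \<omega>))"
  have F_eq: "F \<omega> = exp (l * (\<Sum>i\<in>I. Y i \<omega>))" for \<omega>
    using fin by (simp add: F_def exp_sum sum_distrib_left)
  have F_nonneg: "F \<omega> \<ge> 0" for \<omega> by (simp add: F_eq)
  have F_int: "integrable M F" unfolding F_def by (rule indep_vars_integrable[OF fin indep_e inte])
  have "expectation F = (\<Prod>i\<in>I. expectation (\<lambda>\<omega>. exp (l * Y i \<omega>)))"
    unfolding F_def by (rule indep_vars_lebesgue_integral[OF fin indep_e inte])
  also have "\<dots> \<le> (\<Prod>i\<in>I. exp (l * expectation (Y i) + D * e i))"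
    using mgf by (intro prod_mono) auto
  also have "\<dots> = exp (l * m + D * (\<Sum>i\<in>I. e i))"
    using fin by (simp add: m_def exp_sum[symmetric] sum.distrib sum_distrib_left)
  also have "\<dots> \<le> exp (l * m + D * V)"
    using V by (auto simp: e_def D_def intro!: mult_left_mono)
  finally have EF: "expectation F \<le> exp (l * m + D * V)" .
  have eq: "{\<omega> \<in> space M. (\<Sum>i\<in>I. Y i \<omega>) \<ge> m + u} = {\<omega> \<in> space M. F \<omega> \<ge> exp (l * (m + u))}"
    using l by (auto simp: F_eq)
  have "prob {\<omega> \<in> space M. F \<omega> \<ge> exp (l * (m + u))} \<le> expectation F / exp (l * (m + u))"
    by (rule integral_Markov_inequality_measure[where A = "{}"]) (use F_int F_nonneg in auto)
  also have "\<dots> \<le> exp (l * m + D * V) / exp (l * (m + u))"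
    using EF by (intro divide_right_mono) auto
  also have "\<dots> = exp (- l * u + D * V)" by (simp add: exp_diff[symmetric] algebra_simps)
  finally show ?thesis by (simp add: eq[unfolded m_def] m_def D_def)
qed

text \<open>Adding \<open>A n\<close> to the union loses at most \<open>prob (A n)\<close> times the
  sum so far, and the increments of the squared sum cover this loss. In the application the sum
  tends to 0, so its square is negligible.\<close>

lemma (in prob_space) bonferroni_pairwise:
  fixes A :: "nat \<Rightarrow> 'a set"
  assumes A: "\<And>k. A k \<in> events" and s: "summable (\<lambda>k. prob (A k))"
    and pair: "\<And>k l. k < l \<Longrightarrow> prob (A k \<inter> A l) \<le> prob (A k) * prob (A l)"
  shows "prob (\<Union>k. A k) \<ge> (\<Sum>k. prob (A k)) - (\<Sum>k. prob (A k))\<^sup>2"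
proof -
  have fin: "prob (\<Union>k<n. A k) \<ge> (\<Sum>k<n. prob (A k)) - (\<Sum>k<n. prob (A k))\<^sup>2" for n
  proof (induction n)
    case (Suc n)
    define s where "s = (\<Sum>k<n. prob (A k))"
    have meas: "(\<Union>k<n. A k) \<in> events" using A by auto
    have "prob (A n \<inter> (\<Union>k<n. A k)) = prob (\<Union>k<n. A k \<inter> A n)" by (simp add: Int_commute)
    also have "\<dots> \<le> (\<Sum>k<n. prob (A k \<inter> A n))"
      using A by (intro finite_measure_subadditive_finite) auto
    also have "\<dots> \<le> (\<Sum>k<n. prob (A k) * prob (A n))" by (intro sum_mono pair) auto
    also have "\<dots> = s * prob (A n)" by (simp add: s_def sum_distrib_right)
    finally have int: "prob (A n \<inter> (\<Union>k<n. A k)) \<le> s * prob (A n)" .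
    have "prob (\<Union>k<Suc n. A k) = prob (A n \<union> (\<Union>k<n. A k))" by (simp add: lessThan_Suc)
    also have "\<dots> = prob (A n) + prob (\<Union>k<n. A k) - prob (A n \<inter> (\<Union>k<n. A k))"
      using A meas by (simp add: measure_Un3 fmeasurable_eq_sets)
    finally have "prob (\<Union>k<Suc n. A k) \<ge> prob (A n) + (s - s\<^sup>2) - s * prob (A n)"
      using int Suc by (simp add: s_def)
    moreover have "prob (A n) + (s - s\<^sup>2) - s * prob (A n) \<ge> (s + prob (A n)) - (s + prob (A n))\<^sup>2"
    proof -
      have "0 \<le> s" unfolding s_def by (intro sum_nonneg) auto
      then have "0 \<le> s * prob (A n)" "0 \<le> (prob (A n))\<^sup>2" by auto
      then show ?thesis by (simp add: power2_sum algebra_simps)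
    qed
    ultimately show ?case by (simp add: s_def)
  qed simp
  have lim: "(\<lambda>n. \<Sum>k<n. prob (A k)) \<longlonglongrightarrow> (\<Sum>k. prob (A k))" by (rule summable_LIMSEQ[OF s])
  show ?thesis
  proof (rule tendsto_upperbound)
    show "(\<lambda>n. (\<Sum>k<n. prob (A k)) - (\<Sum>k<n. prob (A k))\<^sup>2) \<longlonglongrightarrow> (\<Sum>k. prob (A k)) - (\<Sum>k. prob (A k))\<^sup>2"
      by (intro tendsto_intros lim)
    show "\<forall>\<^sub>F n in sequentially. (\<Sum>k<n. prob (A k)) - (\<Sum>k<n. prob (A k))\<^sup>2 \<le> prob (\<Union>k. A k)"
    proof (rule always_eventually, rule allI)
      fix n
      have "prob (\<Union>k<n. A k) \<le> prob (\<Union>k. A k)" using A by (intro finite_measure_mono) auto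
      with fin[of n] show "(\<Sum>k<n. prob (A k)) - (\<Sum>k<n. prob (A k))\<^sup>2 \<le> prob (\<Union>k. A k)" by linarith
    qed
  qed simp
qed

section \<open>Paths with a single large jump\<close>

text \<open>Large values are replaced by 0, not clipped to the bound: a single large jump then
  disappears from the truncated sum, and the full sum is exactly the truncated one plus the
  contribution of that jump.\<close>

definition truncate_abs :: "real \<Rightarrow> real \<Rightarrow> real" where
  "truncate_abs b x = (if \<bar>x\<bar> \<le> b then x else 0)"

lemma measurable_truncate_abs [measurable]: "truncate_abs b \<in> borel \<rightarrow>\<^sub>M borel"
  unfolding truncate_abs_def by measurable

lemma truncate_abs_le: "\<bar>truncate_abs b x\<bar> \<le> \<bar>x\<bar>"
  by (simp add: truncate_abs_def)

lemma sum_rev_abs_psum: "(\<Sum>j<n. \<bar>c (n - Suc j)\<bar>) = abs_psum c n"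
  unfolding abs_psum_def by (rule sum.nat_diff_reindex)

lemma sum_rev: "(\<Sum>j<n. c (n - Suc j)) = (\<Sum>i<n. c i)" for c :: "nat \<Rightarrow> real"
  by (rule sum.nat_diff_reindex)

text \<open>Summing over the innovations instead of the lags keeps the position of a jump fixed
  while \<open>n\<close> varies.\<close>

lemma gF_process_eq: "gF_process c X n \<omega> = (\<Sum>j<n. c (n - Suc j) * X (Suc j) \<omega>)"
  unfolding gF_process_def
  by (rule sum.reindex_bij_witness[of _ "\<lambda>j. n - Suc j" "\<lambda>i. n - Suc i"]) (auto simp: Suc_diff_Suc)

text \<open>
  A coefficient in \<open>[l, u]\<close> with \<open>l \<le> 0 < u\<close> can lift a jump above \<open>x > 0\<close> only if the jump is in this
  set. The second inequality is not strict, so that the probability of the set is expressed by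
  values of the distribution function, without left limits.
\<close>

definition jump_set :: "real \<Rightarrow> real \<Rightarrow> real \<Rightarrow> real set" where
  "jump_set u l x = {y. x < u * y \<or> x \<le> l * y}"

lemma jump_set_sets [measurable]: "jump_set u l x \<in> sets borel"
  unfolding jump_set_def by measurable

lemma jump_set_antimono: "x \<le> x' \<Longrightarrow> jump_set u l x' \<subseteq> jump_set u l x"
  by (auto simp: jump_set_def)

lemma sum_single_large:
  fixes d x :: "nat \<Rightarrow> real"
  assumes k: "k < n" and large: "\<And>j. j < n \<Longrightarrow> j \<noteq> k \<Longrightarrow> \<bar>x j\<bar> \<le> b" and "\<bar>x k\<bar> > b"
  shows "(\<Sum>j<n. d j * x j) = (\<Sum>j<n. d j * truncate_abs b (x j)) + d k * x k"
proof -
  have "(\<Sum>j<n. d j * x j) = d k * x k + (\<Sum>j\<in>{..<n} - {k}. d j * x j)"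
    using k by (simp add: sum.remove)
  also have "(\<Sum>j\<in>{..<n} - {k}. d j * x j) = (\<Sum>j\<in>{..<n} - {k}. d j * truncate_abs b (x j))"
    using large by (intro sum.cong) (auto simp: truncate_abs_def)
  also have "\<dots> = (\<Sum>j<n. d j * truncate_abs b (x j))"
    using k assms(3) by (simp add: sum.remove[of "{..<n}" k] truncate_abs_def)
  finally show ?thesis by simp
qed

text \<open>The deterministic part. Here \<open>- m\<close> is the mean of an innovation,
  \<open>D\<close> the price of treating all coefficients as nonnegative, and \<open>iu\<close>,
  \<open>il\<close> the lags at which the extreme coefficients occur. The lower extreme has to be
  attained only when negative, since its default value 0 need not be a coefficient.\<close>

locale single_jump =
  fixes c :: "nat \<Rightarrow> real" and G D m cu cl :: real and iu il :: nat
  assumes G: "\<And>i. \<bar>c i\<bar> \<le> G" and G_pos: "G > 0" and m: "m > 0"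
    and D: "\<And>n. abs_psum c n \<le> (\<Sum>i<n. c i) + D"
    and cu: "\<And>i. c i \<le> cu" "c iu = cu" "cu > 0"
    and cl: "\<And>i. cl \<le> c i" "cl < 0 \<Longrightarrow> c il = cl" "cl \<le> 0"
begin

text \<open>Truncation levels and errors scale with \<open>t + abs_psum c n\<close>, jump thresholds
  with \<open>t + m * abs_psum c n\<close>; \<open>q\<close> converts the former into the
  latter.\<close>

definition "q = max 1 (1 / m)"

lemma q: "q \<ge> 1" and q_bound: "t \<ge> 0 \<Longrightarrow> t + abs_psum c n \<le> q * (t + m * abs_psum c n)"
proof -
  show "q \<ge> 1" by (simp add: q_def)
  assume t: "t \<ge> 0"
  have "1 * t \<le> q * t" using t by (intro mult_right_mono) (auto simp: q_def)
  moreover have "(1 / m) * (m * abs_psum c n) \<le> q * (m * abs_psum c n)"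
    using m abs_psum_nonneg[of c n] by (intro mult_right_mono) (auto simp: q_def)
  ultimately show "t + abs_psum c n \<le> q * (t + m * abs_psum c n)" using m by (simp add: algebra_simps)
qed

text \<open>The plus sign measures the distance to \<open>- m\<close> times the sum of the
  coefficients, the mean of the untruncated sum. The truncation level depends on \<open>n\<close>
  and grows with it.\<close>

definition sums_close :: "real \<Rightarrow> real \<Rightarrow> real \<Rightarrow> (nat \<Rightarrow> real) \<Rightarrow> nat \<Rightarrow> bool" where
  "sums_close \<epsilon> \<delta> t x n \<longleftrightarrow>
    \<bar>(\<Sum>j<n. c (n - Suc j) * truncate_abs (\<delta> * (t + abs_psum c n)) (x j)) + m * (\<Sum>i<n. c i)\<bar>
      < \<epsilon> * (t + abs_psum c n)"

text \<open>The thresholds belong to the jumps and not to a time \<open>n\<close>, so one countable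
  family of pairs serves all \<open>n\<close>. They are the lowest thresholds relevant to these
  jumps, since \<open>abs_psum c (Suc j) \<le> abs_psum c n\<close> whenever
  \<open>j < n\<close>.\<close>

definition both_large :: "real \<Rightarrow> real \<Rightarrow> (nat \<Rightarrow> real) \<Rightarrow> nat \<Rightarrow> nat \<Rightarrow> bool" where
  "both_large \<delta> t x j k \<longleftrightarrow>
    \<bar>x j\<bar> > \<delta> * (t + abs_psum c (Suc j)) \<and> \<bar>x k\<bar> > \<delta> * (t + abs_psum c (Suc k))"

definition good_path :: "real \<Rightarrow> real \<Rightarrow> real \<Rightarrow> (nat \<Rightarrow> real) \<Rightarrow> bool" where
  "good_path \<epsilon> \<delta> t x \<longleftrightarrow> (\<forall>n. sums_close \<epsilon> \<delta> t x n) \<and> (\<forall>j k. j < k \<longrightarrow> \<not> both_large \<delta> t x j k)"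

lemma good_path_unique:
  assumes "good_path \<epsilon> \<delta> t x" and \<delta>: "\<delta> \<ge> 0" and jk: "j < n" "k < n" "j \<noteq> k"
    and large: "\<bar>x k\<bar> > \<delta> * (t + abs_psum c n)"
  shows "\<bar>x j\<bar> \<le> \<delta> * (t + abs_psum c n)"
proof (rule ccontr)
  assume "\<not> ?thesis"
  moreover have "\<delta> * (t + abs_psum c (Suc i)) \<le> \<delta> * (t + abs_psum c n)" if "i < n" for i
    using \<delta> that by (intro mult_left_mono add_left_mono abs_psum_mono) auto
  from this[OF jk(1)] this[OF jk(2)] have "\<not> \<bar>x j\<bar> > \<delta> * (t + abs_psum c n)"
    using assms(1) jk large unfolding good_path_def both_large_def
    by (smt (verit) linorder_neq_iff)
  ultimately show False by simp
qed

text \<open>The truncated sum lies near the negative drift, so exceeding \<open>t\<close> takes an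
  untruncated jump; on a good path there is only one, and it alone must bridge level plus drift. The
  drift at time \<open>n\<close> is at least that at the jump, so \<open>n\<close> disappears from
  the conclusion.\<close>

lemma good_path_upper:
  assumes good: "good_path \<epsilon> \<delta> t x" and \<epsilon>: "\<epsilon> > 0" "3 * \<epsilon> * q < 1" and \<delta>: "\<delta> \<ge> 0"
    and t: "t > 0" "m * D \<le> \<epsilon> * t"
    and S: "(\<Sum>j<n. c (n - Suc j) * x j) > t"
  shows "\<exists>k. x k \<in> jump_set cu cl ((1 - 3 * \<epsilon> * q) * (t + m * abs_psum c (Suc k)))"
proof -
  define A where "A = abs_psum c n"
  define y where "y = t + A"
  define T where "T = (\<Sum>j<n. c (n - Suc j) * truncate_abs (\<delta> * y) (x j))"
  define r where "r = 1 - 3 * \<epsilon> * q"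
  have A: "A \<ge> 0" by (simp add: A_def abs_psum_nonneg)
  have r: "r > 0" using \<epsilon> by (simp add: r_def)
  have tm: "t + m * A > 0" using t A m by (simp add: add_pos_nonneg)
  have "sums_close \<epsilon> \<delta> t x n" using good by (simp add: good_path_def)
  then have "\<bar>T + m * (\<Sum>i<n. c i)\<bar> < \<epsilon> * y" by (simp add: sums_close_def T_def y_def A_def)
  then have "T < - m * (\<Sum>i<n. c i) + \<epsilon> * y" by linarith
  also have "- m * (\<Sum>i<n. c i) \<le> - m * A + m * D"
    using mult_left_mono[OF D[of n], of m] m by (simp add: A_def algebra_simps)
  finally have T: "T < - m * A + m * D + \<epsilon> * y" by simp
  have "\<epsilon> * y \<le> \<epsilon> * (q * (t + m * A))"
    using q_bound[of t n] t \<epsilon> by (intro mult_left_mono) (auto simp: y_def A_def)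
  moreover have "\<epsilon> * t \<le> \<epsilon> * y" using A \<epsilon> by (simp add: y_def)
  \<comment> \<open>The relative error 3 * \<epsilon> * q is shared with the lower bound, where the
    deviation costs twice \<epsilon> * q and the delay after the jump once more.\<close>
  ultimately have "m * D + \<epsilon> * y \<le> 3 * (\<epsilon> * (q * (t + m * A)))" using t \<epsilon>(1) tm q
    by (smt (verit) mult_nonneg_nonneg)
  then have gap: "t - T > r * (t + m * A)" using T by (simp add: r_def algebra_simps)
  have "\<exists>k<n. \<bar>x k\<bar> > \<delta> * y"
  proof (rule ccontr)
    assume "\<not> ?thesis"
    then have "\<bar>x j\<bar> \<le> \<delta> * y" if "j < n" for j using that by (meson not_less)
    then have "T = (\<Sum>j<n. c (n - Suc j) * x j)"
      unfolding T_def by (intro sum.cong) (auto simp: truncate_abs_def)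
    then have "r * (t + m * A) < 0" using S gap by simp
    then show False using r tm by (simp add: mult_less_0_iff)
  qed
  then obtain k where k: "k < n" "\<bar>x k\<bar> > \<delta> * y" by auto
  have "(\<Sum>j<n. c (n - Suc j) * x j) = T + c (n - Suc k) * x k"
    unfolding T_def using good_path_unique[OF good \<delta> _ k(1)] k
    by (intro sum_single_large) (auto simp: y_def A_def)
  then have big: "c (n - Suc k) * x k > r * (t + m * A)" using S gap by simp
  moreover have "r * (t + m * abs_psum c (Suc k)) \<le> r * (t + m * A)"
    unfolding A_def using r m k(1) by (intro mult_left_mono add_left_mono abs_psum_mono) auto
  ultimately have big: "c (n - Suc k) * x k > r * (t + m * abs_psum c (Suc k))" by linarith
  \<comment> \<open>The coefficient acting at time \<open>n\<close> is unknown; the sign of the jump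
    decides which extreme coefficient bounds it.\<close>
  have "cu * x k > r * (t + m * abs_psum c (Suc k)) \<or> cl * x k > r * (t + m * abs_psum c (Suc k))"
  proof (cases "x k \<ge> 0")
    case True
    then show ?thesis using big mult_right_mono[OF cu(1) True, of "n - Suc k"] by linarith
  next
    case False
    then have "c (n - Suc k) * x k \<le> cl * x k"
      using cl(1) by (intro mult_right_mono_neg) auto
    then show ?thesis using big by linarith
  qed
  then show ?thesis unfolding r_def jump_set_def by (intro exI[of _ k]) auto
qed

text \<open>After the jump one waits until the lag reaches \<open>iu\<close> or \<open>il\<close>,
  so that the extreme coefficient multiplies it. Meanwhile the partial sum grows by at most
  \<open>max iu il * G\<close>, a constant small against \<open>t\<close>. The condition on \<delta>
  places the jump above the truncation level, so the other innovations are all truncated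
  harmlessly.\<close>

lemma good_path_lower:
  assumes good: "good_path \<epsilon> \<delta> t x" and \<epsilon>: "\<epsilon> > 0" and \<delta>: "\<delta> \<ge> 0" "2 * \<delta> * q * G < 1"
    and t: "t > 0" "m * (real (max iu il) * G) \<le> \<epsilon> * t" "real (max iu il) * G \<le> t"
    and k: "x k \<in> jump_set cu cl ((1 + 3 * \<epsilon> * q) * (t + m * abs_psum c (Suc k)))"
  shows "\<exists>n. (\<Sum>j<n. c (n - Suc j) * x j) > t"
proof -
  define A where "A = abs_psum c (Suc k)"
  define E where "E = real (max iu il) * G"
  define r where "r = 1 + 3 * \<epsilon> * q"
  have A: "A \<ge> 0" by (simp add: A_def abs_psum_nonneg)
  have r: "r > 1" using \<epsilon> q by (simp add: r_def)
  have tm: "t + m * A > 0" using t A m by (simp add: add_pos_nonneg)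
  then have rtm: "r * (t + m * A) > t + m * A" using r by simp
  have "\<exists>i. i \<le> max iu il \<and> c i * x k \<ge> r * (t + m * A)"
  proof (cases "cu * x k > r * (t + m * A)")
    case True
    then show ?thesis using cu(2) by (intro exI[of _ iu]) auto
  next
    case False
    then have *: "cl * x k \<ge> r * (t + m * A)" using k by (auto simp: jump_set_def A_def r_def)
    \<comment> \<open>A positive product excludes the default value \<open>cl = 0\<close>, so the
      infimum is an actual coefficient.\<close>
    then have "cl * x k > 0" using rtm tm by linarith
    then have "cl \<noteq> 0" by auto
    then have "c il = cl" using cl by auto
    then show ?thesis using * by (intro exI[of _ il]) auto
  qed
  then obtain i where i: "i \<le> max iu il" "c i * x k \<ge> r * (t + m * A)" by auto
  \<comment> \<open>At this time the lag \<open>n - Suc k\<close> of the jump is exactly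
    \<open>i\<close>.\<close>
  define n where "n = Suc k + i"
  define An where "An = abs_psum c n"
  define y where "y = t + An"
  define T where "T = (\<Sum>j<n. c (n - Suc j) * truncate_abs (\<delta> * y) (x j))"
  have "real i * G \<le> E" unfolding E_def using i G_pos by (intro mult_right_mono) auto
  then have An: "An \<le> A + E" using abs_psum_add_le[of c G "Suc k" i, OF G] by (simp add: An_def n_def A_def)
  have y: "y \<le> 2 * (t + A)" using An t A by (simp add: y_def E_def)
  have qb: "t + A \<le> q * (t + m * A)" using q_bound[of t "Suc k"] t by (simp add: A_def)
  have "\<delta> * y \<le> \<delta> * (2 * (q * (t + m * A)))" using y qb \<delta> by (intro mult_left_mono) auto
  also have "\<dots> < (t + m * A) / G"
    using mult_strict_right_mono[OF \<delta>(2) tm] G_pos by (simp add: pos_less_divide_eq mult_ac)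
  also have "\<dots> \<le> \<bar>x k\<bar>"
  proof -
    have "t + m * A \<le> \<bar>c i * x k\<bar>" using i(2) rtm by linarith
    also have "\<dots> \<le> G * \<bar>x k\<bar>" unfolding abs_mult by (intro mult_right_mono G) auto
    finally show ?thesis using G_pos by (simp add: field_simps)
  qed
  finally have large: "\<bar>x k\<bar> > \<delta> * y" .
  have kn: "k < n" by (simp add: n_def)
  have "(\<Sum>j<n. c (n - Suc j) * x j) = T + c (n - Suc k) * x k"
    unfolding T_def using good_path_unique[OF good \<delta>(1) _ kn] kn large
    by (intro sum_single_large) (auto simp: y_def An_def)
  then have S: "(\<Sum>j<n. c (n - Suc j) * x j) \<ge> T + r * (t + m * A)" using i(2) by (simp add: n_def)
  have "sums_close \<epsilon> \<delta> t x n" using good by (simp add: good_path_def)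
  then have "\<bar>T + m * (\<Sum>i<n. c i)\<bar> < \<epsilon> * y" by (simp add: sums_close_def T_def y_def An_def)
  then have "T > - m * (\<Sum>i<n. c i) - \<epsilon> * y" by linarith
  moreover have "(\<Sum>i<n. c i) \<le> An" unfolding An_def abs_psum_def by (intro sum_mono) auto
  then have "m * (\<Sum>i<n. c i) \<le> m * (A + E)" using An m by (intro mult_left_mono) auto
  moreover have "\<epsilon> * y \<le> \<epsilon> * (2 * (q * (t + m * A)))" using y qb \<epsilon> by (intro mult_left_mono) auto
  moreover have "m * E \<le> \<epsilon> * (q * (t + m * A))"
  proof -
    have "m * E \<le> \<epsilon> * t" using t by (simp add: E_def)
    also have "\<dots> \<le> \<epsilon> * (q * (t + m * A))" using qb A \<epsilon> by (intro mult_left_mono) auto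
    finally show ?thesis .
  qed
  ultimately have "T + r * (t + m * A) > t" by (simp add: r_def algebra_simps)
  then show ?thesis using S by (intro exI[of _ n]) linarith
qed

end

section \<open>Probability of exceeding a level\<close>

text \<open>The innovations are renumbered from 0. The moment order \<open>p\<close> lies strictly
  above 1, which yields a power gain in the Chernoff bound, and at most 2, which the exponential
  inequality requires.\<close>

locale single_jump_process = single_jump c G D m cu cl iu il + prob_space M
  for c :: "nat \<Rightarrow> real" and G D m cu cl :: real and iu il :: nat and M :: "'a measure" +
  fixes Z :: "nat \<Rightarrow> 'a \<Rightarrow> real" and p :: real
  assumes indep: "indep_vars (\<lambda>_. borel) Z UNIV"
    and ident: "\<And>j. distr M borel (Z j) = distr M borel (Z 0)"
    and integrable_Z: "integrable M (Z 0)" and mean_Z: "expectation (Z 0) = - m"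
    and p: "1 < p" "p \<le> 2" and moment: "integrable M (\<lambda>\<omega>. \<bar>Z 0 \<omega>\<bar> powr p)"
begin

section \<open>Concentration of the truncated sums around the drift\<close>

lemma Z_measurable [measurable]: "random_variable borel (Z j)"
  using indep by (auto simp: indep_vars_def)

lemma expectation_Z:
  fixes f :: "real \<Rightarrow> real"
  assumes [measurable]: "f \<in> borel \<rightarrow>\<^sub>M borel"
  shows "expectation (\<lambda>\<omega>. f (Z j \<omega>)) = expectation (\<lambda>\<omega>. f (Z 0 \<omega>))"
proof -
  have "expectation (\<lambda>\<omega>. f (Z j \<omega>)) = integral\<^sup>L (distr M borel (Z j)) f" for j
    by (simp add: integral_distr)
  then show ?thesis using ident by metis
qed

lemma prob_Z:
  assumes [measurable]: "S \<in> sets borel"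
  shows "prob {\<omega> \<in> space M. Z j \<omega> \<in> S} = prob {\<omega> \<in> space M. Z 0 \<omega> \<in> S}"
proof -
  have "prob {\<omega> \<in> space M. Z j \<omega> \<in> S} = measure (distr M borel (Z j)) S" for j
    by (simp add: measure_distr vimage_def Int_def conj_commute)
  then show ?thesis using ident by metis
qed

lemma prob_Z_pair:
  assumes jk: "j \<noteq> k" and [measurable]: "S \<in> sets borel" "S' \<in> sets borel"
  shows "prob {\<omega> \<in> space M. Z j \<omega> \<in> S \<and> Z k \<omega> \<in> S'} =
    prob {\<omega> \<in> space M. Z 0 \<omega> \<in> S} * prob {\<omega> \<in> space M. Z 0 \<omega> \<in> S'}"
proof -
  define A where "A = (\<lambda>i. if i = j then S else S')"
  have "prob (\<Inter>i\<in>{j, k}. Z i -` A i \<inter> space M) = (\<Prod>i\<in>{j, k}. prob (Z i -` A i \<inter> space M))"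
    by (rule indep_varsD[OF indep]) (auto simp: A_def)
  moreover have "(\<Inter>i\<in>{j, k}. Z i -` A i \<inter> space M) = {\<omega> \<in> space M. Z j \<omega> \<in> S \<and> Z k \<omega> \<in> S'}"
    using jk by (auto simp: A_def)
  moreover have "Z i -` T \<inter> space M = {\<omega> \<in> space M. Z i \<omega> \<in> T}" for i T by auto
  ultimately show ?thesis using jk prob_Z[of S j] prob_Z[of S' k] by (simp add: A_def)
qed

text \<open>Stated for any \<open>d\<close> with the same absolute values as \<open>c\<close>, so
  that \<open>c\<close> and its negative give the two tails. Any decay exponent \<open>K\<close> is
  reached by truncating lower: a smaller \<delta> permits a larger exponential parameter. The factor
  \<open>exp 1\<close> bounds the moment term, which is eventually below 1.\<close>

lemma truncated_sum_upper_tail: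
  assumes d: "\<And>i. \<bar>d i\<bar> = \<bar>c i\<bar>" and \<epsilon>: "\<epsilon> > 0" and K: "K > 0"
  shows "\<exists>\<delta>0>0. \<forall>\<delta>. 0 < \<delta> \<and> \<delta> \<le> \<delta>0 \<longrightarrow> (\<exists>y0. \<forall>n y. y \<ge> y0 \<and> y \<ge> abs_psum c n \<longrightarrow>
    prob {\<omega> \<in> space M. (\<Sum>j<n. d (n - Suc j) * truncate_abs (\<delta> * y) (Z j \<omega>)) \<ge>
      (\<Sum>j<n. d (n - Suc j)) * expectation (\<lambda>\<omega>. truncate_abs (\<delta> * y) (Z 0 \<omega>)) + \<epsilon> * y}
      \<le> exp 1 * y powr (- K))"
proof -
  define h where "h = (p - 1) / 2"
  have h: "h > 0" using p by (simp add: h_def)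
  define \<mu>p where "\<mu>p = expectation (\<lambda>\<omega>. \<bar>Z 0 \<omega>\<bar> powr p)"
  have \<mu>p: "\<mu>p \<ge> 0" by (simp add: \<mu>p_def)
  \<comment> \<open>Chosen such that \<open>R = h / (G * \<delta>)\<close> satisfies
    \<open>R * \<epsilon> \<ge> K\<close> for every admissible \<delta>.\<close>
  define \<delta>0 where "\<delta>0 = h * \<epsilon> / (G * K)"
  have "\<exists>y0. \<forall>n y. y \<ge> y0 \<and> y \<ge> abs_psum c n \<longrightarrow>
    prob {\<omega> \<in> space M. (\<Sum>j<n. d (n - Suc j) * truncate_abs (\<delta> * y) (Z j \<omega>)) \<ge>
      (\<Sum>j<n. d (n - Suc j)) * expectation (\<lambda>\<omega>. truncate_abs (\<delta> * y) (Z 0 \<omega>)) + \<epsilon> * y}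
      \<le> exp 1 * y powr (- K)" if \<delta>: "0 < \<delta>" "\<delta> \<le> \<delta>0" for \<delta>
  proof -
    define R where "R = h / (G * \<delta>)"
    have R: "R > 0" using h G_pos \<delta> by (simp add: R_def)
    have RK: "R * \<epsilon> \<ge> K" using \<delta> h G_pos K by (simp add: R_def \<delta>0_def field_simps)
    define B where "B = R powr p * G powr (p - 1) * \<mu>p"
    have "((\<lambda>y. ln y powr p * y powr (- h)) \<longlongrightarrow> 0) at_top"
      using h by real_asymp
    then have "((\<lambda>y. B * (ln y powr p * y powr (- h))) \<longlongrightarrow> B * 0) at_top"
      by (intro tendsto_mult tendsto_const)
    then have "\<forall>\<^sub>F y in at_top. B * (ln y powr p * y powr (- h)) < 1"
      by (rule order_tendstoD) simp
    then have "\<forall>\<^sub>F y in at_top. B * (ln y powr p * y powr (- h)) < 1 \<and> y > 1"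
      using eventually_gt_at_top[of 1] by eventually_elim auto
    then obtain y0 where y0: "\<And>y. y \<ge> y0 \<Longrightarrow> B * (ln y powr p * y powr (- h)) < 1 \<and> y > 1"
      by (auto simp: eventually_at_top_linorder)
    show ?thesis
    proof (intro exI[of _ y0] allI impI)
      fix n y assume yn: "y \<ge> y0 \<and> y \<ge> abs_psum c n"
      have y: "y > 1" "B * (ln y powr p * y powr (- h)) < 1" using y0 yn by auto
      define b where "b = \<delta> * y"
      have b: "b > 0" using \<delta> y by (simp add: b_def)
      define Y where "Y = (\<lambda>j \<omega>. d (n - Suc j) * truncate_abs b (Z j \<omega>))"
      have d_le: "\<bar>d i\<bar> \<le> G" for i using d G by simp
      have indY: "indep_vars (\<lambda>_. borel) Y {..<n}"
        unfolding Y_def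
        by (rule indep_vars_compose2[where Y = "\<lambda>j x. d (n - Suc j) * truncate_abs b x",
              OF indep_vars_subset[OF indep subset_UNIV]]) measurable
      have bound: "\<bar>Y j \<omega>\<bar> \<le> G * b" for j \<omega>
        unfolding Y_def abs_mult using d_le b G_pos by (intro mult_mono) (auto simp: truncate_abs_def)
      have EY: "expectation (Y j) = d (n - Suc j) * expectation (\<lambda>\<omega>. truncate_abs b (Z 0 \<omega>))" for j
        unfolding Y_def using expectation_Z[of "truncate_abs b" j] by simp
      have sum_EY: "(\<Sum>j<n. expectation (Y j)) = (\<Sum>j<n. d (n - Suc j)) * expectation (\<lambda>\<omega>. truncate_abs b (Z 0 \<omega>))"
        by (simp add: EY sum_distrib_right)
      have EYp: "expectation (\<lambda>\<omega>. \<bar>Y j \<omega>\<bar> powr p) \<le> G powr (p - 1) * \<bar>d (n - Suc j)\<bar> * \<mu>p" for j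
      proof -
        define e where "e = \<bar>d (n - Suc j)\<bar>"
        have e: "0 \<le> e" "e \<le> G" using d_le by (auto simp: e_def)
        have "e powr p = e powr (p - 1) * e" using e by (cases "e = 0") (simp_all add: powr_diff)
        also have "\<dots> \<le> G powr (p - 1) * e" using e p by (intro mult_right_mono powr_mono2) auto
        \<comment> \<open>Trading \<open>p - 1\<close> powers for the bound \<open>G\<close> leaves
          a term linear in the coefficient, so the moments add up to a multiple of
          \<open>abs_psum c n\<close>.\<close>
        finally have ep: "e powr p \<le> G powr (p - 1) * e" .
        have eqn: "\<bar>Y j \<omega>\<bar> powr p = e powr p * \<bar>truncate_abs b (Z j \<omega>)\<bar> powr p" for \<omega>
          by (simp add: Y_def e_def abs_mult powr_mult)
        have "expectation (\<lambda>\<omega>. \<bar>Y j \<omega>\<bar> powr p)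
            = e powr p * expectation (\<lambda>\<omega>. \<bar>truncate_abs b (Z 0 \<omega>)\<bar> powr p)"
          unfolding eqn using expectation_Z[of "\<lambda>x. \<bar>truncate_abs b x\<bar> powr p" j] by simp
        also have "\<dots> \<le> e powr p * \<mu>p"
        proof (intro mult_left_mono)
          show "expectation (\<lambda>\<omega>. \<bar>truncate_abs b (Z 0 \<omega>)\<bar> powr p) \<le> \<mu>p"
            unfolding \<mu>p_def
          proof (rule integral_mono[OF _ moment])
            show "integrable M (\<lambda>\<omega>. \<bar>truncate_abs b (Z 0 \<omega>)\<bar> powr p)"
              using p truncate_abs_le
              by (intro Bochner_Integration.integrable_bound[OF moment]) (auto intro!: powr_mono2)
          qed (use p truncate_abs_le in \<open>auto intro!: powr_mono2\<close>)
        qed simp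
        also have "\<dots> \<le> (G powr (p - 1) * e) * \<mu>p" using ep \<mu>p by (rule mult_right_mono)
        finally show ?thesis by (simp add: e_def)
      qed
      have V: "(\<Sum>j<n. expectation (\<lambda>\<omega>. \<bar>Y j \<omega>\<bar> powr p)) \<le> G powr (p - 1) * \<mu>p * y"
      proof -
        have "(\<Sum>j<n. expectation (\<lambda>\<omega>. \<bar>Y j \<omega>\<bar> powr p)) \<le> (\<Sum>j<n. G powr (p - 1) * \<bar>d (n - Suc j)\<bar> * \<mu>p)"
          by (intro sum_mono EYp)
        also have "\<dots> = G powr (p - 1) * \<mu>p * (\<Sum>j<n. \<bar>d (n - Suc j)\<bar>)"
          by (simp add: sum_distrib_left mult_ac)
        also have "(\<Sum>j<n. \<bar>d (n - Suc j)\<bar>) = abs_psum c n" by (simp add: d sum_rev_abs_psum)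
        also have "G powr (p - 1) * \<mu>p * abs_psum c n \<le> G powr (p - 1) * \<mu>p * y"
          using yn \<mu>p by (intro mult_left_mono) auto
        finally show ?thesis .
      qed
      \<comment> \<open>With this \<open>l\<close> the factor \<open>exp (l * (G * b))\<close> is \<open>y powr h\<close>, which the moment bound
        \<open>y powr (1 - p) = y powr - (2 * h)\<close> absorbs.\<close>
      define l where "l = R * ln y / y"
      have l: "l > 0" using R y by (simp add: l_def)
      have "prob {\<omega> \<in> space M. (\<Sum>j<n. Y j \<omega>) \<ge> (\<Sum>j<n. expectation (Y j)) + \<epsilon> * y}
          \<le> exp (- l * (\<epsilon> * y) + l powr p * exp (l * (G * b)) * (G powr (p - 1) * \<mu>p * y))"
        by (rule chernoff_bounded_sum[OF _ indY bound _ _ l V]) (use p in auto)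
      also have "\<dots> \<le> exp (1 - K * ln y)"
      proof -
        have "K * ln y \<le> (R * \<epsilon>) * ln y" using RK y by (intro mult_right_mono) auto
        also have "\<dots> = l * (\<epsilon> * y)" using y by (simp add: l_def)
        finally have 1: "K * ln y \<le> l * (\<epsilon> * y)" .
        have "l * (G * b) = h * ln y" using y G_pos \<delta> by (simp add: l_def R_def b_def)
        then have e: "exp (l * (G * b)) = y powr h" using y by (simp add: powr_def)
        have "l powr p = R powr p * ln y powr p * y powr (- p)"
          using R y by (simp add: l_def powr_mult powr_divide powr_minus field_simps)
        then have "l powr p * exp (l * (G * b)) * (G powr (p - 1) * \<mu>p * y)
            = B * (ln y powr p * (y powr (- p) * y powr h * y powr 1))"
          using y by (simp add: e B_def)
        also have "y powr (- p) * y powr h * y powr 1 = y powr (- p + h + 1)" by (simp only: powr_add)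
        also have "- p + h + 1 = - h" by (simp add: h_def field_simps)
        finally show ?thesis using 1 y(2) by simp
      qed
      also have "\<dots> = exp 1 * y powr (- K)" using y by (simp add: powr_def exp_diff exp_minus field_simps)
      finally show "prob {\<omega> \<in> space M. (\<Sum>j<n. d (n - Suc j) * truncate_abs (\<delta> * y) (Z j \<omega>)) \<ge>
        (\<Sum>j<n. d (n - Suc j)) * expectation (\<lambda>\<omega>. truncate_abs (\<delta> * y) (Z 0 \<omega>)) + \<epsilon> * y}
        \<le> exp 1 * y powr (- K)"
        unfolding sum_EY unfolding Y_def b_def .
    qed
  qed
  moreover have "\<delta>0 > 0" using h \<epsilon> G_pos K by (simp add: \<delta>0_def)
  ultimately show ?thesis by blast
qed

lemma truncated_mean_tendsto:
  "((\<lambda>b. expectation (\<lambda>\<omega>. truncate_abs b (Z 0 \<omega>))) \<longlongrightarrow> - m) at_top"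
proof -
  have "((\<lambda>b. expectation (\<lambda>\<omega>. truncate_abs b (Z 0 \<omega>))) \<longlongrightarrow> expectation (Z 0)) at_top"
  proof (rule integral_dominated_convergence_at_top)
    show "integrable M (\<lambda>\<omega>. \<bar>Z 0 \<omega>\<bar>)" using integrable_Z by simp
    show "AE \<omega> in M. ((\<lambda>b. truncate_abs b (Z 0 \<omega>)) \<longlongrightarrow> Z 0 \<omega>) at_top"
    proof (rule AE_I2)
      fix \<omega>
      have "\<forall>\<^sub>F b in at_top. truncate_abs b (Z 0 \<omega>) = Z 0 \<omega>"
        using eventually_ge_at_top[of "\<bar>Z 0 \<omega>\<bar>"] by eventually_elim (simp add: truncate_abs_def)
      then show "((\<lambda>b. truncate_abs b (Z 0 \<omega>)) \<longlongrightarrow> Z 0 \<omega>) at_top" by (rule tendsto_eventually)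
    qed
    show "\<forall>\<^sub>F b in at_top. AE \<omega> in M. norm (truncate_abs b (Z 0 \<omega>)) \<le> \<bar>Z 0 \<omega>\<bar>"
      using truncate_abs_le by simp
  qed measurable
  then show ?thesis by (simp add: mean_Z)
qed

text \<open>Half of \<epsilon> pays for the fluctuation in either direction, the other half for
  replacing the truncated mean by \<open>- m\<close>: the latter error is multiplied by a sum of
  coefficients that is at most \<open>abs_psum c n\<close> in absolute value.\<close>

lemma sums_close_prob:
  assumes \<epsilon>: "\<epsilon> > 0" and K: "K > 0"
  shows "\<exists>\<delta>0>0. \<forall>\<delta>. 0 < \<delta> \<and> \<delta> \<le> \<delta>0 \<longrightarrow> (\<exists>t0. \<forall>n t. t \<ge> t0 \<longrightarrow>
    prob {\<omega> \<in> space M. \<not> sums_close \<epsilon> \<delta> t (\<lambda>j. Z j \<omega>) n} \<le> 2 * exp 1 * (t + abs_psum c n) powr (- K))"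
proof -
  note upper = truncated_sum_upper_tail[OF _ half_gt_zero[OF \<epsilon>] K]
  obtain \<delta>1 where \<delta>1: "\<delta>1 > 0" "\<And>\<delta>. 0 < \<delta> \<and> \<delta> \<le> \<delta>1 \<Longrightarrow> \<exists>y0. \<forall>n y. y \<ge> y0 \<and> y \<ge> abs_psum c n \<longrightarrow>
    prob {\<omega> \<in> space M. (\<Sum>j<n. c (n - Suc j) * truncate_abs (\<delta> * y) (Z j \<omega>)) \<ge>
      (\<Sum>j<n. c (n - Suc j)) * expectation (\<lambda>\<omega>. truncate_abs (\<delta> * y) (Z 0 \<omega>)) + \<epsilon> / 2 * y}
      \<le> exp 1 * y powr (- K)"
    using upper[of c] by auto
  obtain \<delta>2 where \<delta>2: "\<delta>2 > 0" "\<And>\<delta>. 0 < \<delta> \<and> \<delta> \<le> \<delta>2 \<Longrightarrow> \<exists>y0. \<forall>n y. y \<ge> y0 \<and> y \<ge> abs_psum c n \<longrightarrow>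
    prob {\<omega> \<in> space M. (\<Sum>j<n. - c (n - Suc j) * truncate_abs (\<delta> * y) (Z j \<omega>)) \<ge>
      (\<Sum>j<n. - c (n - Suc j)) * expectation (\<lambda>\<omega>. truncate_abs (\<delta> * y) (Z 0 \<omega>)) + \<epsilon> / 2 * y}
      \<le> exp 1 * y powr (- K)"
    using upper[of "\<lambda>i. - c i"] by auto
  have "\<exists>t0. \<forall>n t. t \<ge> t0 \<longrightarrow>
    prob {\<omega> \<in> space M. \<not> sums_close \<epsilon> \<delta> t (\<lambda>j. Z j \<omega>) n} \<le> 2 * exp 1 * (t + abs_psum c n) powr (- K)"
    if \<delta>: "0 < \<delta> \<and> \<delta> \<le> min \<delta>1 \<delta>2" for \<delta>
  proof -
    obtain y1 where y1: "\<And>n y. y \<ge> y1 \<Longrightarrow> y \<ge> abs_psum c n \<Longrightarrow>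
      prob {\<omega> \<in> space M. (\<Sum>j<n. c (n - Suc j) * truncate_abs (\<delta> * y) (Z j \<omega>)) \<ge>
        (\<Sum>j<n. c (n - Suc j)) * expectation (\<lambda>\<omega>. truncate_abs (\<delta> * y) (Z 0 \<omega>)) + \<epsilon> / 2 * y}
        \<le> exp 1 * y powr (- K)"
      using \<delta>1(2)[of \<delta>] \<delta> by auto
    obtain y2 where y2: "\<And>n y. y \<ge> y2 \<Longrightarrow> y \<ge> abs_psum c n \<Longrightarrow>
      prob {\<omega> \<in> space M. (\<Sum>j<n. - c (n - Suc j) * truncate_abs (\<delta> * y) (Z j \<omega>)) \<ge>
        (\<Sum>j<n. - c (n - Suc j)) * expectation (\<lambda>\<omega>. truncate_abs (\<delta> * y) (Z 0 \<omega>)) + \<epsilon> / 2 * y}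
        \<le> exp 1 * y powr (- K)"
      using \<delta>2(2)[of \<delta>] \<delta> by auto
    have "filterlim (\<lambda>y. \<delta> * y) at_top at_top"
      using \<delta> by (intro filterlim_tendsto_pos_mult_at_top[OF tendsto_const _ filterlim_ident]) auto
    from filterlim_compose[OF truncated_mean_tendsto this]
    have "\<forall>\<^sub>F y in at_top. dist (expectation (\<lambda>\<omega>. truncate_abs (\<delta> * y) (Z 0 \<omega>))) (- m) < \<epsilon> / 2"
      using \<epsilon> by (intro tendstoD) auto
    then obtain y3 where y3: "\<And>y. y \<ge> y3 \<Longrightarrow> \<bar>expectation (\<lambda>\<omega>. truncate_abs (\<delta> * y) (Z 0 \<omega>)) + m\<bar> < \<epsilon> / 2"
      by (auto simp: eventually_at_top_linorder dist_real_def)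
    show ?thesis
    proof (intro exI[of _ "max (max y1 y2) (max y3 1)"] allI impI)
      fix n t assume t: "t \<ge> max (max y1 y2) (max y3 1)"
      define y where "y = t + abs_psum c n"
      have y: "y \<ge> y1" "y \<ge> y2" "y \<ge> y3" "y \<ge> abs_psum c n" "y \<ge> 1"
        using t abs_psum_nonneg[of c n] by (auto simp: y_def)
      define e where "e = expectation (\<lambda>\<omega>. truncate_abs (\<delta> * y) (Z 0 \<omega>))"
      define C where "C = (\<Sum>i<n. c i)"
      define T where "T = (\<lambda>\<omega>. \<Sum>j<n. c (n - Suc j) * truncate_abs (\<delta> * y) (Z j \<omega>))"
      have "\<bar>C\<bar> \<le> abs_psum c n" unfolding C_def abs_psum_def by (rule sum_abs)
      then have "\<bar>C\<bar> * \<bar>e + m\<bar> \<le> y * (\<epsilon> / 2)"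
        using y3[OF y(3)] y by (intro mult_mono) (auto simp: e_def)
      then have shift: "\<bar>C * e + m * C\<bar> \<le> \<epsilon> / 2 * y" by (simp add: algebra_simps flip: abs_mult)
      define E1 where "E1 = {\<omega> \<in> space M. T \<omega> \<ge> C * e + \<epsilon> / 2 * y}"
      define E2 where "E2 = {\<omega> \<in> space M. - T \<omega> \<ge> - C * e + \<epsilon> / 2 * y}"
      have [measurable]: "T \<in> borel_measurable M" unfolding T_def by measurable
      have ev: "E1 \<in> events" "E2 \<in> events" unfolding E1_def E2_def by measurable
      have "{\<omega> \<in> space M. \<not> sums_close \<epsilon> \<delta> t (\<lambda>j. Z j \<omega>) n} \<subseteq> E1 \<union> E2"
      proof
        fix \<omega> assume "\<omega> \<in> {\<omega> \<in> space M. \<not> sums_close \<epsilon> \<delta> t (\<lambda>j. Z j \<omega>) n}"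
        then have w: "\<omega> \<in> space M" "\<bar>T \<omega> + m * C\<bar> \<ge> \<epsilon> * y"
          by (auto simp: sums_close_def T_def C_def y_def not_less)
        then show "\<omega> \<in> E1 \<union> E2" using shift unfolding E1_def E2_def by (auto simp: abs_if split: if_splits)
      qed
      then have "prob {\<omega> \<in> space M. \<not> sums_close \<epsilon> \<delta> t (\<lambda>j. Z j \<omega>) n} \<le> prob (E1 \<union> E2)"
        using ev by (intro finite_measure_mono) auto
      also have "\<dots> \<le> prob E1 + prob E2" using ev by (rule measure_Un_le)
      also have "prob E1 \<le> exp 1 * y powr (- K)"
        using y1[OF y(1,4)] by (simp add: E1_def T_def C_def e_def sum_rev)
      also have "prob E2 \<le> exp 1 * y powr (- K)"
        using y2[OF y(2,4)] by (simp add: E2_def T_def C_def e_def sum_rev sum_negf)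
      finally show "prob {\<omega> \<in> space M. \<not> sums_close \<epsilon> \<delta> t (\<lambda>j. Z j \<omega>) n}
          \<le> 2 * exp 1 * (t + abs_psum c n) powr (- K)"
        by (simp add: y_def)
    qed
  qed
  then show ?thesis using \<delta>1(1) \<delta>2(1) by (intro exI[of _ "min \<delta>1 \<delta>2"]) auto
qed

end

section \<open>Reduction of the exceedance probability to single jumps\<close>

context single_jump_process
begin

definition jump_prob :: "real \<Rightarrow> real" where
  "jump_prob x = prob {\<omega> \<in> space M. Z 0 \<omega> \<in> jump_set cu cl x}"

definition two_sided_tail :: "real \<Rightarrow> real" where
  "two_sided_tail x = prob {\<omega> \<in> space M. \<bar>Z 0 \<omega>\<bar> > x}"

definition jump_sum :: "real \<Rightarrow> real" where
  "jump_sum t = (\<Sum>k. jump_prob (t + m * abs_psum c (Suc k)))"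

lemma jump_prob_antimono: "antimono jump_prob"
  unfolding jump_prob_def
  by (intro antimonoI finite_measure_mono) (use jump_set_antimono in blast, measurable)

lemma jump_prob_pos:
  assumes "regularly_varying jump_prob \<rho>"
  shows "jump_prob x > 0"
proof -
  obtain b where "\<And>t. t \<ge> b \<Longrightarrow> jump_prob t > 0"
    using regularly_varying_pos[OF assms] by (auto simp: eventually_at_top_linorder)
  then have "jump_prob (max x b) > 0" by simp
  also have "jump_prob (max x b) \<le> jump_prob x" using jump_prob_antimono by (auto simp: monotone_def)
  finally show ?thesis .
qed

lemma sums_close_measurable [measurable]:
  "{\<omega> \<in> space M. \<not> sums_close \<epsilon> \<delta> t (\<lambda>j. Z j \<omega>) n} \<in> events"
  unfolding sums_close_def by measurable

lemma both_large_measurable [measurable]: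
  "{\<omega> \<in> space M. both_large \<delta> t (\<lambda>j. Z j \<omega>) j k} \<in> events"
  unfolding both_large_def by measurable

lemma good_path_measurable [measurable]:
  "{\<omega> \<in> space M. \<not> good_path \<epsilon> \<delta> t (\<lambda>j. Z j \<omega>)} \<in> events"
  unfolding good_path_def sums_close_def both_large_def by measurable

lemma both_large_prob:
  assumes "j \<noteq> k"
  shows "prob {\<omega> \<in> space M. both_large \<delta> t (\<lambda>j. Z j \<omega>) j k} =
    two_sided_tail (\<delta> * (t + abs_psum c (Suc j))) * two_sided_tail (\<delta> * (t + abs_psum c (Suc k)))"
  using prob_Z_pair[OF assms, of "{x. \<bar>x\<bar> > \<delta> * (t + abs_psum c (Suc j))}"
      "{x. \<bar>x\<bar> > \<delta> * (t + abs_psum c (Suc k))}"]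
  by (simp add: both_large_def two_sided_tail_def)

text \<open>Union bounds over times and over pairs of jumps. Independence turns a pair into a
  product, so the double sum over pairs is at most the square of the single sum.\<close>

lemma not_good_path_prob_le:
  assumes s1: "summable f" and f: "\<And>n. prob {\<omega> \<in> space M. \<not> sums_close \<epsilon> \<delta> t (\<lambda>j. Z j \<omega>) n} \<le> f n"
    and s2: "summable h" and h: "\<And>j. two_sided_tail (\<delta> * (t + abs_psum c (Suc j))) \<le> h j"
  shows "prob {\<omega> \<in> space M. \<not> good_path \<epsilon> \<delta> t (\<lambda>j. Z j \<omega>)} \<le> suminf f + (suminf h)\<^sup>2"
proof -
  define E1 where "E1 = (\<lambda>n. {\<omega> \<in> space M. \<not> sums_close \<epsilon> \<delta> t (\<lambda>j. Z j \<omega>) n})"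
  define E2 where "E2 = (\<lambda>j k. if j < k then {\<omega> \<in> space M. both_large \<delta> t (\<lambda>j. Z j \<omega>) j k} else {})"
  have [measurable]: "E1 n \<in> events" "E2 j k \<in> events" for n j k by (auto simp: E1_def E2_def)
  have h0: "0 \<le> h j" for j by (rule order_trans[OF _ h]) (simp add: two_sided_tail_def)
  have sE1: "summable (\<lambda>n. prob (E1 n))"
    by (rule summable_comparison_test'[OF s1]) (use f in \<open>auto simp: E1_def\<close>)
  have "prob (\<Union>n. E1 n) \<le> (\<Sum>n. prob (E1 n))"
    using sE1 by (intro finite_measure_subadditive_countably) auto
  also have "\<dots> \<le> suminf f" using f by (intro suminf_le sE1 s1) (auto simp: E1_def)
  finally have 1: "prob (\<Union>n. E1 n) \<le> suminf f" .
  have E2: "prob (E2 j k) \<le> h j * h k" for j k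
    using h h0 by (auto simp: E2_def both_large_prob two_sided_tail_def intro!: mult_mono)
  have E2j: "prob (\<Union>k. E2 j k) \<le> h j * suminf h" for j
  proof -
    have sE2: "summable (\<lambda>k. prob (E2 j k))"
      by (rule summable_comparison_test'[OF summable_mult[OF s2, of "h j"]]) (use E2 in auto)
    have "prob (\<Union>k. E2 j k) \<le> (\<Sum>k. prob (E2 j k))"
      using sE2 by (intro finite_measure_subadditive_countably) auto
    also have "\<dots> \<le> (\<Sum>k. h j * h k)" using E2 by (intro suminf_le sE2 summable_mult s2) auto
    also have "\<dots> = h j * suminf h" by (rule suminf_mult[OF s2])
    finally show ?thesis .
  qed
  have sU: "summable (\<lambda>j. prob (\<Union>k. E2 j k))"
    by (rule summable_comparison_test'[OF summable_mult2[OF s2, of "suminf h"]]) (use E2j in auto)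
  have "prob (\<Union>j. \<Union>k. E2 j k) \<le> (\<Sum>j. prob (\<Union>k. E2 j k))"
    using sU by (intro finite_measure_subadditive_countably) auto
  also have "\<dots> \<le> (\<Sum>j. h j * suminf h)" using E2j by (intro suminf_le sU summable_mult2 s2) auto
  also have "\<dots> = (suminf h)\<^sup>2" using suminf_mult2[OF s2, of "suminf h"] by (simp add: power2_eq_square)
  finally have 2: "prob (\<Union>j. \<Union>k. E2 j k) \<le> (suminf h)\<^sup>2" .
  have "{\<omega> \<in> space M. \<not> good_path \<epsilon> \<delta> t (\<lambda>j. Z j \<omega>)} \<subseteq> (\<Union>n. E1 n) \<union> (\<Union>j. \<Union>k. E2 j k)"
    by (auto simp: good_path_def E1_def E2_def)
  then have "prob {\<omega> \<in> space M. \<not> good_path \<epsilon> \<delta> t (\<lambda>j. Z j \<omega>)} \<le> prob ((\<Union>n. E1 n) \<union> (\<Union>j. \<Union>k. E2 j k))"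
    by (intro finite_measure_mono) measurable
  also have "\<dots> \<le> prob (\<Union>n. E1 n) + prob (\<Union>j. \<Union>k. E2 j k)" by (rule measure_Un_le) measurable
  finally show ?thesis using 1 2 by linarith
qed

definition exceed :: "real \<Rightarrow> 'a set" where
  "exceed t = {\<omega> \<in> space M. \<exists>n. (\<Sum>j<n. c (n - Suc j) * Z j \<omega>) > t}"

lemma exceed_measurable [measurable]: "exceed t \<in> events"
  unfolding exceed_def by measurable

lemma jump_events:
  shows "{\<omega> \<in> space M. Z k \<omega> \<in> jump_set cu cl x} \<in> events"
    and "prob {\<omega> \<in> space M. Z k \<omega> \<in> jump_set cu cl x} = jump_prob x"
  unfolding jump_prob_def by (measurable, rule prob_Z, measurable)

text \<open>The exponent \<beta> makes the Chernoff errors summable over all times. The bound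
  \<open>tail\<close> is the form in which tail balance enters: large innovations of either sign are
  at most as likely, up to a constant, as favourable ones.\<close>

context
  fixes \<alpha> \<beta> C0 t0 :: real
  assumes rv: "regularly_varying jump_prob (- \<alpha>)" and \<alpha>: "\<alpha> > 0"
    and \<beta>: "\<beta> > 0" "summable (\<lambda>n. (1 + abs_psum c n) powr - \<beta>)"
    and tail: "\<And>x. x \<ge> t0 \<Longrightarrow> two_sided_tail x \<le> C0 * jump_prob x"
    and summ: "\<forall>\<^sub>F t in at_top. summable (\<lambda>k. jump_prob (t + m * abs_psum c (Suc k)))"
    and null: "(jump_sum \<longlongrightarrow> 0) at_top"
begin

lemma C0_nonneg: "C0 \<ge> 0"
proof -
  have "0 \<le> C0 * jump_prob t0" by (rule order_trans[OF _ tail]) (auto simp: two_sided_tail_def)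
  then show ?thesis using jump_prob_pos[OF rv, of t0] by (simp add: zero_le_mult_iff)
qed

lemma jump_prob_scale:
  assumes s: "s > 0" and C: "C > s powr - \<alpha>"
  shows "\<exists>x1. \<forall>x\<ge>x1. jump_prob (s * x) \<le> C * jump_prob x"
proof -
  have "\<forall>\<^sub>F x in at_top. jump_prob (s * x) / jump_prob x < C"
    using order_tendstoD(2)[OF regularly_varying_ratio[OF rv s] C] .
  then have "\<forall>\<^sub>F x in at_top. jump_prob (s * x) \<le> C * jump_prob x"
    by eventually_elim (use jump_prob_pos[OF rv] in \<open>auto simp: field_simps\<close>)
  then show ?thesis by (auto simp: eventually_at_top_linorder)
qed

lemma jump_prob_scale_lower:
  assumes s: "s > 0" and C: "C < s powr - \<alpha>"
  shows "\<exists>x1. \<forall>x\<ge>x1. C * jump_prob x \<le> jump_prob (s * x)"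
proof -
  have "\<forall>\<^sub>F x in at_top. jump_prob (s * x) / jump_prob x > C"
    using order_tendstoD(1)[OF regularly_varying_ratio[OF rv s] C] .
  then have "\<forall>\<^sub>F x in at_top. C * jump_prob x \<le> jump_prob (s * x)"
    by eventually_elim (use jump_prob_pos[OF rv] in \<open>auto simp: field_simps\<close>)
  then show ?thesis by (auto simp: eventually_at_top_linorder)
qed

text \<open>The term \<open>k = 0\<close> alone suffices, since its drift
  \<open>m * \<bar>c 0\<bar>\<close> is below \<open>t\<close>. It shows that the main term decays
  at most polynomially.\<close>

lemma jump_sum_ge:
  assumes s: "summable (\<lambda>k. jump_prob (t + m * abs_psum c (Suc k)))" and t: "t \<ge> m * G"
  shows "jump_prob (2 * t) \<le> jump_sum t" and "jump_sum t > 0"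
proof -
  have "m * abs_psum c (Suc 0) \<le> m * G" using G[of 0] m by (simp add: abs_psum_def)
  then have "jump_prob (2 * t) \<le> jump_prob (t + m * abs_psum c (Suc 0))"
    using jump_prob_antimono t by (auto simp: monotone_def)
  also have "\<dots> = (\<Sum>k<1. jump_prob (t + m * abs_psum c (Suc k)))" by simp
  also have "\<dots> \<le> jump_sum t" unfolding jump_sum_def
    using jump_prob_pos[OF rv] by (intro sum_le_suminf s) (auto intro: less_imp_le)
  finally show "jump_prob (2 * t) \<le> jump_sum t" .
  then show "jump_sum t > 0" using jump_prob_pos[OF rv, of "2 * t"] by linarith
qed

text \<open>A Potter bound for \<open>1 / jump_prob\<close> with exponent \<alpha> + 1 bounds the
  main term below by a multiple of \<open>t powr - (\<alpha> + 1)\<close>, which leaves a factor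
  \<open>1 / t\<close>.\<close>

lemma powr_over_jump_sum:
  shows "((\<lambda>t. t powr - (\<alpha> + 2) / jump_sum t) \<longlongrightarrow> 0) at_top"
proof -
  have mono: "mono (\<lambda>x. 1 / jump_prob x)"
    using jump_prob_antimono jump_prob_pos[OF rv]
    by (auto intro!: monoI divide_left_mono mult_pos_pos simp: monotone_def)
  obtain C x0 where C: "C > 0" "x0 > 0"
    "\<And>y. y \<ge> 1 \<Longrightarrow> 1 / jump_prob (y * x0) \<le> C * y powr (\<alpha> + 1) * (1 / jump_prob x0)"
    using regularly_varying_potter[OF regularly_varying_inverse[OF rv], of 0 "\<alpha> + 1"]
      mono_imp_mono_on[OF mono] by auto
  define B where "B = C * (2 / x0) powr (\<alpha> + 1) / jump_prob x0"
  show ?thesis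
  proof (rule Lim_null_comparison)
    show "((\<lambda>t. B / t) \<longlongrightarrow> 0) at_top" by (rule real_tendsto_divide_at_top[OF tendsto_const filterlim_ident])
    show "\<forall>\<^sub>F t in at_top. norm (t powr - (\<alpha> + 2) / jump_sum t) \<le> B / t"
      using summ eventually_ge_at_top[of "max (m * G) (max x0 1)"]
    proof eventually_elim
      case (elim t)
      note js = jump_sum_ge[OF elim(1)]
      have t: "t \<ge> 1" "t \<ge> x0" "t \<ge> m * G" using elim by auto
      have "2 * t / x0 * x0 = 2 * t" using C by simp
      then have "1 / jump_prob (2 * t) \<le> C * (2 * t / x0) powr (\<alpha> + 1) * (1 / jump_prob x0)"
        using C(3)[of "2 * t / x0"] C(2) t by (simp add: field_simps)
      also have "\<dots> = B * t powr (\<alpha> + 1)"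
        using t C(2) by (simp add: B_def powr_mult powr_divide)
      finally have 1: "1 / jump_prob (2 * t) \<le> B * t powr (\<alpha> + 1)" .
      have "1 / jump_sum t \<le> 1 / jump_prob (2 * t)"
        using js t jump_prob_pos[OF rv, of "2 * t"] by (intro divide_left_mono) auto
      with 1 have "t powr - (\<alpha> + 2) * (1 / jump_sum t) \<le> t powr - (\<alpha> + 2) * (B * t powr (\<alpha> + 1))"
        by (intro mult_left_mono) auto
      also have "\<dots> = B * (t powr - (\<alpha> + 2) * t powr (\<alpha> + 1))" by simp
      also have "t powr - (\<alpha> + 2) * t powr (\<alpha> + 1) = t powr (- 1)" by (simp only: flip: powr_add) simp
      also have "t powr (- 1) = 1 / t" using t by (simp add: powr_minus_divide)
      finally show ?case using js t by simp
    qed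
  qed
qed

text \<open>Once \<delta> is small enough for the Chernoff bound it stays fixed as \<open>t\<close>
  grows. Lowering the thresholds by the factor \<delta> then costs only a constant in the jump
  probabilities, so pairs of jumps contribute a multiple of
  \<open>(jump_sum t)\<^sup>2\<close>.\<close>

lemma not_good_path_negligible:
  assumes \<epsilon>: "\<epsilon> > 0" and d: "d > 0"
  shows "\<exists>\<delta>>0. \<delta> \<le> d \<and>
    ((\<lambda>t. prob {\<omega> \<in> space M. \<not> good_path \<epsilon> \<delta> t (\<lambda>j. Z j \<omega>)} / jump_sum t) \<longlongrightarrow> 0) at_top"
proof -
  \<comment> \<open>The part \<alpha> + 2 makes the error small against the main term in
    \<open>t\<close>, the part \<beta> makes it summable in \<open>n\<close>.\<close>
  define K where "K = \<alpha> + 2 + \<beta>"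
  have K: "K > 0" using \<alpha> \<beta> by (simp add: K_def)
  obtain \<delta>0 where \<delta>0: "\<delta>0 > 0" "\<And>\<delta>. 0 < \<delta> \<and> \<delta> \<le> \<delta>0 \<Longrightarrow> \<exists>t0. \<forall>n t. t \<ge> t0 \<longrightarrow>
    prob {\<omega> \<in> space M. \<not> sums_close \<epsilon> \<delta> t (\<lambda>j. Z j \<omega>) n} \<le> 2 * exp 1 * (t + abs_psum c n) powr (- K)"
    using sums_close_prob[OF \<epsilon> K] by auto
  define \<delta> where "\<delta> = min \<delta>0 d"
  have \<delta>: "\<delta> > 0" "\<delta> \<le> d" "\<delta> \<le> \<delta>0" using d \<delta>0 by (auto simp: \<delta>_def)
  obtain t1 where t1: "\<And>n t. t \<ge> t1 \<Longrightarrow>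
    prob {\<omega> \<in> space M. \<not> sums_close \<epsilon> \<delta> t (\<lambda>j. Z j \<omega>) n} \<le> 2 * exp 1 * (t + abs_psum c n) powr (- K)"
    using \<delta>0(2)[of \<delta>] \<delta> by auto
  \<comment> \<open>Then \<open>s * (t + m * A) \<le> \<delta> * (t + A)\<close>, which moves the
    thresholds to the points occurring in \<open>jump_sum\<close>.\<close>
  define s where "s = \<delta> / max 1 m"
  have s: "s > 0" using \<delta> by (simp add: s_def)
  obtain x1 where x1: "\<And>x. x \<ge> x1 \<Longrightarrow> jump_prob (s * x) \<le> (s powr - \<alpha> + 1) * jump_prob x"
    using jump_prob_scale[OF s, of "s powr - \<alpha> + 1"] by auto
  define C where "C = C0 * (s powr - \<alpha> + 1)"
  define W where "W = (\<Sum>n. (1 + abs_psum c n) powr - \<beta>)"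
  have "((\<lambda>t. prob {\<omega> \<in> space M. \<not> good_path \<epsilon> \<delta> t (\<lambda>j. Z j \<omega>)} / jump_sum t) \<longlongrightarrow> 0) at_top"
  proof (rule Lim_null_comparison)
    have "((\<lambda>t. 2 * exp 1 * W * (t powr - (\<alpha> + 2) / jump_sum t) + C\<^sup>2 * jump_sum t) \<longlongrightarrow>
        2 * exp 1 * W * 0 + C\<^sup>2 * 0) at_top"
      by (intro tendsto_intros powr_over_jump_sum null)
    then show "((\<lambda>t. 2 * exp 1 * W * (t powr - (\<alpha> + 2) / jump_sum t) + C\<^sup>2 * jump_sum t) \<longlongrightarrow> 0) at_top"
      by simp
    show "\<forall>\<^sub>F t in at_top. norm (prob {\<omega> \<in> space M. \<not> good_path \<epsilon> \<delta> t (\<lambda>j. Z j \<omega>)} / jump_sum t)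
        \<le> 2 * exp 1 * W * (t powr - (\<alpha> + 2) / jump_sum t) + C\<^sup>2 * jump_sum t"
      using summ eventually_ge_at_top[of "max (max (m * G) 1) (max (max t1 x1) (t0 / \<delta>))"]
    proof eventually_elim
      case (elim t)
      have t: "t \<ge> m * G" "t \<ge> 1" "t \<ge> t1" "t \<ge> x1" "t \<ge> t0 / \<delta>" using elim by auto
      have js: "jump_sum t > 0" by (rule jump_sum_ge(2)[OF elim(1) t(1)])
      define f where "f = (\<lambda>n. 2 * exp 1 * t powr - (\<alpha> + 2) * (1 + abs_psum c n) powr - \<beta>)"
      define h where "h = (\<lambda>j. C * jump_prob (t + m * abs_psum c (Suc j)))"
      have "prob {\<omega> \<in> space M. \<not> good_path \<epsilon> \<delta> t (\<lambda>j. Z j \<omega>)} \<le> suminf f + (suminf h)\<^sup>2"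
      proof (rule not_good_path_prob_le)
        show "summable f" unfolding f_def by (intro summable_mult \<beta>)
        show "summable h" unfolding h_def by (intro summable_mult elim)
        show "prob {\<omega> \<in> space M. \<not> sums_close \<epsilon> \<delta> t (\<lambda>j. Z j \<omega>) n} \<le> f n" for n
        proof -
          have A: "abs_psum c n \<ge> 0" by (rule abs_psum_nonneg)
          have "(t + abs_psum c n) powr (- K) = (t + abs_psum c n) powr - (\<alpha> + 2) * (t + abs_psum c n) powr - \<beta>"
            by (simp add: K_def flip: powr_add)
          also have "\<dots> \<le> t powr - (\<alpha> + 2) * (1 + abs_psum c n) powr - \<beta>"
            using t A \<alpha> \<beta> by (intro mult_mono powr_mono2') auto
          finally have "2 * exp 1 * (t + abs_psum c n) powr (- K) \<le> f n"
            unfolding f_def by (simp add: mult.assoc)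
          with t1[OF t(3), of n] show ?thesis by linarith
        qed
        show "two_sided_tail (\<delta> * (t + abs_psum c (Suc j))) \<le> h j" for j
        proof -
          define A where "A = abs_psum c (Suc j)"
          have A: "A \<ge> 0" by (simp add: A_def abs_psum_nonneg)
          have "t0 \<le> \<delta> * t" using t(5) \<delta> by (simp add: field_simps)
          also have "\<dots> \<le> \<delta> * (t + A)" using A \<delta> by (intro mult_left_mono) auto
          finally have "two_sided_tail (\<delta> * (t + A)) \<le> C0 * jump_prob (\<delta> * (t + A))" by (rule tail)
          also have "\<dots> \<le> C0 * jump_prob (s * (t + m * A))"
          proof -
            have "t + m * A \<le> max 1 m * (t + A)"
            proof -
              have "1 * t \<le> max 1 m * t" "m * A \<le> max 1 m * A" using t A by (intro mult_right_mono; simp)+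
              then show ?thesis by (simp add: algebra_simps)
            qed
            then have "s * (t + m * A) \<le> s * (max 1 m * (t + A))" using s by (intro mult_left_mono) auto
            moreover have "max 1 m \<noteq> 0" by (auto simp: max_def)
            ultimately have "s * (t + m * A) \<le> \<delta> * (t + A)" by (simp add: s_def)
            then show ?thesis using jump_prob_antimono C0_nonneg
              by (intro mult_left_mono) (auto simp: monotone_def)
          qed
          also have "\<dots> \<le> C0 * ((s powr - \<alpha> + 1) * jump_prob (t + m * A))"
          proof -
            have "t + m * A \<ge> x1" using t(4) m A by (simp add: add_increasing2)
            then show ?thesis using C0_nonneg x1 by (intro mult_left_mono) auto
          qed
          finally show ?thesis by (simp add: h_def C_def A_def mult.assoc)
        qed
      qed
      also have "suminf f = 2 * exp 1 * t powr - (\<alpha> + 2) * W"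
        unfolding f_def W_def by (rule suminf_mult[OF \<beta>(2)])
      also have "suminf h = C * jump_sum t"
        unfolding h_def jump_sum_def by (rule suminf_mult[OF elim(1)])
      finally have "prob {\<omega> \<in> space M. \<not> good_path \<epsilon> \<delta> t (\<lambda>j. Z j \<omega>)} / jump_sum t
          \<le> (2 * exp 1 * t powr - (\<alpha> + 2) * W + (C * jump_sum t)\<^sup>2) / jump_sum t"
        using js by (intro divide_right_mono) auto
      also have "\<dots> = 2 * exp 1 * W * (t powr - (\<alpha> + 2) / jump_sum t) + C\<^sup>2 * jump_sum t"
        using js by (simp add: add_divide_distrib power2_eq_square)
      finally show ?case using js by simp
    qed
  qed
  then show ?thesis using \<delta> by blast
qed

text \<open>On good paths exceeding is squeezed between a jump beyond \<open>(1 + x)\<close> and one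
  beyond \<open>(1 - x)\<close> times level plus drift. A union bound and the Bonferroni inequality
  turn both into sums, which regular variation compares with \<open>jump_sum\<close>. The allowance
  \<open>e\<close> is divided among this rescaling, the bad paths and the Bonferroni loss.\<close>

theorem exceed_asymptotics: "((\<lambda>t. prob (exceed t) / jump_sum t) \<longlongrightarrow> 1) at_top"
proof (rule tendstoI)
  fix e :: real assume e: "e > 0"
  have "((\<lambda>x. (1 - x) powr - \<alpha>) \<longlongrightarrow> (1 - 0) powr - \<alpha>) (at_right 0)"
    by (intro tendsto_intros) auto
  then have "\<forall>\<^sub>F x in at_right 0. (1 - x) powr - \<alpha> < 1 + e / 3"
    by (rule order_tendstoD) (use e in simp)
  moreover have "((\<lambda>x. (1 + x) powr - \<alpha>) \<longlongrightarrow> (1 + 0) powr - \<alpha>) (at_right 0)"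
    by (intro tendsto_intros) auto
  then have "\<forall>\<^sub>F x in at_right 0. (1 + x) powr - \<alpha> > 1 - e / 3"
    by (rule order_tendstoD) (use e in simp)
  moreover have "\<forall>\<^sub>F x::real in at_right 0. x \<in> {0<..<1}" by (rule eventually_at_right_real) simp
  ultimately have "\<forall>\<^sub>F x in at_right 0. (1 - x) powr - \<alpha> < 1 + e / 3 \<and> (1 + x) powr - \<alpha> > 1 - e / 3 \<and> x \<in> {0<..<1}"
    by eventually_elim auto
  then obtain x where x: "(1 - x) powr - \<alpha> < 1 + e / 3" "(1 + x) powr - \<alpha> > 1 - e / 3" "0 < x" "x < 1"
    using eventually_happens'[of "at_right (0::real)"] by auto
  \<comment> \<open>This makes the relative error \<open>3 * \<epsilon> * q\<close> of the path
    lemmas equal to \<open>x\<close>.\<close>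
  define \<epsilon> where "\<epsilon> = x / (3 * q)"
  have \<epsilon>: "\<epsilon> > 0" "3 * \<epsilon> * q = x" using x q by (auto simp: \<epsilon>_def)
  \<comment> \<open>For \<delta> at most \<open>d\<close> the quantity
    \<open>2 * \<delta> * q * G\<close> is at most 1/2, so a qualifying jump is not
    truncated.\<close>
  define d where "d = 1 / (4 * q * G)"
  have d: "d > 0" using q G_pos by (simp add: d_def)
  define bad where "bad = (\<lambda>\<delta> t. {\<omega> \<in> space M. \<not> good_path \<epsilon> \<delta> t (\<lambda>j. Z j \<omega>)})"
  obtain \<delta> where \<delta>: "\<delta> > 0" "\<delta> \<le> d" "((\<lambda>t. prob (bad \<delta> t) / jump_sum t) \<longlongrightarrow> 0) at_top"
    using not_good_path_negligible[OF \<epsilon>(1) d] unfolding bad_def by auto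
  have "2 * \<delta> * q * G \<le> 2 * d * q * G" using \<delta>(2) q G_pos by (intro mult_right_mono mult_left_mono) auto
  also have "\<dots> < 1" using q G_pos by (simp add: d_def)
  finally have \<delta>q: "2 * \<delta> * q * G < 1" .
  have [measurable]: "bad \<delta> t \<in> events" for t unfolding bad_def by measurable
  obtain x1 where x1: "\<And>u. u \<ge> x1 \<Longrightarrow> jump_prob ((1 - x) * u) \<le> (1 + e / 3) * jump_prob u"
    using jump_prob_scale[of "1 - x" "1 + e / 3"] x by auto
  obtain x2 where x2: "\<And>u. u \<ge> x2 \<Longrightarrow> (1 - e / 3) * jump_prob u \<le> jump_prob ((1 + x) * u)"
    using jump_prob_scale_lower[of "1 + x" "1 - e / 3"] x by auto
  define E where "E = real (max iu il) * G"
  have "\<forall>\<^sub>F t in at_top. jump_sum t < e / 3" using e by (intro order_tendstoD(2)[OF null]) simp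
  moreover have "\<forall>\<^sub>F t in at_top. prob (bad \<delta> t) / jump_sum t < e / 3"
    using e by (intro order_tendstoD(2)[OF \<delta>(3)]) simp
  ultimately show "\<forall>\<^sub>F t in at_top. dist (prob (exceed t) / jump_sum t) 1 < e"
    using summ eventually_ge_at_top[of "max (max (max (m * G) 1) (max x1 x2)) (max (max (m * D / \<epsilon>) (m * E / \<epsilon>)) E)"]
  proof eventually_elim
    case (elim t)
    have t: "t \<ge> m * G" "t \<ge> 1" "t \<ge> x1" "t \<ge> x2" "t \<ge> m * D / \<epsilon>" "t \<ge> m * E / \<epsilon>" "t \<ge> E"
      using elim by auto
    have tD: "m * D \<le> \<epsilon> * t" and tE: "m * E \<le> \<epsilon> * t" using t(5,6) \<epsilon>(1) by (simp_all add: field_simps)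
    have js: "jump_sum t > 0" by (rule jump_sum_ge(2)[OF elim(3) t(1)])
    define u where "u = (\<lambda>k. t + m * abs_psum c (Suc k))"
    have ut: "u k \<ge> t" for k using m abs_psum_nonneg[of c "Suc k"] by (simp add: u_def)
    have su: "summable (\<lambda>k. jump_prob (u k))" using elim(3) by (simp add: u_def)
    have js_eq: "jump_sum t = (\<Sum>k. jump_prob (u k))" by (simp add: jump_sum_def u_def)
    define J where "J = (\<lambda>r k. {\<omega> \<in> space M. Z k \<omega> \<in> jump_set cu cl (r * u k)})"
    have J: "J r k \<in> events" "prob (J r k) = jump_prob (r * u k)" for r k
      unfolding J_def by (rule jump_events)+

    have Jge: "prob (J (1 - x) k) \<le> (1 + e / 3) * jump_prob (u k)" for k
      unfolding J(2) using x1 ut[of k] t(3) by simp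
    have sJ: "summable (\<lambda>k. prob (J (1 - x) k))"
      by (rule summable_comparison_test'[OF summable_mult[OF su, of "1 + e / 3"]]) (use Jge in auto)
    have "exceed t \<subseteq> bad \<delta> t \<union> (\<Union>k. J (1 - x) k)"
    proof
      fix \<omega> assume w: "\<omega> \<in> exceed t"
      then obtain n where n: "\<omega> \<in> space M" "(\<Sum>j<n. c (n - Suc j) * Z j \<omega>) > t" by (auto simp: exceed_def)
      have "\<exists>k. Z k \<omega> \<in> jump_set cu cl ((1 - 3 * \<epsilon> * q) * (t + m * abs_psum c (Suc k)))"
        if "good_path \<epsilon> \<delta> t (\<lambda>j. Z j \<omega>)"
        using good_path_upper[OF that \<epsilon>(1) _ _ _ tD n(2)] \<epsilon>(2) x \<delta> t by simp
      then show "\<omega> \<in> bad \<delta> t \<union> (\<Union>k. J (1 - x) k)" using n(1) \<epsilon>(2) by (auto simp: bad_def J_def u_def)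
    qed
    then have "prob (exceed t) \<le> prob (bad \<delta> t \<union> (\<Union>k. J (1 - x) k))"
      using J(1) by (intro finite_measure_mono) auto
    also have "\<dots> \<le> prob (bad \<delta> t) + prob (\<Union>k. J (1 - x) k)"
      using J(1) by (intro measure_Un_le) auto
    also have "prob (\<Union>k. J (1 - x) k) \<le> (\<Sum>k. prob (J (1 - x) k))"
      using J(1) sJ by (intro finite_measure_subadditive_countably) auto
    also have "\<dots> \<le> (\<Sum>k. (1 + e / 3) * jump_prob (u k))"
      by (intro suminf_le sJ summable_mult su Jge)
    also have "\<dots> = (1 + e / 3) * jump_sum t" unfolding js_eq by (rule suminf_mult[OF su])
    finally have "prob (exceed t) \<le> prob (bad \<delta> t) + (1 + e / 3) * jump_sum t" by simp
    then have "prob (exceed t) / jump_sum t \<le> (prob (bad \<delta> t) + (1 + e / 3) * jump_sum t) / jump_sum t"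
      using js by (intro divide_right_mono) auto
    also have "\<dots> = prob (bad \<delta> t) / jump_sum t + (1 + e / 3)" using js by (simp add: add_divide_distrib)
    also have "\<dots> < 1 + e" using elim(2) e by linarith
    finally have upper: "prob (exceed t) / jump_sum t < 1 + e" .

    have Jle: "prob (J (1 + x) k) \<le> jump_prob (u k)" for k
    proof -
      have "1 * u k \<le> (1 + x) * u k" using x t ut[of k] by (intro mult_right_mono) auto
      then show ?thesis unfolding J(2) using jump_prob_antimono by (auto simp: monotone_def)
    qed
    have sJ': "summable (\<lambda>k. prob (J (1 + x) k))"
      using Jle by (intro summable_comparison_test'[OF su]) auto
    define S where "S = (\<Sum>k. prob (J (1 + x) k))"
    have "(1 - e / 3) * jump_sum t = (\<Sum>k. (1 - e / 3) * jump_prob (u k))"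
      unfolding js_eq by (rule suminf_mult[OF su, symmetric])
    also have "\<dots> \<le> S" unfolding S_def
    proof (intro suminf_le sJ' summable_mult su)
      fix k show "(1 - e / 3) * jump_prob (u k) \<le> prob (J (1 + x) k)"
        unfolding J(2) using x2 ut[of k] t(4) by simp
    qed
    finally have S1: "(1 - e / 3) * jump_sum t \<le> S" .
    have S2: "S \<le> jump_sum t" unfolding S_def js_eq using Jle by (intro suminf_le sJ' su) auto
    have S0: "0 \<le> S" unfolding S_def by (intro suminf_nonneg sJ') auto
    have "S - S\<^sup>2 \<le> prob (\<Union>k. J (1 + x) k)"
      unfolding S_def
    proof (rule bonferroni_pairwise[OF J(1) sJ'])
      fix k l :: nat assume "k < l"
      then have kl: "k \<noteq> l" by simp
      have "J (1 + x) k \<inter> J (1 + x) l = {\<omega> \<in> space M. Z k \<omega> \<in> jump_set cu cl ((1 + x) * u k) \<and>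
          Z l \<omega> \<in> jump_set cu cl ((1 + x) * u l)}"
        by (auto simp: J_def)
      then show "prob (J (1 + x) k \<inter> J (1 + x) l) \<le> prob (J (1 + x) k) * prob (J (1 + x) l)"
        using prob_Z_pair[OF kl jump_set_sets jump_set_sets, of cu cl "(1 + x) * u k" cu cl "(1 + x) * u l"]
        unfolding J(2) jump_prob_def by simp
    qed
    also have "\<dots> \<le> prob (exceed t \<union> bad \<delta> t)"
    proof (intro finite_measure_mono subsetI)
      fix \<omega> assume "\<omega> \<in> (\<Union>k. J (1 + x) k)"
      then obtain k where k: "\<omega> \<in> space M" "Z k \<omega> \<in> jump_set cu cl ((1 + x) * u k)" by (auto simp: J_def)
      have "\<exists>n. (\<Sum>j<n. c (n - Suc j) * Z j \<omega>) > t" if "good_path \<epsilon> \<delta> t (\<lambda>j. Z j \<omega>)"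
        using good_path_lower[OF that \<epsilon>(1) _ \<delta>q] \<delta>(1) t tE k(2) \<epsilon>(2) by (auto simp: E_def u_def)
      then show "\<omega> \<in> exceed t \<union> bad \<delta> t" using k(1) by (auto simp: exceed_def bad_def)
    qed measurable
    also have "\<dots> \<le> prob (exceed t) + prob (bad \<delta> t)" by (rule measure_Un_le) measurable
    finally have low: "S - S\<^sup>2 \<le> prob (exceed t) + prob (bad \<delta> t)" .
    have "S\<^sup>2 \<le> (jump_sum t)\<^sup>2" using S0 S2 by (rule power_mono[rotated])
    then have "((1 - e / 3) * jump_sum t - (jump_sum t)\<^sup>2 - prob (bad \<delta> t)) / jump_sum t \<le> prob (exceed t) / jump_sum t"
      using low S1 js by (intro divide_right_mono) auto
    also have "((1 - e / 3) * jump_sum t - (jump_sum t)\<^sup>2 - prob (bad \<delta> t)) / jump_sum t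
        = (1 - e / 3) - jump_sum t - prob (bad \<delta> t) / jump_sum t"
      using js by (simp add: diff_divide_distrib power2_eq_square)
    finally have "prob (exceed t) / jump_sum t > 1 - e" using elim(1,2) by linarith
    with upper show ?case by (simp add: dist_real_def abs_less_iff)
  qed
qed

end

end

section \<open>Distribution tails and extremal coefficients\<close>

text \<open>Beyond some index all coefficients lie below the positive value \<open>c j\<close>, so
  the supremum is a maximum over a finite prefix. The lag at which it occurs is used for the lower
  bound on the maximum of the process.\<close>

lemma SUP_attained_null_seq:
  fixes c :: "nat \<Rightarrow> real"
  assumes lim: "c \<longlonglongrightarrow> 0" and j: "c j > 0"
  shows "\<exists>i. c i = (SUP n. c n)" and "\<And>n. c n \<le> (SUP n. c n)"
proof -
  obtain N where N: "\<And>n. n \<ge> N \<Longrightarrow> c n < c j"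
    using order_tendstoD(2)[OF lim j] by (auto simp: eventually_sequentially)
  have "Max (c ` {..max N j}) \<in> c ` {..max N j}" by (intro Max_in) auto
  then obtain i where i: "c i = Max (c ` {..max N j})" by (metis imageE)
  have le: "c n \<le> c i" for n
  proof (cases "n \<le> max N j")
    case True
    then show ?thesis unfolding i by (intro Max_ge) auto
  next
    case False
    then have "c n < c j" using N by simp
    also have "c j \<le> c i" unfolding i by (intro Max_ge) auto
    finally show ?thesis by simp
  qed
  have eq: "(SUP n. c n) = c i"
    by (rule antisym) (auto intro!: cSUP_least cSUP_upper bdd_aboveI2 le)
  show "\<exists>i. c i = (SUP n. c n)" using eq by metis
  show "c n \<le> (SUP n. c n)" for n using eq le by simp
qed

text \<open>A negative infimum of a null sequence is attained by the preceding argument applied to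
  \<open>- c\<close>. Without negative coefficients \<open>coeff_inf c\<close> is 0, possibly
  without being a coefficient, hence the implication.\<close>

lemma coeff_inf_attained:
  assumes lim: "c \<longlonglongrightarrow> 0"
  shows "coeff_inf c \<le> 0" and "\<And>n. coeff_inf c \<le> c n" and "\<exists>i. coeff_inf c < 0 \<longrightarrow> c i = coeff_inf c"
proof -
  show 1: "coeff_inf c \<le> 0" by (simp add: coeff_inf_def)
  have bdd: "bdd_below (range c)"
    by (rule bounded_imp_bdd_below[OF convergent_imp_bounded[OF lim]])
  have inf: "(INF n. c n) \<le> c n" for n by (rule cINF_lower[OF bdd]) simp
  show "coeff_inf c \<le> c n" for n using inf[of n] by (simp add: coeff_inf_def)
  show "\<exists>i. coeff_inf c < 0 \<longrightarrow> c i = coeff_inf c"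
  proof (cases "\<exists>j. c j < 0")
    case True
    then obtain j where j: "c j < 0" ..
    have "(\<lambda>n. - c n) \<longlonglongrightarrow> 0" using tendsto_minus[OF lim] by simp
    from SUP_attained_null_seq[OF this, of j] j
    obtain i where i: "- c i = (SUP n. - c n)" "\<And>n. - c n \<le> (SUP n. - c n)" by auto
    have "(INF n. c n) = c i"
    proof (rule antisym)
      have "c i \<le> c n" for n using i(2)[of n] unfolding i(1)[symmetric] by simp
      then show "c i \<le> (INF n. c n)" by (intro cINF_greatest) auto
    qed (rule inf)
    moreover have "c i < 0" using i(2)[of j] j unfolding i(1)[symmetric] by simp
    ultimately show ?thesis by (auto simp: coeff_inf_def)
  next
    case False
    then have "0 \<le> (INF n. c n)" by (intro cINF_greatest) (auto simp: not_less)
    then show ?thesis by (simp add: coeff_inf_def)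
  qed
qed

lemma (in prob_space) indep_vars_reindex_inj:
  assumes f: "inj_on f I" and indep: "indep_vars M' X (f ` I)"
  shows "indep_vars (\<lambda>i. M' (f i)) (\<lambda>i. X (f i)) I"
proof -
  define S where "S = (\<lambda>i. {X i -` A \<inter> space M | A. A \<in> sets (M' i)})"
  from indep have rv: "\<And>i. i \<in> f ` I \<Longrightarrow> random_variable (M' i) (X i)" and inds: "indep_sets S (f ` I)"
    by (auto simp: indep_vars_def2 S_def)
  have "indep_sets (\<lambda>i. S (f i)) I"
    unfolding indep_sets_def
  proof (intro conjI ballI allI impI)
    show "S (f i) \<subseteq> events" if "i \<in> I" for i using inds that by (auto simp: indep_sets_def)
    fix J A assume J: "J \<subseteq> I" "J \<noteq> {}" "finite J" and A: "A \<in> (\<Pi> i\<in>J. S (f i))"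
    have fJ: "inj_on f J" using f J(1) by (rule inj_on_subset)
    define A' where "A' = (\<lambda>k. A (the_inv_into J f k))"
    have A': "A' (f j) = A j" if "j \<in> J" for j using the_inv_into_f_f[OF fJ that] by (simp add: A'_def)
    have "A' \<in> (\<Pi> k\<in>f ` J. S k)" using A A' by auto
    then have "prob (\<Inter>k\<in>f ` J. A' k) = (\<Prod>k\<in>f ` J. prob (A' k))"
      using inds J unfolding indep_sets_def by (metis finite_imageI image_is_empty image_mono)
    then show "prob (\<Inter>j\<in>J. A j) = (\<Prod>j\<in>J. prob (A j))"
      using A' by (simp add: prod.reindex[OF fJ])
  qed
  then show ?thesis using rv by (auto simp: indep_vars_def2 S_def)
qed

text \<open>Dyadic decomposition: \<open>\<bar>X\<bar> powr p\<close> is at most 1 plus the sum of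
  \<open>(2 ^ Suc k) powr p\<close> over all \<open>k\<close> with
  \<open>\<bar>X\<bar> > 2 ^ k\<close>. In expectation the tail bound turns this into a geometric
  series with ratio \<open>2 powr (p - s)\<close>.\<close>

lemma (in prob_space) integrable_powr_of_tail:
  fixes X :: "'a \<Rightarrow> real"
  assumes [measurable]: "random_variable borel X" and p: "0 < p" "p < s"
    and tail: "\<And>t. t \<ge> t0 \<Longrightarrow> prob {\<omega> \<in> space M. \<bar>X \<omega>\<bar> > t} \<le> C * t powr - s"
  shows "integrable M (\<lambda>\<omega>. \<bar>X \<omega>\<bar> powr p)"
proof (rule integrableI_bounded)
  define t1 where "t1 = max t0 1"
  \<comment> \<open>The second entry extends the tail bound down to \<open>t = 1\<close>, where only
    the trivial bound 1 on the probability is available.\<close>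
  define K where "K = max C (t1 powr s)"
  have K: "K \<ge> 0" using powr_ge_zero[of t1 s] unfolding K_def by linarith
  have tailK: "prob {\<omega> \<in> space M. \<bar>X \<omega>\<bar> > t} \<le> K * t powr - s" if t: "t \<ge> 1" for t
  proof (cases "t \<ge> t1")
    case True
    then have "prob {\<omega> \<in> space M. \<bar>X \<omega>\<bar> > t} \<le> C * t powr - s" using tail by (simp add: t1_def)
    also have "\<dots> \<le> K * t powr - s" by (intro mult_right_mono) (auto simp: K_def)
    finally show ?thesis .
  next
    case False
    have "1 = t powr s * t powr - s" using t by (simp flip: powr_add)
    also have "\<dots> \<le> K * t powr - s"
    proof (rule mult_right_mono)
      have "t powr s \<le> t1 powr s" using False t p by (intro powr_mono2) auto
      then show "t powr s \<le> K" by (simp add: K_def)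
    qed simp
    finally show ?thesis by (rule order_trans[OF prob_le_1])
  qed
  define E where "E = (\<lambda>k::nat. {\<omega> \<in> space M. \<bar>X \<omega>\<bar> > 2 ^ k})"
  have [measurable]: "E k \<in> events" for k unfolding E_def by measurable
  define a where "a = (\<lambda>k::nat. (2 ^ Suc k) powr p :: real)"
  have pt: "ennreal (norm (\<bar>X \<omega>\<bar> powr p)) \<le> 1 + (\<Sum>k. ennreal (a k) * indicator (E k) \<omega>)" if w: "\<omega> \<in> space M" for \<omega>
  proof (cases "\<bar>X \<omega>\<bar> \<le> 1")
    case True
    then have "\<bar>X \<omega>\<bar> powr p \<le> 1 powr p" using p by (intro powr_mono2) auto
    then have "ennreal (norm (\<bar>X \<omega>\<bar> powr p)) \<le> 1" by simp
    then show ?thesis by (rule add_increasing2[rotated]) simp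
  next
    case False
    obtain n where n: "\<bar>X \<omega>\<bar> \<le> 2 ^ n" using real_arch_pow[of 2 "\<bar>X \<omega>\<bar>"] by (auto intro: less_imp_le)
    define m where "m = (LEAST n. \<bar>X \<omega>\<bar> \<le> 2 ^ n)"
    have m: "\<bar>X \<omega>\<bar> \<le> 2 ^ m" unfolding m_def by (rule LeastI[of "\<lambda>n. \<bar>X \<omega>\<bar> \<le> 2 ^ n", OF n])
    then have "m \<noteq> 0" using False by (cases m) auto
    then obtain k where k: "m = Suc k" by (cases m) auto
    have "\<not> \<bar>X \<omega>\<bar> \<le> 2 ^ k" using not_less_Least[of k "\<lambda>n. \<bar>X \<omega>\<bar> \<le> 2 ^ n"] k m_def by simp
    then have wE: "\<omega> \<in> E k" using w by (simp add: E_def)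
    have "\<bar>X \<omega>\<bar> powr p \<le> a k" unfolding a_def using m k p by (intro powr_mono2) auto
    then have "ennreal (norm (\<bar>X \<omega>\<bar> powr p)) \<le> ennreal (a k) * indicator (E k) \<omega>"
      using wE by (simp add: ennreal_leI)
    also have "\<dots> \<le> (\<Sum>k. ennreal (a k) * indicator (E k) \<omega>)"
    proof -
      have "sum v {k} \<le> suminf v" for v :: "nat \<Rightarrow> ennreal" by (rule sum_le_suminf) auto
      then have "v k \<le> suminf v" for v :: "nat \<Rightarrow> ennreal" by (metis finite.emptyI empty_iff sum.insert sum.empty add.right_neutral)
      then show ?thesis .
    qed
    also have "\<dots> \<le> 1 + (\<Sum>k. ennreal (a k) * indicator (E k) \<omega>)" by simp
    finally show ?thesis .
  qed
  define r where "r = (2::real) powr (p - s)"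
  have r: "0 \<le> r" "r < 1" using p by (auto simp: r_def powr_less_one)
  have aE: "a k * prob (E k) \<le> 2 powr p * K * r ^ k" for k
  proof -
    have "prob (E k) \<le> K * (2 ^ k) powr - s" unfolding E_def by (rule tailK) simp
    then have "a k * prob (E k) \<le> a k * (K * (2 ^ k) powr - s)" by (intro mult_left_mono) (auto simp: a_def)
    also have "\<dots> = 2 powr p * K * ((2 ^ k) powr p * (2 ^ k) powr - s)"
      by (simp add: a_def powr_mult)
    also have "(2 ^ k) powr p * (2 ^ k) powr - s = ((2::real) ^ k) powr (p - s)"
      by (simp flip: powr_add)
    also have "((2::real) ^ k) powr (p - s) = r ^ k"
      by (simp add: r_def powr_powr powr_realpow[symmetric] mult.commute)
    finally show ?thesis .
  qed
  have sumr: "summable (\<lambda>k. 2 powr p * K * r ^ k)" using r by (intro summable_mult summable_geometric) auto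
  have "(\<integral>\<^sup>+\<omega>. ennreal (norm (\<bar>X \<omega>\<bar> powr p)) \<partial>M)
      \<le> (\<integral>\<^sup>+\<omega>. 1 + (\<Sum>k. ennreal (a k) * indicator (E k) \<omega>) \<partial>M)"
    using pt by (rule nn_integral_mono)
  also have "\<dots> = 1 + (\<Sum>k. \<integral>\<^sup>+\<omega>. ennreal (a k) * indicator (E k) \<omega> \<partial>M)"
    by (simp add: nn_integral_add nn_integral_suminf emeasure_space_1)
  also have "(\<Sum>k. \<integral>\<^sup>+\<omega>. ennreal (a k) * indicator (E k) \<omega> \<partial>M) \<le> (\<Sum>k. ennreal (2 powr p * K * r ^ k))"
  proof (intro suminf_le summableI)
    fix k
    have "(\<integral>\<^sup>+\<omega>. ennreal (a k) * indicator (E k) \<omega> \<partial>M) = ennreal (a k * prob (E k))"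
      by (simp add: nn_integral_cmult_indicator emeasure_eq_measure a_def flip: ennreal_mult)
    then show "(\<integral>\<^sup>+\<omega>. ennreal (a k) * indicator (E k) \<omega> \<partial>M) \<le> ennreal (2 powr p * K * r ^ k)"
      using aE by (simp add: ennreal_leI)
  qed
  also have "(\<Sum>k. ennreal (2 powr p * K * r ^ k)) = ennreal (\<Sum>k. 2 powr p * K * r ^ k)"
    using K r by (intro suminf_ennreal2 sumr) auto
  also have "1 + \<dots> < \<infinity>" by (simp add: ennreal_add_less_top)
  finally show "(\<integral>\<^sup>+\<omega>. ennreal (norm (\<bar>X \<omega>\<bar> powr p)) \<partial>M) < \<infinity>" by (simp add: add_left_mono)
qed measurable

lemma regularly_varying_antimono_tail_bound:
  assumes rv: "regularly_varying Q (- \<alpha>)" and Q: "antimono Q" and s: "s < \<alpha>"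
  shows "\<exists>C t0. \<forall>t\<ge>t0. Q t \<le> C * t powr - s"
proof -
  obtain C x0 where C: "C > 0" "x0 > 0" "\<And>y. y \<ge> 1 \<Longrightarrow> Q (y * x0) \<le> C * y powr - s * Q x0"
    using regularly_varying_potter[OF rv, of 0 "- s"] monotone_on_subset[OF Q] s by auto
  have "Q t \<le> (C * x0 powr s * Q x0) * t powr - s" if "t \<ge> x0" for t
  proof -
    have "Q t \<le> C * (t / x0) powr - s * Q x0" using C(3)[of "t / x0"] C(2) that by (simp add: field_simps)
    also have "(t / x0) powr - s = x0 powr s * t powr - s"
      using C(2) that by (simp add: powr_divide powr_minus field_simps)
    finally show ?thesis by (simp add: mult_ac)
  qed
  then show ?thesis by blast
qed

text \<open>The partial sums grow at least like \<open>n powr (\<gamma> / 2)\<close> by a Potter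
  bound, so the exponent 4 / \<gamma> gives the summable power -2.\<close>

lemma summable_abs_psum_powr:
  assumes rv: "regularly_varying (abs_psum_real c) \<gamma>" and \<gamma>: "\<gamma> > 0"
  shows "summable (\<lambda>n. (1 + abs_psum c n) powr - (4 / \<gamma>))"
proof -
  define a where "a = abs_psum_real c"
  obtain b where b: "\<And>x. x \<ge> b \<Longrightarrow> a x > 0"
    using regularly_varying_pos[OF rv] by (auto simp: eventually_at_top_linorder a_def)
  have "antimono_on {b..} (\<lambda>x. 1 / a x)"
    using b by (auto intro!: monotone_onI divide_left_mono mult_pos_pos monoD[OF mono_abs_psum_real, folded a_def]
        simp: a_def)
  then obtain C x0 where C: "C > 0" "x0 > 0" "\<And>x. x \<ge> x0 \<Longrightarrow> 1 / a x > 0"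
    "\<And>y. y \<ge> 1 \<Longrightarrow> 1 / a (y * x0) \<le> C * y powr - (\<gamma> / 2) * (1 / a x0)"
    using regularly_varying_potter[OF regularly_varying_inverse[OF rv], of b "- (\<gamma> / 2)"] \<gamma>
    unfolding a_def by auto
  define B where "B = C * x0 powr (\<gamma> / 2) / a x0"
  have B: "B > 0" using C(1,2) C(3)[of x0] by (simp add: B_def)
  define N where "N = nat \<lceil>x0\<rceil> + 1"
  have bound: "(1 + abs_psum c n) powr - (4 / \<gamma>) \<le> B powr (4 / \<gamma>) * real n powr - 2" if n: "n \<ge> N" for n
  proof -
    have nx: "real n \<ge> x0" "n > 0" using n by (auto simp: N_def) linarith
    have "1 / a (real n) \<le> C * (real n / x0) powr - (\<gamma> / 2) * (1 / a x0)"
      using C(4)[of "real n / x0"] C(2) nx by simp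
    also have "(real n / x0) powr - (\<gamma> / 2) = x0 powr (\<gamma> / 2) * real n powr - (\<gamma> / 2)"
      using C(2) nx by (simp add: powr_divide powr_minus field_simps)
    finally have 1: "1 / a (real n) \<le> B * real n powr - (\<gamma> / 2)" by (simp add: B_def mult_ac)
    have an: "a (real n) = abs_psum c n" by (simp add: a_def)
    have p: "abs_psum c n > 0" using C(3)[of "real n"] nx by (simp add: an)
    have "(1 + abs_psum c n) powr - (4 / \<gamma>) \<le> abs_psum c n powr - (4 / \<gamma>)"
      using p \<gamma> by (intro powr_mono2') auto
    also have "\<dots> = (1 / abs_psum c n) powr (4 / \<gamma>)" using p by (simp add: powr_divide powr_minus_divide)
    also have "\<dots> \<le> (B * real n powr - (\<gamma> / 2)) powr (4 / \<gamma>)"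
      using 1 p \<gamma> unfolding an by (intro powr_mono2) auto
    also have "\<dots> = B powr (4 / \<gamma>) * real n powr - 2"
      using B \<gamma> by (simp add: powr_mult powr_powr)
    finally show ?thesis .
  qed
  have "summable (\<lambda>n. real n powr - 2)" by (subst summable_real_powr_iff) simp
  from summable_mult[OF this, of "B powr (4 / \<gamma>)"] show ?thesis
    by (rule summable_comparison_test'[where N = N]) (use bound in auto)
qed

lemma (in prob_space) cdf_distr_eq_prob:
  fixes X :: "'a \<Rightarrow> real"
  assumes [measurable]: "random_variable borel X"
  shows "1 - cdf (distr M borel X) x = prob {\<omega> \<in> space M. X \<omega> > x}"
    and "cdf (distr M borel X) x = prob {\<omega> \<in> space M. X \<omega> \<le> x}"
proof -
  show 1: "cdf (distr M borel X) x = prob {\<omega> \<in> space M. X \<omega> \<le> x}"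
    by (simp add: cdf_def measure_distr vimage_def Int_def conj_commute)
  have "{\<omega> \<in> space M. X \<omega> > x} = space M - {\<omega> \<in> space M. X \<omega> \<le> x}" by auto
  then show "1 - cdf (distr M borel X) x = prob {\<omega> \<in> space M. X \<omega> > x}"
    unfolding 1 by (simp add: prob_compl)
qed

text \<open>For \<open>x > 0\<close> the two half-lines lie on opposite sides of 0 and are disjoint.
  With \<open>l = 0\<close> the second condition reads \<open>x \<le> 0\<close> and never holds,
  hence the case distinction.\<close>

lemma (in prob_space) prob_jump_set:
  fixes X :: "'a \<Rightarrow> real"
  assumes [measurable]: "random_variable borel X" and x: "x > 0" and u: "u > 0" and l: "l \<le> 0"
  defines "F \<equiv> cdf (distr M borel X)"
  shows "prob {\<omega> \<in> space M. X \<omega> \<in> jump_set u l x} = (1 - F (1 / u * x)) + (if l < 0 then F (- (1 / (- l) * x)) else 0)"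
proof (cases "l < 0")
  case True
  have "{\<omega> \<in> space M. X \<omega> \<in> jump_set u l x} =
      {\<omega> \<in> space M. X \<omega> > 1 / u * x} \<union> {\<omega> \<in> space M. X \<omega> \<le> - (1 / (- l) * x)}"
    using True u by (auto simp: jump_set_def field_simps)
  moreover have "prob ({\<omega> \<in> space M. X \<omega> > 1 / u * x} \<union> {\<omega> \<in> space M. X \<omega> \<le> - (1 / (- l) * x)}) =
      prob {\<omega> \<in> space M. X \<omega> > 1 / u * x} + prob {\<omega> \<in> space M. X \<omega> \<le> - (1 / (- l) * x)}"
  proof (rule finite_measure_Union)
    have "1 / u * x > 0" "- (1 / (- l) * x) < 0" using u x True by (auto simp: field_simps)
    then show "{\<omega> \<in> space M. X \<omega> > 1 / u * x} \<inter> {\<omega> \<in> space M. X \<omega> \<le> - (1 / (- l) * x)} = {}" by fastforce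
  qed measurable
  moreover have "1 - F (1 / u * x) = prob {\<omega> \<in> space M. X \<omega> > 1 / u * x}"
    "F (- (1 / (- l) * x)) = prob {\<omega> \<in> space M. X \<omega> \<le> - (1 / (- l) * x)}"
    unfolding F_def by (rule cdf_distr_eq_prob; measurable)+
  ultimately show ?thesis using True by (simp only: if_True)
next
  case False
  then have "{\<omega> \<in> space M. X \<omega> \<in> jump_set u l x} = {\<omega> \<in> space M. X \<omega> > 1 / u * x}"
    using x l u by (auto simp: jump_set_def field_simps)
  moreover have "1 - F (1 / u * x) = prob {\<omega> \<in> space M. X \<omega> > 1 / u * x}"
    unfolding F_def by (rule cdf_distr_eq_prob) measurable
  ultimately show ?thesis using False by (simp only: if_False add_0_right)
qed

section \<open>The maximum of the process\<close>

lemma abs_psum_le_sum_add: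
  fixes c :: "nat \<Rightarrow> real"
  assumes "\<And>n. n \<ge> N \<Longrightarrow> c n \<ge> 0"
  shows "abs_psum c n \<le> (\<Sum>i<n. c i) + (\<Sum>i<N. \<bar>c i\<bar> - c i)"
proof -
  have "abs_psum c n - (\<Sum>i<n. c i) = (\<Sum>i<n. \<bar>c i\<bar> - c i)" by (simp add: abs_psum_def sum_subtractf)
  also have "\<dots> \<le> (\<Sum>i\<in>{..<n} \<union> {..<N}. \<bar>c i\<bar> - c i)" by (intro sum_mono2) auto
  also have "\<dots> = (\<Sum>i<N. \<bar>c i\<bar> - c i)" using assms by (intro sum.mono_neutral_right) auto
  finally show ?thesis by simp
qed

text \<open>Regular variation at the scales \<open>1 / u\<close> and \<open>1 / (- l)\<close>
  produces the powers of the extreme coefficients. The case \<open>l = 0\<close> is separate because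
  \<open>1 / 0 = 0\<close> would put a spurious \<open>F 0\<close> into the formula; its limit is
  consistent since \<open>0 powr \<alpha> = 0\<close>.\<close>

lemma jump_set_tail_limit:
  fixes F :: "real \<Rightarrow> real"
  assumes rv: "regularly_varying (\<lambda>t. 1 - F t) (- \<alpha>)" and r: "((\<lambda>t. F (- t) / (1 - F t)) \<longlongrightarrow> r) at_top"
    and u: "u > 0" and l: "l \<le> 0"
  shows "((\<lambda>t. ((1 - F (1 / u * t)) + (if l < 0 then F (- (1 / (- l) * t)) else 0)) / (1 - F t))
    \<longlongrightarrow> u powr \<alpha> + (- l) powr \<alpha> * r) at_top"
proof -
  have upper: "((\<lambda>t. (1 - F (1 / u * t)) / (1 - F t)) \<longlongrightarrow> u powr \<alpha>) at_top"
    using regularly_varying_ratio[OF rv, of "1 / u"] u by (simp add: powr_divide powr_minus)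
  have lower: "((\<lambda>t. (if l < 0 then F (- (1 / (- l) * t)) else 0) / (1 - F t)) \<longlongrightarrow> (- l) powr \<alpha> * r) at_top"
  proof (cases "l < 0")
    case True
    define s where "s = 1 / (- l)"
    have s: "s > 0" using True by (simp add: s_def)
    have at: "filterlim (\<lambda>t. s * t) at_top at_top"
      by (rule filterlim_tendsto_pos_mult_at_top[OF tendsto_const s filterlim_ident])
    have "((\<lambda>t. (F (- (s * t)) / (1 - F (s * t))) * ((1 - F (s * t)) / (1 - F t))) \<longlongrightarrow> r * s powr - \<alpha>) at_top"
      by (intro tendsto_mult filterlim_compose[OF r at] regularly_varying_ratio[OF rv s])
    moreover have "\<forall>\<^sub>F t in at_top. (F (- (s * t)) / (1 - F (s * t))) * ((1 - F (s * t)) / (1 - F t)) = F (- (s * t)) / (1 - F t)"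
      using eventually_compose_filterlim[OF regularly_varying_pos[OF rv] at] by eventually_elim auto
    ultimately have "((\<lambda>t. F (- (s * t)) / (1 - F t)) \<longlongrightarrow> r * s powr - \<alpha>) at_top"
      by (rule Lim_transform_eventually)
    moreover have "s powr - \<alpha> = (- l) powr \<alpha>"
      unfolding s_def using True by (subst powr_divide) (auto simp: powr_minus inverse_eq_divide)
    ultimately show ?thesis using True by (simp add: s_def mult.commute)
  qed (use l in simp)
  from tendsto_add[OF upper lower] show ?thesis by (simp add: add_divide_distrib)
qed

theorem theorem2p2p1:
  fixes g :: "real \<Rightarrow> real" and c :: "nat \<Rightarrow> real"
    and F Fstar U :: "real \<Rightarrow> real"
    and \<alpha> \<gamma> \<mu> :: real
    and P :: "'a measure" and X :: "nat \<Rightarrow> 'a \<Rightarrow> real"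
  assumes g_analytic: "\<And>x. -1 < x \<Longrightarrow> x < 1 \<Longrightarrow> (\<lambda>i. c i * x ^ i) sums g x"
    and c_rv: "regularly_varying_seq c (\<gamma> - 1)"
    and c_not_summable: "\<not> summable c"
    and c_null: "c \<longlonglongrightarrow> 0"
    and prob: "prob_space P"
    and X_indep: "prob_space.indep_vars P (\<lambda>_. borel) X {1..}"
    and X_distr: "\<And>n. n \<ge> 1 \<Longrightarrow> cdf (distr P borel (X n)) = F"
    and X_integrable: "integrable P (X 1)"
    and mean: "prob_space.expectation P (X 1) = \<mu>"
    and mean_neg: "\<mu> < 0"
    and alpha_pos: "0 < \<alpha>"
    and F_rv: "regularly_varying (\<lambda>t. 1 - F t) (- \<alpha>)"
    and Fstar: "Fstar = cdf (distr P borel (\<lambda>\<omega>. \<bar>X 1 \<omega>\<bar>))"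
    and balance_upper: "\<exists>p>0. ((\<lambda>t. (1 - F t) / (1 - Fstar t)) \<longlongrightarrow> p) at_top"
    and balance_lower: "\<exists>q\<ge>0. ((\<lambda>t. F (- t) / (1 - Fstar t)) \<longlongrightarrow> q) at_top"
    and gamma_gt: "1 / \<alpha> < \<gamma>" and gamma_less: "\<gamma> < 1"
    and U_rv: "regularly_varying U (1 / \<gamma>)"
    and U_dom: "\<forall>\<^sub>F t in at_top. 1 - 1 / U t \<in> {-1<..<1}"
    and U_g: "(\<lambda>t. g (1 - 1 / U t)) \<sim>[at_top] (\<lambda>t. t)"
  shows "(\<lambda>t. measure P {\<omega> \<in> space P. gF_maximum c X \<omega> > ereal t}) \<sim>[at_top]
    (\<lambda>t. 1 / \<gamma> * Beta (1 / \<gamma>) (\<alpha> - 1 / \<gamma>) * (Gamma (1 + \<gamma>) / (- \<mu>)) powr (1 / \<gamma>) * U t *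
       (coeff_sup c powr \<alpha> * (1 - F t) + (- coeff_inf c) powr \<alpha> * F (- t)))"
proof -
  interpret prob_space P by (rule prob)
  define m where "m = - \<mu>"
  have m: "m > 0" using mean_neg by (simp add: m_def)
  have \<gamma>: "\<gamma> > 0" using gamma_gt alpha_pos by (smt (verit) divide_pos_pos)
  have \<alpha>\<gamma>: "1 / \<gamma> < \<alpha>" using gamma_gt alpha_pos \<gamma> by (simp add: field_simps)
  moreover have "1 < 1 / \<gamma>" using gamma_less \<gamma> by simp
  \<comment> \<open>This leaves room for a moment order strictly between 1 and \<alpha>.\<close>
  ultimately have \<alpha>: "\<alpha> > 1" by linarith
  have c_pos: "\<forall>\<^sub>F n in sequentially. c n > 0" using c_rv by (simp add: regularly_varying_seq_def)
  then obtain N where N: "\<And>n. n \<ge> N \<Longrightarrow> c n > 0" by (auto simp: eventually_sequentially)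
  have "Bseq c" using c_null by (intro convergent_imp_Bseq convergentI)
  then obtain G where G: "G > 0" "\<And>i. \<bar>c i\<bar> \<le> G" by (auto simp: Bseq_def)
  define D where "D = (\<Sum>i<N. \<bar>c i\<bar> - c i)"
  define u where "u = coeff_sup c"
  define l where "l = coeff_inf c"
  obtain iu where iu: "c iu = u"
    using SUP_attained_null_seq(1)[OF c_null N[OF order_refl]] by (auto simp: u_def coeff_sup_def)
  have u_ge: "c i \<le> u" for i
    using SUP_attained_null_seq(2)[OF c_null N[OF order_refl]] by (simp add: u_def coeff_sup_def)
  have u: "u > 0" using N[OF order_refl] u_ge[of N] by linarith
  have l: "l \<le> 0" "\<And>i. l \<le> c i" using coeff_inf_attained[OF c_null] by (auto simp: l_def)
  obtain il where il: "l < 0 \<Longrightarrow> c il = l" using coeff_inf_attained(3)[OF c_null] by (auto simp: l_def)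

  define a where "a = abs_psum_real c"
  have a_rv: "regularly_varying a \<gamma>"
    using abs_psum_real_regularly_varying[OF c_rv c_not_summable G(2)] \<gamma> by (simp add: a_def)
  have nat_at: "filterlim (\<lambda>x::real. nat \<lfloor>x\<rfloor>) at_top at_top"
    by (intro filterlim_compose[OF filterlim_nat_sequentially filterlim_floor_sequentially])
  have a_at: "filterlim a at_top at_top"
    unfolding a_def by (rule filterlim_compose[OF abs_psum_at_top[OF c_not_summable] nat_at])

  \<comment> \<open>From \<open>1 - 1 / U t > -1\<close> and \<open>U t > 0\<close>; this is the
    uniform lower bound from which the doubling argument starts.\<close>
  have "\<forall>\<^sub>F t in at_top. U t \<ge> 1 / 2"
    using U_dom regularly_varying_pos[OF U_rv] by eventually_elim (auto simp: field_simps)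
  then have U_at: "filterlim U at_top at_top"
    using \<gamma> by (intro regularly_varying_at_top[OF U_rv, of "1 / 2"]) auto
  have \<Gamma>: "Gamma (1 + \<gamma>) > 0" using \<gamma> by (intro Gamma_real_pos) auto
  have lim_a: "((\<lambda>t. t / a (U t)) \<longlongrightarrow> Gamma (1 + \<gamma>)) at_top"
  proof -
    have 1: "((\<lambda>t. g (1 - 1 / U t) / a (U t)) \<longlongrightarrow> Gamma (1 + \<gamma>)) at_top"
      unfolding a_def
      by (rule filterlim_compose[OF power_series_asymptotics[OF g_analytic a_rv[unfolded a_def] \<gamma> gamma_less G(2) c_pos a_at[unfolded a_def]] U_at])
    have 2: "((\<lambda>t. g (1 - 1 / U t) / t) \<longlongrightarrow> 1) at_top"
    proof (rule asymp_equivD_strong[OF U_g])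
      show "\<forall>\<^sub>F t in at_top. g (1 - 1 / U t) \<noteq> 0 \<or> t \<noteq> 0"
        using eventually_gt_at_top[of 0] by eventually_elim simp
    qed
    \<comment> \<open>The Abelian asymptotics and the defining property of \<open>U\<close> are
      divided, so that \<open>g\<close> cancels and \<open>t\<close> is compared directly with the
      partial sums at \<open>U t\<close>.\<close>
    have "((\<lambda>t. (g (1 - 1 / U t) / a (U t)) / (g (1 - 1 / U t) / t)) \<longlongrightarrow> Gamma (1 + \<gamma>) / 1) at_top"
      by (intro tendsto_divide 1 2) auto
    moreover have "\<forall>\<^sub>F t in at_top. (g (1 - 1 / U t) / a (U t)) / (g (1 - 1 / U t) / t) = t / a (U t)"
    proof -
      have "\<forall>\<^sub>F t in at_top. g (1 - 1 / U t) / t > 0" by (rule order_tendstoD(1)[OF 2]) simp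
      then show ?thesis by eventually_elim auto
    qed
    ultimately have "((\<lambda>t. t / a (U t)) \<longlongrightarrow> Gamma (1 + \<gamma>) / 1) at_top" by (rule Lim_transform_eventually)
    then show ?thesis by simp
  qed

  define Z where "Z = (\<lambda>j. X (Suc j))"
  have X_meas [measurable]: "random_variable borel (X n)" if "n \<ge> 1" for n
    using X_indep that by (auto simp: indep_vars_def)
  have Z_meas [measurable]: "random_variable borel (Z j)" for j by (simp add: Z_def X_meas)
  have X1: "X 1 = Z 0" by (simp add: Z_def)
  have F_eq: "F = cdf (distr P borel (Z 0))" using X_distr[of 1] by (simp add: Z_def)
  have Z_ident: "distr P borel (Z j) = distr P borel (Z 0)" for j
  proof (rule cdf_unique)
    show "cdf (distr P borel (Z j)) = cdf (distr P borel (Z 0))"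
      using X_distr[of "Suc j"] F_eq by (simp add: Z_def)
  qed (rule real_distribution_distr[OF Z_meas])+
  have "range Suc = {1..}" by (auto simp: image_def) presburger
  then have Z_indep: "indep_vars (\<lambda>_. borel) Z UNIV"
    unfolding Z_def using X_indep by (intro indep_vars_reindex_inj[of Suc UNIV "\<lambda>_. borel" X]) auto

  obtain pb where pb: "pb > 0" "((\<lambda>t. (1 - F t) / (1 - Fstar t)) \<longlongrightarrow> pb) at_top" using balance_upper by auto
  obtain qb where qb: "qb \<ge> 0" "((\<lambda>t. F (- t) / (1 - Fstar t)) \<longlongrightarrow> qb) at_top" using balance_lower by auto
  have F_pos: "\<forall>\<^sub>F t in at_top. 1 - F t > 0" by (rule regularly_varying_pos[OF F_rv])
  have star_pos: "\<forall>\<^sub>F t in at_top. (1 - F t) / (1 - Fstar t) > 0" by (rule order_tendstoD(1)[OF pb(2) pb(1)])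
  have star_lim: "((\<lambda>t. (1 - Fstar t) / (1 - F t)) \<longlongrightarrow> 1 / pb) at_top"
    using tendsto_inverse[OF pb(2)] pb(1) by (simp add: field_simps)
  \<comment> \<open>Tail balance is stated relative to the two-sided tail; the quotient of its
    limits expresses the lower tail relative to the upper one. It may be 0.\<close>
  define r where "r = qb / pb"
  have r: "r \<ge> 0" using pb qb by (simp add: r_def)
  have r_lim: "((\<lambda>t. F (- t) / (1 - F t)) \<longlongrightarrow> r) at_top"
  proof -
    have "((\<lambda>t. (F (- t) / (1 - Fstar t)) / ((1 - F t) / (1 - Fstar t))) \<longlongrightarrow> r) at_top"
      unfolding r_def using pb by (intro tendsto_divide qb pb) auto
    moreover have "\<forall>\<^sub>F t in at_top. (F (- t) / (1 - Fstar t)) / ((1 - F t) / (1 - Fstar t)) = F (- t) / (1 - F t)"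
      using star_pos by eventually_elim auto
    ultimately show ?thesis by (rule Lim_transform_eventually)
  qed

  \<comment> \<open>The common limit, relative to the upper tail, of the jump probability and of the
    tail combination in the claim. The two are therefore interchangeable.\<close>
  define \<kappa> where "\<kappa> = u powr \<alpha> + (- l) powr \<alpha> * r"
  have \<kappa>: "\<kappa> > 0" using u r by (simp add: \<kappa>_def add_pos_nonneg)
  define Q where "Q = (\<lambda>x. prob {\<omega> \<in> space P. Z 0 \<omega> \<in> jump_set u l x})"
  have Q_lim: "((\<lambda>t. Q t / (1 - F t)) \<longlongrightarrow> \<kappa>) at_top"
  proof -
    have "\<forall>\<^sub>F t in at_top. ((1 - F (1 / u * t)) + (if l < 0 then F (- (1 / (- l) * t)) else 0)) / (1 - F t) = Q t / (1 - F t)"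
      using eventually_gt_at_top[of 0]
    proof eventually_elim
      case (elim t)
      show ?case unfolding Q_def F_eq prob_jump_set[OF Z_meas elim u l(1)] ..
    qed
    with jump_set_tail_limit[OF F_rv r_lim u l(1), folded \<kappa>_def] show ?thesis by (rule Lim_transform_eventually)
  qed
  have rhs_lim: "((\<lambda>t. (u powr \<alpha> * (1 - F t) + (- l) powr \<alpha> * F (- t)) / (1 - F t)) \<longlongrightarrow> \<kappa>) at_top"
  proof -
    have "((\<lambda>t. u powr \<alpha> + (- l) powr \<alpha> * (F (- t) / (1 - F t))) \<longlongrightarrow> \<kappa>) at_top"
      unfolding \<kappa>_def by (intro tendsto_intros r_lim)
    moreover have "\<forall>\<^sub>F t in at_top. u powr \<alpha> + (- l) powr \<alpha> * (F (- t) / (1 - F t)) =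
        (u powr \<alpha> * (1 - F t) + (- l) powr \<alpha> * F (- t)) / (1 - F t)"
      using F_pos by eventually_elim (simp add: add_divide_distrib)
    ultimately show ?thesis by (rule Lim_transform_eventually)
  qed

  define H where "H = (\<lambda>x. prob {\<omega> \<in> space P. \<bar>Z 0 \<omega>\<bar> > x})"
  have H: "1 - Fstar x = H x" for x
    unfolding Fstar H_def X1 by (rule cdf_distr_eq_prob) measurable
  have "\<forall>\<^sub>F t in at_top. H t / (1 - F t) < 1 / pb + 1"
    using order_tendstoD(2)[OF star_lim, of "1 / pb + 1"] by (simp add: H)
  with F_pos have "\<forall>\<^sub>F t in at_top. H t \<le> (1 / pb + 1) * (1 - F t)"
    by eventually_elim (auto simp: pos_divide_less_eq)
  moreover have "\<forall>\<^sub>F t in at_top. 1 - F t \<le> 2 / \<kappa> * Q t"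
  proof -
    have "\<forall>\<^sub>F t in at_top. Q t / (1 - F t) > \<kappa> / 2" using \<kappa> by (intro order_tendstoD(1)[OF Q_lim]) auto
    with F_pos show ?thesis by eventually_elim (use \<kappa> in \<open>auto simp: field_simps\<close>)
  qed
  ultimately have "\<forall>\<^sub>F t in at_top. H t \<le> (1 / pb + 1) * (1 - F t) \<and> H t \<le> (1 / pb + 1) * (2 / \<kappa>) * Q t"
  proof eventually_elim
    case (elim t)
    have "(1 / pb + 1) * (1 - F t) \<le> (1 / pb + 1) * (2 / \<kappa> * Q t)" using elim pb by (intro mult_left_mono) auto
    also have "\<dots> = (1 / pb + 1) * (2 / \<kappa>) * Q t" by (simp only: mult.assoc)
    finally show ?case using elim by linarith
  qed
  then obtain t0 where t0: "\<And>t. t \<ge> t0 \<Longrightarrow> H t \<le> (1 / pb + 1) * (1 - F t) \<and> H t \<le> (1 / pb + 1) * (2 / \<kappa>) * Q t"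
    by (auto simp: eventually_at_top_linorder)

  \<comment> \<open>Halfway between 1 and \<alpha>, capped at 2.\<close>
  define p where "p = min 2 ((1 + \<alpha>) / 2)"
  have p: "1 < p" "p \<le> 2" "p < \<alpha>" using \<alpha> by (auto simp: p_def min_def field_simps)
  have F_antimono: "antimono (\<lambda>t. 1 - F t)"
    unfolding F_eq by (intro antimonoI diff_left_mono finite_borel_measure.cdf_nondecreasing
        real_distribution.finite_borel_measure_M real_distribution_distr Z_meas)
  have moment: "integrable P (\<lambda>\<omega>. \<bar>Z 0 \<omega>\<bar> powr p)"
  proof -
    define s where "s = (p + \<alpha>) / 2"
    have s: "p < s" "s < \<alpha>" using p by (auto simp: s_def)
    obtain C t1 where C: "\<And>t. t \<ge> t1 \<Longrightarrow> 1 - F t \<le> C * t powr - s"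
      using regularly_varying_antimono_tail_bound[OF F_rv F_antimono s(2)] by auto
    show ?thesis
    proof (rule integrable_powr_of_tail[OF Z_meas _ s(1)])
      fix t assume t: "t \<ge> max t0 t1"
      then have "H t \<le> (1 / pb + 1) * (1 - F t)" using t0 by simp
      also have "\<dots> \<le> (1 / pb + 1) * (C * t powr - s)" using t C pb by (intro mult_left_mono) auto
      finally show "prob {\<omega> \<in> space P. \<bar>Z 0 \<omega>\<bar> > t} \<le> ((1 / pb + 1) * C) * t powr - s" by (simp add: H_def)
    qed (use p in auto)
  qed

  interpret sj: single_jump_process c G D m u l iu il P Z p
  proof unfold_locales
    show "abs_psum c n \<le> (\<Sum>i<n. c i) + D" for n
      unfolding D_def using N by (intro abs_psum_le_sum_add) (auto intro: less_imp_le)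
  qed (use G m u u_ge iu l il Z_indep Z_ident X_integrable mean p moment in \<open>auto simp: Z_def m_def\<close>)
  have jp: "sj.jump_prob = Q" by (simp add: fun_eq_iff sj.jump_prob_def Q_def)
  have tt: "sj.two_sided_tail = H" by (simp add: fun_eq_iff sj.two_sided_tail_def H_def)
  have Q_rv: "regularly_varying Q (- \<alpha>)" by (rule regularly_varying_of_ratio_tendsto[OF F_rv \<kappa> Q_lim])
  have Q_antimono: "antimono Q" using sj.jump_prob_antimono by (simp add: jp)
  have Q_pos: "Q t > 0" for t using sj.jump_prob_pos[of "- \<alpha>" t] Q_rv by (simp add: jp)

  define \<Lambda> where "\<Lambda> = (m / Gamma (1 + \<gamma>)) powr - (1 / \<gamma>) * (1 / \<gamma> * Beta (1 / \<gamma>) (\<alpha> - 1 / \<gamma>))"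
  note tails = shifted_tail_sum_asymptotics[OF Q_rv Q_antimono Q_pos a_rv[unfolded a_def] U_at lim_a[unfolded a_def] \<Gamma> m \<gamma> \<alpha>\<gamma>]
  have js_eq: "sj.jump_sum = (\<lambda>t. \<Sum>k. Q (t + m * abs_psum c (Suc k)))"
    by (simp add: fun_eq_iff sj.jump_sum_def jp)
  have js_lim: "((\<lambda>t. sj.jump_sum t / (U t * Q t)) \<longlongrightarrow> \<Lambda>) at_top"
    using tails(2) by (simp add: js_eq \<Lambda>_def)
  have "Beta (1 / \<gamma>) (\<alpha> - 1 / \<gamma>) > 0"
    using \<gamma> \<alpha>\<gamma> alpha_pos by (auto simp: Beta_def intro!: mult_pos_pos divide_pos_pos Gamma_real_pos)
  moreover have "(m / Gamma (1 + \<gamma>)) powr - (1 / \<gamma>) > 0"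
    using divide_pos_pos[OF m \<Gamma>] by (metis less_irrefl powr_gt_zero)
  ultimately have \<Lambda>: "\<Lambda> > 0" unfolding \<Lambda>_def using \<gamma> by (intro mult_pos_pos) auto

  have F_lim: "(F \<longlongrightarrow> 1) at_top"
    unfolding F_eq by (intro real_distribution.cdf_lim_at_top_prob real_distribution_distr Z_meas)
  have Q_null: "(Q \<longlongrightarrow> 0) at_top"
  proof -
    have "((\<lambda>t. Q t / (1 - F t) * (1 - F t)) \<longlongrightarrow> \<kappa> * (1 - 1)) at_top" by (intro tendsto_intros Q_lim F_lim)
    moreover have "\<forall>\<^sub>F t in at_top. Q t / (1 - F t) * (1 - F t) = Q t" using F_pos by eventually_elim auto
    ultimately have "(Q \<longlongrightarrow> \<kappa> * (1 - 1)) at_top" by (rule Lim_transform_eventually)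
    then show ?thesis by simp
  qed
  \<comment> \<open>Dominated convergence for series: since \<open>Q\<close> decreases, the summands
    at one fixed level \<open>t1\<close> dominate those at all higher levels.\<close>
  have js_null: "(sj.jump_sum \<longlongrightarrow> 0) at_top"
  proof -
    obtain t1 where t1: "summable (\<lambda>k. Q (t1 + m * abs_psum c (Suc k)))"
      using tails(1) by (auto simp: eventually_at_top_linorder)
    have "((\<lambda>t. \<Sum>k. Q (t + m * abs_psum c (Suc k))) \<longlongrightarrow> (\<Sum>k::nat. 0)) at_top"
    proof (rule tannerys_theorem[THEN conjunct2, THEN conjunct2])
      fix k
      have "filterlim (\<lambda>t::real. t + m * abs_psum c (Suc k)) at_top at_top"
        by (rule filterlim_at_top_mono[OF filterlim_ident])
          (use m abs_psum_nonneg[of c "Suc k"] in \<open>auto intro!: always_eventually mult_nonneg_nonneg\<close>)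
      from filterlim_compose[OF Q_null this]
      show "((\<lambda>t. Q (t + m * abs_psum c (Suc k))) \<longlongrightarrow> 0) at_top" .
    next
      have "\<forall>\<^sub>F x in (at_top :: nat filter) \<times>\<^sub>F (at_top :: real filter). True \<and> snd x \<ge> t1"
        by (rule eventually_prodI) (auto intro: eventually_ge_at_top)
      then show "\<forall>\<^sub>F (k, t) in at_top \<times>\<^sub>F at_top. norm (Q (t + m * abs_psum c (Suc k))) \<le> Q (t1 + m * abs_psum c (Suc k))"
        by (rule eventually_mono) (use Q_antimono Q_pos in \<open>auto simp: monotone_def less_imp_le\<close>)
    qed (use t1 in auto)
    then show ?thesis by (simp add: js_eq)
  qed

  have exceed: "((\<lambda>t. prob (sj.exceed t) / sj.jump_sum t) \<longlongrightarrow> 1) at_top"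
  proof (rule sj.exceed_asymptotics)
    show "regularly_varying sj.jump_prob (- \<alpha>)" using Q_rv by (simp add: jp)
    show "\<alpha> > 0" by (rule alpha_pos)
    show "4 / \<gamma> > 0" using \<gamma> by simp
    show "summable (\<lambda>n. (1 + abs_psum c n) powr - (4 / \<gamma>))"
      using a_rv \<gamma> unfolding a_def by (rule summable_abs_psum_powr)
    show "sj.two_sided_tail x \<le> (1 / pb + 1) * (2 / \<kappa>) * sj.jump_prob x" if "x \<ge> t0" for x
      using t0[OF that] by (simp add: jp tt)
    show "\<forall>\<^sub>F t in at_top. summable (\<lambda>k. sj.jump_prob (t + m * abs_psum c (Suc k)))"
      using tails(1) by (simp add: jp)
  qed (rule js_null)
  \<comment> \<open>A supremum strictly exceeds a level iff some member does, so the extended-real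
    maximum reduces to an event about finite sums.\<close>
  have exceed_eq: "sj.exceed t = {\<omega> \<in> space P. gF_maximum c X \<omega> > ereal t}" for t
    unfolding sj.exceed_def gF_maximum_def less_SUP_iff by (simp add: gF_process_eq Z_def)

  have const: "\<Lambda> = 1 / \<gamma> * Beta (1 / \<gamma>) (\<alpha> - 1 / \<gamma>) * (Gamma (1 + \<gamma>) / (- \<mu>)) powr (1 / \<gamma>)"
  proof -
    have "(m / Gamma (1 + \<gamma>)) powr - (1 / \<gamma>) = (Gamma (1 + \<gamma>) / m) powr (1 / \<gamma>)"
      using m \<Gamma> by (simp add: powr_divide powr_minus field_simps)
    then show ?thesis by (simp add: \<Lambda>_def m_def)
  qed
  define R where "R = (\<lambda>t. u powr \<alpha> * (1 - F t) + (- l) powr \<alpha> * F (- t))"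
  \<comment> \<open>A telescoping product: exceedance to jump sum, jump sum to
    \<open>U t * Q t\<close>, and \<open>Q\<close> to the tail combination \<open>R\<close> through
    the upper tail.\<close>
  have "((\<lambda>t. (prob (sj.exceed t) / sj.jump_sum t) * (sj.jump_sum t / (U t * Q t)) *
      ((Q t / (1 - F t)) / (R t / (1 - F t))) / \<Lambda>) \<longlongrightarrow> 1 * \<Lambda> * (\<kappa> / \<kappa>) / \<Lambda>) at_top"
    unfolding R_def using \<kappa> \<Lambda> by (intro tendsto_intros exceed js_lim Q_lim rhs_lim) auto
  moreover have "\<forall>\<^sub>F t in at_top. (prob (sj.exceed t) / sj.jump_sum t) * (sj.jump_sum t / (U t * Q t)) *
      ((Q t / (1 - F t)) / (R t / (1 - F t))) / \<Lambda> = prob (sj.exceed t) / (\<Lambda> * U t * R t)"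
  proof -
    have "\<forall>\<^sub>F t in at_top. sj.jump_sum t / (U t * Q t) > 0" by (rule order_tendstoD(1)[OF js_lim \<Lambda>])
    then show ?thesis using F_pos
    proof eventually_elim
      case (elim t)
      have "sj.jump_sum t \<noteq> 0" using elim by auto
      then show ?case using elim Q_pos[of t] by simp
    qed
  qed
  ultimately have "((\<lambda>t. prob (sj.exceed t) / (\<Lambda> * U t * R t)) \<longlongrightarrow> 1 * \<Lambda> * (\<kappa> / \<kappa>) / \<Lambda>) at_top"
    by (rule Lim_transform_eventually)
  then have "((\<lambda>t. prob (sj.exceed t) / (\<Lambda> * U t * R t)) \<longlongrightarrow> 1) at_top" using \<kappa> \<Lambda> by simp
  then have "(\<lambda>t. prob (sj.exceed t)) \<sim>[at_top] (\<lambda>t. \<Lambda> * U t * R t)" by (rule asymp_equivI')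
  then show ?thesis unfolding exceed_eq const R_def u_def l_def .
qed

end
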